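(* Let $E$ be a finite extension of $\mathbb{Q}_p$ and $m$ a positive integer. There exists a finite set $\mathcal{E}$ of finite extensions of $E$, depending only on $E$ and $m$, such that every standard subset $X\subset\bar{\mathbb{Q}}_p$ defined over $E$ with $c_E(X)\leq m$ is entirely determined by the sets $X\cap F$, $F\in\mathcal{E}$: that is, if $X,X'\subset\bar{\mathbb{Q}}_p$ are standard subsets defined over $E$ with $c_E(X)\leq m$, $c_E(X')\leq m$ and $X\cap F=X'\cap F$ for all $F\in\mathcal{E}$, then $X=X'$.
   Context: Rational disks: $D(a,r)^-=\{x\in\bar{\mathbb{Q}}_p:|x-a|<r\}$ (open) and $D(a,r)^+=\{x:|x-a|\leq r\}$ (closed), with $a\in\bar{\mathbb{Q}}_p$, $r\in|\bar{\mathbb{Q}}_p^\times|$. A connected standard subset of $\mathbb{P}^1(\bar{\mathbb{Q}}_p)$ is either $D_0\setminus\bigcup_{i=1}^nD_i$ with $D_0$ an open rational disk and $D_1,\dots,D_n$ pairwise disjoint closed rational disks contained in and different from $D_0$, or $\mathbb{P}^1(\bar{\mathbb{Q}}_p)\setminus\bigcup_{i=1}^nD_i$ with $D_i$ pairwise disjoint closed rational disks. A standard subset is a finite disjoint union of connected standard subsets (its connected components). $G_E=\operatorname{Gal}(\bar{\mathbb{Q}}_p/E)$ acts on $\mathbb{P}^1(\bar{\mathbb{Q}}_p)$; a subset is defined over $E$ if it is $G_E$-stable; the field of definition over $E$ of a subset is the fixed field of its stabilizer in $G_E$. $v_E$ is the normalized valuation of $E$ extended to $\bar{\mathbb{Q}}_p$.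 Complexity $c_E$: for a rational disk $D$ (open or closed), let $F$ be its field of definition over $E$, let $s$ be the smallest ramification index $e_{K/F}$ of a finite extension $K/F$ with $K\cap D\neq\emptyset$, and let $t$ be the smallest positive integer such that, for such a $K$, $D$ can be written as $\{x: st\,v_E(x-a)\geq v_E(b)\}$ or $\{x: st\,v_E(x-a)>v_E(b)\}$ with $a,b\in K$; set $c_E(D)=st$ and $c_E(\mathbb{P}^1(\bar{\mathbb{Q}}_p))=0$. For a connected standard subset $D_0\setminus\bigcup_{j=1}^nD_j$ (with $D_0$ an open disk or $\mathbb{P}^1$), $c_E=\sum_{j=0}^nc_E(D_j)$; for a standard subset, $c_E$ is the sum over its connected components. *)

theory Defs
  imports
    "HOL-Analysis.Abstract_Metric_Spaces"
    "HOL-Algebra.Algebraic_Closure_Type"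
    "HOL-Library.Extended_Real"
    "HOL-Library.Disjoint_Sets"
begin

no_notation Polynomials.var (\<open>X\<index>\<close>)

text \<open>
  A type \<open>'a\<close> with a subset \<open>Qp\<close> and a function \<open>av\<close> is (a model of) an algebraic closure of the
  field of \<open>p\<close>-adic numbers: \<open>Qp\<close> is the completion of the rationals for the \<open>p\<close>-adic absolute
  value, the whole type is an algebraic closure of \<open>Qp\<close>, and \<open>av\<close> is the absolute value on it
  extending the \<open>p\<close>-adic one.  Together with the ultrametric inequality, multiplicativity and
  \<open>av p = 1/p\<close> force \<open>av\<close> to be the \<open>p\<close>-adic absolute value on the rationals, so these axioms
  determine \<open>('a, Qp, av)\<close> up to isomorphism.
\<close>

locale padic_closure =
  fixes p :: nat and Qp :: "'a :: field_char_0 set" and av :: "'a \<Rightarrow> real"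
  assumes prime_p: "prime p"
    and closure_Qp: "algebraic_closure (ring_of_type_algebra :: 'a ring) Qp"
    and av_nonneg: "0 \<le> av x"
    and av_eq_0_iff: "av x = 0 \<longleftrightarrow> x = 0"
    and av_mult: "av (x * y) = av x * av y"
    and av_ultrametric: "av (x + y) \<le> max (av x) (av y)"
    and av_p: "av (of_nat p) = 1 / real p"
    and rat_dense: "x \<in> Qp \<Longrightarrow> 0 < e \<Longrightarrow> \<exists>q :: rat. av (x - of_rat q) < e"
    and complete_Qp: "Metric_space.mcomplete Qp (\<lambda>x y. av (x - y))"

definition fin_ext :: "'a :: field set \<Rightarrow> 'a set \<Rightarrow> bool" where
  "fin_ext F K \<longleftrightarrow>
     subfield F (ring_of_type_algebra :: 'a ring) \<and>
     subfield K (ring_of_type_algebra :: 'a ring) \<and>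
     F \<subseteq> K \<and> ring.finite_dimension (ring_of_type_algebra :: 'a ring) F K"

definition galois_group :: "'a :: field set \<Rightarrow> ('a \<Rightarrow> 'a) set" where
  "galois_group E =
     {\<sigma> \<in> ring_iso (ring_of_type_algebra :: 'a ring) (ring_of_type_algebra :: 'a ring).
        \<forall>x\<in>E. \<sigma> x = x}"

text \<open>
  The normalized valuation: minus the logarithm of the absolute value, scaled so that
  the nonzero elements of \<open>E\<close> have value group exactly the integers.
\<close>

definition val_scale :: "('a :: field \<Rightarrow> real) \<Rightarrow> 'a set \<Rightarrow> real" where
  "val_scale av E = (THE c. 0 < c \<and> (\<lambda>x. - c * ln (av x)) ` (E - {0}) = \<int>)"

definition val :: "('a :: field \<Rightarrow> real) \<Rightarrow> 'a set \<Rightarrow> 'a \<Rightarrow> ereal" where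
  "val av E x = (if x = 0 then \<infinity> else ereal (- val_scale av E * ln (av x)))"

definition value_group :: "('a :: field \<Rightarrow> real) \<Rightarrow> 'a set \<Rightarrow> real monoid" where
  "value_group av K = \<lparr>carrier = av ` (K - {0}), monoid.mult = (*), one = 1\<rparr>"

text \<open>The ramification index \<open>e\<^sub>K\<^sub>/\<^sub>F\<close> as the index of the value group of \<open>F\<close> in that of \<open>K\<close>.\<close>

definition ram_index :: "('a :: field \<Rightarrow> real) \<Rightarrow> 'a set \<Rightarrow> 'a set \<Rightarrow> nat" where
  "ram_index av F K = card (rcosets\<^bsub>value_group av K\<^esub> carrier (value_group av F))"


datatype 'a proj_line = Affine 'a | Pt_infinity

definition set_stabilizer :: "'a :: field set \<Rightarrow> 'a proj_line set \<Rightarrow> ('a \<Rightarrow> 'a) set" where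
  "set_stabilizer E X = {\<sigma> \<in> galois_group E. map_proj_line \<sigma> ` X = X}"

definition defined_over :: "'a :: field set \<Rightarrow> 'a proj_line set \<Rightarrow> bool" where
  "defined_over E X \<longleftrightarrow> set_stabilizer E X = galois_group E"

definition field_of_def :: "'a :: field set \<Rightarrow> 'a proj_line set \<Rightarrow> 'a set" where
  "field_of_def E X = {x. \<forall>\<sigma> \<in> set_stabilizer E X. \<sigma> x = x}"

definition rational_open_disk :: "('a :: field \<Rightarrow> real) \<Rightarrow> 'a proj_line set \<Rightarrow> bool" where
  "rational_open_disk av D \<longleftrightarrow>
     (\<exists>a. \<exists>r \<in> av ` (UNIV - {0}). D = Affine ` {x. av (x - a) < r})"

definition rational_closed_disk :: "('a :: field \<Rightarrow> real) \<Rightarrow> 'a proj_line set \<Rightarrow> bool" where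
  "rational_closed_disk av D \<longleftrightarrow>
     (\<exists>a. \<exists>r \<in> av ` (UNIV - {0}). D = Affine ` {x. av (x - a) \<le> r})"

text \<open>
  \<open>D\<^sub>0\<close> is the outer part (an open disk, or the whole projective line) and \<open>\<D>\<close> the set of holes.
  Since the holes are nonempty and pairwise disjoint, a finite set of them is the same as a
  finite family.
\<close>

definition conn_decomp ::
    "('a :: field \<Rightarrow> real) \<Rightarrow> 'a proj_line set \<Rightarrow> 'a proj_line set \<Rightarrow> 'a proj_line set set \<Rightarrow> bool"
  where
  "conn_decomp av X D\<^sub>0 \<D> \<longleftrightarrow>
     (rational_open_disk av D\<^sub>0 \<or> D\<^sub>0 = UNIV) \<and>
     finite \<D> \<and> disjoint \<D> \<and>
     (\<forall>D\<in>\<D>. rational_closed_disk av D \<and> D \<subset> D\<^sub>0) \<and>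
     X = D\<^sub>0 - \<Union>\<D>"

definition conn_standard :: "('a :: field \<Rightarrow> real) \<Rightarrow> 'a proj_line set \<Rightarrow> bool" where
  "conn_standard av X \<longleftrightarrow> (\<exists>D\<^sub>0 \<D>. conn_decomp av X D\<^sub>0 \<D>)"

definition standard_decomp ::
    "('a :: field \<Rightarrow> real) \<Rightarrow> 'a proj_line set \<Rightarrow> 'a proj_line set set \<Rightarrow> bool" where
  "standard_decomp av X \<C> \<longleftrightarrow>
     finite \<C> \<and> disjoint \<C> \<and> (\<forall>C\<in>\<C>. conn_standard av C) \<and> X = \<Union>\<C>"

definition standard :: "('a :: field \<Rightarrow> real) \<Rightarrow> 'a proj_line set \<Rightarrow> bool" where
  "standard av X \<longleftrightarrow> (\<exists>\<C>. standard_decomp av X \<C>)"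


definition disk_s :: "('a :: field \<Rightarrow> real) \<Rightarrow> 'a set \<Rightarrow> 'a proj_line set \<Rightarrow> nat" where
  "disk_s av E D =
     (LEAST s. \<exists>K. fin_ext (field_of_def E D) K \<and> Affine ` K \<inter> D \<noteq> {} \<and>
                   ram_index av (field_of_def E D) K = s)"

text \<open>
  The condition on \<open>t\<close> only depends on the value group of \<open>K\<close>, which is the same for every \<open>K\<close>
  meeting \<open>D\<close> with minimal ramification index; hence it does not matter that \<open>K\<close> is
  quantified existentially.
\<close>

definition disk_t :: "('a :: field \<Rightarrow> real) \<Rightarrow> 'a set \<Rightarrow> 'a proj_line set \<Rightarrow> nat" where
  "disk_t av E D =
     (LEAST t. 0 < t \<and>
        (\<exists>K. fin_ext (field_of_def E D) K \<and> Affine ` K \<inter> D \<noteq> {} \<and>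
             ram_index av (field_of_def E D) K = disk_s av E D \<and>
             (\<exists>a\<in>K. \<exists>b\<in>K.
                D = Affine ` {x. ereal (real (disk_s av E D * t)) * val av E (x - a) \<ge> val av E b} \<or>
                D = Affine ` {x. ereal (real (disk_s av E D * t)) * val av E (x - a) > val av E b})))"

text \<open>For \<open>D\<close> a rational disk or the whole projective line.\<close>

definition disk_complexity ::
    "('a :: field \<Rightarrow> real) \<Rightarrow> 'a set \<Rightarrow> 'a proj_line set \<Rightarrow> nat" where
  "disk_complexity av E D = (if D = UNIV then 0 else disk_s av E D * disk_t av E D)"

text \<open>
  The decomposition of a connected standard subset into an outer part and holes, and that of a
  standard subset into connected components, are unique, so the choices below are immaterial.
\<close>

definition conn_complexity ::
    "('a :: field \<Rightarrow> real) \<Rightarrow> 'a set \<Rightarrow> 'a proj_line set \<Rightarrow> nat" where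
  "conn_complexity av E X =
     (let (D\<^sub>0, \<D>) = (SOME (D\<^sub>0, \<D>). conn_decomp av X D\<^sub>0 \<D>)
      in disk_complexity av E D\<^sub>0 + (\<Sum>D\<in>\<D>. disk_complexity av E D))"

definition std_components :: "('a :: field \<Rightarrow> real) \<Rightarrow> 'a proj_line set \<Rightarrow> 'a proj_line set set" where
  "std_components av X = (SOME \<C>. standard_decomp av X \<C>)"

definition complexity :: "('a :: field \<Rightarrow> real) \<Rightarrow> 'a set \<Rightarrow> 'a proj_line set \<Rightarrow> nat" where
  "complexity av E X = (\<Sum>C\<in>std_components av X. conn_complexity av E C)"

end

theory Submission
  imports Defs
begin

text \<open>
  Crossing the boundary of a disk of a standard subset changes membership, so the disks are determined by the
  subset, and the Galois group permutes them.  Bounded complexity therefore bounds the number of disks, their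
  orbits, and the denominators of their radii; moreover each disk meets a field of bounded ramification.  A point
  of lowest degree in such a disk has bounded degree over \<open>Qp\<close>: polynomials of smaller degree are constant on the
  disk up to factors close to 1, so their absolute values are those of the field of bounded ramification and
  their residues have few conjugates.  If a
  disk with few conjugates contains a point of bounded degree, the average of the conjugates of this point and
  rescaling move the problem into a totally bounded set; adjoining finitely many approximations shrinks the orbit
  of the disk, and by induction all the disks in question meet one finite extension \<open>L\<close>.  If two subsets differ,
  take a smallest disk containing a point of the difference.  After enlarging \<open>L\<close> by a root of \<open>p\<close> and enough
  residues, this disk contains a point of \<open>L\<close> that avoids all the disks not containing it, and this point
  lies in the difference as well.
\<close>

section \<open>Subfields of a field type\<close>

text \<open>The obstacle: complexity bounds the ramification of a field meeting a disk, but not its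
  residue degree. Such fields have unbounded degree over \<open>Qp\<close>, so the finiteness of the
  set of extensions of a given degree does not apply to them. A point of bounded degree exists
  nevertheless because a Galois element moves the relevant residues only through its effect on the
  disk: few conjugate disks force a small residue field, and a count modulo \<open>p\<close> then
  bounds a rank over \<open>Qp\<close>. The counts are crude; only their independence of the
  individual disk matters.

  The average of the conjugates alone is not enough: when \<open>p\<close> divides their number, the
  division costs up to \<open>1 / |n!|\<close> and the average may miss the disk. This loss is the
  reason for the finite approximations.

  One field \<open>L\<close> serves all subsets at once, so the family of extensions in the theorem
  is a singleton.\<close>

locale type_subfield =
  fixes K :: "'a :: field set"
  assumes zero_mem: "0 \<in> K" and one_mem: "1 \<in> K"
    and add_mem: "x \<in> K \<Longrightarrow> y \<in> K \<Longrightarrow> x + y \<in> K"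
    and uminus_mem: "x \<in> K \<Longrightarrow> - x \<in> K"
    and mult_mem: "x \<in> K \<Longrightarrow> y \<in> K \<Longrightarrow> x * y \<in> K"
    and inverse_mem: "x \<in> K \<Longrightarrow> inverse x \<in> K"
begin

lemma diff_mem: "x \<in> K \<Longrightarrow> y \<in> K \<Longrightarrow> x - y \<in> K"
  using add_mem[of x "- y"] uminus_mem[of y] by simp

lemma divide_mem: "x \<in> K \<Longrightarrow> y \<in> K \<Longrightarrow> x / y \<in> K"
  by (simp add: divide_inverse mult_mem inverse_mem)

lemma power_mem: "x \<in> K \<Longrightarrow> x ^ n \<in> K"
  by (induction n) (auto simp: one_mem mult_mem)

lemma sum_mem: "(\<And>i. i \<in> I \<Longrightarrow> f i \<in> K) \<Longrightarrow> sum f I \<in> K"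
  by (induction I rule: infinite_finite_induct) (auto simp: zero_mem add_mem)

lemma of_nat_mem: "of_nat n \<in> K"
  by (induction n) (auto simp: zero_mem one_mem add_mem)

lemma poly_mem: "(\<And>i. coeff p i \<in> K) \<Longrightarrow> x \<in> K \<Longrightarrow> poly p x \<in> K"
  unfolding poly_altdef by (intro sum_mem mult_mem power_mem)

end

section \<open>Translation of carrier-based algebra to the field type class\<close>

context
begin

private abbreviation "rt \<equiv> (ring_of_type_algebra :: 'a :: field ring)"

lemma ring_of_type_algebra_simps [simp]:
  "carrier rt = UNIV" "x \<otimes>\<^bsub>rt\<^esub> y = x * y" "x \<oplus>\<^bsub>rt\<^esub> y = x + y"
  "\<one>\<^bsub>rt\<^esub> = 1" "\<zero>\<^bsub>rt\<^esub> = 0"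
  by (simp_all add: ring_of_type_algebra_def)

lemma ring_of_type_algebra_uminus [simp]: "\<ominus>\<^bsub>rt\<^esub> x = - x"
proof -
  interpret field rt by (rule field_from_type_algebra)
  show ?thesis by (rule minus_equality) simp_all
qed

lemma ring_of_type_algebra_inverse: "x \<noteq> 0 \<Longrightarrow> inv\<^bsub>rt\<^esub> x = inverse x"
proof -
  interpret field rt by (rule field_from_type_algebra)
  show "x \<noteq> 0 \<Longrightarrow> inv\<^bsub>rt\<^esub> x = inverse x" by (rule comm_inv_char) simp_all
qed

lemma ring_of_type_algebra_power [simp]: "x [^]\<^bsub>rt\<^esub> (n :: nat) = x ^ n"
proof -
  interpret field rt by (rule field_from_type_algebra)
  show ?thesis by (induction n) (simp_all add: mult.commute)
qed

text \<open>Lets all later arithmetic in subfields run on the type class, where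
  \<open>inverse 0 = 0\<close> makes closure under \<open>inverse\<close> unconditional.\<close>

lemma subfield_iff_type_subfield: "subfield K rt \<longleftrightarrow> type_subfield K"
proof -
  interpret field rt by (rule field_from_type_algebra)
  show ?thesis
  proof
    assume K: "subfield K rt"
    note R = subringE[OF subfieldE(1)[OF K]]
    show "type_subfield K"
    proof
      fix x assume x: "x \<in> K"
      show "inverse x \<in> K"
      proof (cases "x = 0")
        case True
        then show ?thesis using R(2) by simp
      next
        case False
        then show ?thesis using subfield_m_inv(1)[OF K, of x] x ring_of_type_algebra_inverse[of x] by simp
      qed
    next
      fix x assume x: "x \<in> K"
      show "- x \<in> K" using R(5)[OF x] by simp
    qed (use R(2,3,6,7) in auto)
  next
    assume "type_subfield K"
    then interpret type_subfield K .
    have "subring K rt"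
      by (rule ring.subringI) (auto simp: one_mem add_mem mult_mem uminus_mem is_ring)
    then show "subfield K rt"
      by (rule subfieldI') (simp add: ring_of_type_algebra_inverse inverse_mem)
  qed
qed

text \<open>Polynomials of the carrier-based library list the leading coefficient first,
  \<open>Poly\<close> the constant one; hence \<open>rev\<close>.\<close>

lemma ring_of_type_algebra_eval: "ring.eval rt xs x = poly (Poly (rev xs)) x"
proof -
  interpret field rt by (rule field_from_type_algebra)
  show ?thesis by (induction xs) (simp_all add: Poly_append poly_monom)
qed

lemma algebraic_closure_poly_root:
  assumes "algebraic_closure (rt :: 'a ring) K" and "degree (p :: 'a :: field poly) > 0"
  shows "\<exists>x. poly p x = 0"
proof -
  interpret algebraic_closure rt K by fact
  define P where "P = rev (Polynomial.coeffs p)"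
  have deg: "Polynomials.degree P = Polynomial.degree p"
    by (auto simp: P_def degree_eq_length_coeffs)
  have carrier_P: "P \<in> carrier (poly_ring rt)"
    using assms(2)
    by (auto simp: univ_poly_def polynomial_def P_def hd_rev last_coeffs_eq_coeff_degree)
  hence "splitted P"
    using roots_over_carrier by blast
  hence "roots P \<noteq> {#}"
    unfolding splitted_def using deg assms(2) by auto
  then obtain x where "x \<in># roots P"
    by blast
  hence "is_root P x"
    using roots_mem_iff_is_root[OF carrier_P] by auto
  then show ?thesis
    by (auto simp: is_root_def ring_of_type_algebra_eval P_def)
qed

lemma algebraic_iff_poly:
  assumes "type_subfield K"
  shows "ring.algebraic rt K x \<longleftrightarrow> (\<exists>p. p \<noteq> 0 \<and> (\<forall>i. poly.coeff p i \<in> K) \<and> poly p x = 0)"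
proof -
  interpret field rt by (rule field_from_type_algebra)
  interpret K: type_subfield K by fact
  have K: "subring K rt" using assms subfieldE(1) subfield_iff_type_subfield by blast
  show ?thesis
  proof
    assume "algebraic K x"
    then have "(algebraic over K) x" by (simp add: over_def)
    then obtain p where p: "p \<in> carrier (K[X]\<^bsub>rt\<^esub>)" "p \<noteq> []" "eval p x = \<zero>\<^bsub>rt\<^esub>"
      using algebraicE[OF K] by auto
    have h: "set p \<subseteq> K" "hd p \<noteq> 0" using p(1,2) by (auto simp: univ_poly_def polynomial_def)
    have "Poly (rev p) \<noteq> 0"
    proof
      assume "Poly (rev p) = 0"
      then have "poly.coeff (Poly (rev p)) (length p - 1) = 0" by simp
      then show False using h(2) p(2) by (simp add: nth_default_def rev_nth hd_conv_nth)
    qed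
    moreover have "poly.coeff (Poly (rev p)) i \<in> K" for i
      using h(1) K.zero_mem nth_mem[of i "rev p"] by (auto simp: nth_default_def)
    ultimately show "\<exists>p. p \<noteq> 0 \<and> (\<forall>i. poly.coeff p i \<in> K) \<and> poly p x = 0"
      using p(3) by (auto simp: ring_of_type_algebra_eval)
  next
    assume "\<exists>p. p \<noteq> 0 \<and> (\<forall>i. poly.coeff p i \<in> K) \<and> poly p x = 0"
    then obtain p where p: "p \<noteq> 0" "\<forall>i. poly.coeff p i \<in> K" "poly p x = 0" by blast
    define P where "P = rev (Polynomial.coeffs p)"
    have "P \<in> carrier (K[X]\<^bsub>rt\<^esub>)"
      using p(1,2) by (auto simp: univ_poly_def polynomial_def P_def hd_rev last_coeffs_eq_coeff_degree
          Polynomial.coeffs_def)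
    moreover have "P \<noteq> []" using p(1) by (simp add: P_def)
    moreover have "eval P x = \<zero>\<^bsub>rt\<^esub>" using p(3) by (simp add: ring_of_type_algebra_eval P_def)
    ultimately have "(algebraic over K) x" by (rule algebraicI)
    then show "algebraic K x" by (simp add: over_def)
  qed
qed

lemma finite_dimension_spanning_list:
  assumes "type_subfield F" and "ring.finite_dimension rt F K"
  obtains us where "set us \<subseteq> K"
    and "\<And>x. x \<in> K \<Longrightarrow> \<exists>c. (\<forall>i. c i \<in> F) \<and> x = (\<Sum>i<length us. c i * us ! i)"
proof -
  interpret field rt by (rule field_from_type_algebra)
  interpret F: type_subfield F by fact
  have F: "subfield F rt" using assms(1) subfield_iff_type_subfield by blast
  obtain n where "dimension n F K" using assms(2) by auto
  then obtain us where us: "set us \<subseteq> carrier rt" "independent F us" "length us = n" "Span F us = K"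
    using exists_base[OF F] by blast
  have comb: "length ks = length vs \<Longrightarrow> combine ks vs = (\<Sum>i<length vs. ks ! i * vs ! i)" for ks vs :: "'a list"
    by (induction ks vs rule: list_induct2) (simp_all add: sum.lessThan_Suc_shift del: sum.lessThan_Suc)
  have "\<exists>c. (\<forall>i. c i \<in> F) \<and> x = (\<Sum>i<length us. c i * us ! i)" if x: "x \<in> K" for x
  proof -
    obtain ks where ks: "set ks \<subseteq> F" "length ks = length us" "x = combine ks us"
    proof -
      have "x \<in> Span F us" using x us(4) by blast
      then show ?thesis using Span_mem_iff_length_version[OF F us(1)] that by blast
    qed
    \<comment> \<open>Padding with 0 makes the coefficient family total with all values in
      \<open>F\<close>.\<close>
    show ?thesis
      by (rule exI[of _ "\<lambda>i. if i < length us then ks ! i else 0"])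
         (use ks comb[OF ks(2)] F.zero_mem nth_mem[of _ ks] in auto)
  qed
  moreover have "set us \<subseteq> K" using Span_base_incl[OF F us(1)] us(4) by simp
  ultimately show ?thesis using that by blast
qed

lemma fin_ext_finite_extension:
  assumes "type_subfield F" and "\<And>x. x \<in> set xs \<Longrightarrow> \<exists>p. p \<noteq> 0 \<and> (\<forall>i. coeff p i \<in> F) \<and> poly p x = 0"
  shows "fin_ext F (ring.finite_extension rt F xs)" and "set xs \<subseteq> ring.finite_extension rt F xs"
proof -
  interpret field rt by (rule field_from_type_algebra)
  have F: "subfield F rt" using assms(1) subfield_iff_type_subfield by blast
  have alg: "(algebraic over F) x" if "x \<in> set xs" for x
    using assms(2)[OF that] algebraic_iff_poly[OF assms(1), of x] by (simp add: over_def)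
  show "fin_ext F (finite_extension F xs)"
    unfolding fin_ext_def
    using F finite_extension_is_subfield[OF F _ alg] finite_extension_incl[of F xs]
      finite_extension_finite_dimension(1)[OF F _ alg] by simp
  show "set xs \<subseteq> finite_extension F xs"
    using finite_extension_mem[OF subfieldE(1)[OF F]] by simp
qed

lemma fin_ext_type_subfield: "fin_ext (F :: 'a :: field set) K \<Longrightarrow> type_subfield F \<and> type_subfield K \<and> F \<subseteq> K"
  unfolding fin_ext_def subfield_iff_type_subfield by blast

end

section \<open>Galois groups\<close>

lemma galois_group_iff:
  "\<sigma> \<in> galois_group (E :: 'a :: field set) \<longleftrightarrow>
     bij \<sigma> \<and> (\<forall>x y. \<sigma> (x + y) = \<sigma> x + \<sigma> y) \<and> (\<forall>x y. \<sigma> (x * y) = \<sigma> x * \<sigma> y) \<and> \<sigma> 1 = 1 \<and> (\<forall>x\<in>E. \<sigma> x = x)"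
  unfolding galois_group_def ring_iso_def ring_hom_def by auto

lemma galois_group_antimono: "E \<subseteq> F \<Longrightarrow> galois_group F \<subseteq> galois_group E"
  by (force simp: galois_group_iff)

locale field_auto =
  fixes \<sigma> :: "'a :: field \<Rightarrow> 'a"
  assumes bij: "bij \<sigma>" and hom_add: "\<sigma> (x + y) = \<sigma> x + \<sigma> y"
    and hom_mult: "\<sigma> (x * y) = \<sigma> x * \<sigma> y" and hom_one: "\<sigma> 1 = 1"
begin

lemma hom_zero: "\<sigma> 0 = 0" using hom_add[of 0 0] by (metis add.right_neutral add_cancel_left_right)
lemma eq_iff: "\<sigma> x = \<sigma> y \<longleftrightarrow> x = y" using bij by (simp add: bij_is_inj inj_eq)
lemma eq_0_iff: "\<sigma> x = 0 \<longleftrightarrow> x = 0" using eq_iff[of x 0] hom_zero by simp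
lemma hom_uminus: "\<sigma> (- x) = - \<sigma> x" using hom_add[of x "- x"] hom_zero by (simp add: add_eq_0_iff)
lemma hom_diff: "\<sigma> (x - y) = \<sigma> x - \<sigma> y" using hom_add[of x "- y"] hom_uminus by simp
lemma hom_power: "\<sigma> (x ^ n) = \<sigma> x ^ n" by (induction n) (auto simp: hom_one hom_mult)
lemma hom_inverse: "\<sigma> (inverse x) = inverse (\<sigma> x)"
proof (cases "x = 0")
  case False
  then have "\<sigma> x * \<sigma> (inverse x) = 1" by (simp flip: hom_mult add: hom_one)
  then show ?thesis by (metis inverse_unique)
qed (simp add: hom_zero)
lemma hom_divide: "\<sigma> (x / y) = \<sigma> x / \<sigma> y" by (simp add: divide_inverse hom_mult hom_inverse)
lemma hom_sum: "\<sigma> (sum f I) = (\<Sum>i\<in>I. \<sigma> (f i))"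
  by (induction I rule: infinite_finite_induct) (auto simp: hom_zero hom_add)
lemma hom_prod: "\<sigma> (prod f I) = (\<Prod>i\<in>I. \<sigma> (f i))"
  by (induction I rule: infinite_finite_induct) (auto simp: hom_one hom_mult)
lemma hom_of_nat: "\<sigma> (of_nat n) = of_nat n"
  by (induction n) (auto simp: hom_zero hom_one hom_add)
lemma hom_poly: "\<sigma> (poly p x) = poly (map_poly \<sigma> p) (\<sigma> x)"
  by (induction p) (simp_all add: hom_zero hom_add hom_mult map_poly_pCons eq_0_iff)
lemma map_poly_mult: "map_poly \<sigma> (p * q) = map_poly \<sigma> p * map_poly \<sigma> q"
  by (rule poly_eqI) (simp add: coeff_map_poly hom_zero coeff_mult hom_sum hom_mult)
lemma map_poly_prod: "map_poly \<sigma> (prod f I) = (\<Prod>i\<in>I. map_poly \<sigma> (f i))"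
  by (induction I rule: infinite_finite_induct) (auto simp: map_poly_mult hom_one)

end

lemma galois_group_field_auto: "\<sigma> \<in> galois_group E \<Longrightarrow> field_auto \<sigma>"
  by (auto simp: galois_group_iff field_auto_def)

lemma galois_group_fix: "\<sigma> \<in> galois_group E \<Longrightarrow> x \<in> E \<Longrightarrow> \<sigma> x = x"
  by (simp add: galois_group_iff)

lemma galois_group_id: "id \<in> galois_group E"
  by (simp add: galois_group_iff)

lemma galois_group_comp: "\<sigma> \<in> galois_group E \<Longrightarrow> \<tau> \<in> galois_group E \<Longrightarrow> \<sigma> \<circ> \<tau> \<in> galois_group E"
  by (auto simp: galois_group_iff bij_comp)

lemma galois_group_inv:
  assumes "\<sigma> \<in> galois_group E"
  shows "inv_into UNIV \<sigma> \<in> galois_group E"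
proof -
  interpret field_auto \<sigma> using assms by (rule galois_group_field_auto)
  have s: "\<sigma> (inv_into UNIV \<sigma> x) = x" for x by (rule surj_f_inv_f[OF bij_is_surj[OF bij]])
  have "inv_into UNIV \<sigma> (x + y) = inv_into UNIV \<sigma> x + inv_into UNIV \<sigma> y" "inv_into UNIV \<sigma> (x * y) = inv_into UNIV \<sigma> x * inv_into UNIV \<sigma> y" "inv_into UNIV \<sigma> 1 = 1" for x y
    using s by (metis eq_iff hom_add hom_mult hom_one)+
  moreover have "inv_into UNIV \<sigma> x = x" if "x \<in> E" for x
    using galois_group_fix[OF assms that] s eq_iff by metis
  ultimately show ?thesis
    using bij_imp_bij_inv[OF bij] by (simp add: galois_group_iff)
qed

lemma galois_group_inv_apply:
  assumes "\<sigma> \<in> galois_group E"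
  shows "inv_into UNIV \<sigma> (\<sigma> x) = x" and "\<sigma> (inv_into UNIV \<sigma> x) = x"
  using assms by (auto simp: galois_group_iff bij_is_inj bij_is_surj surj_f_inv_f)

text \<open>For \<open>H = galois_group (Qp \<union> A)\<close> this plays the role of the field
  generated by \<open>A\<close> over \<open>Qp\<close>.\<close>

definition fixed_field :: "('a \<Rightarrow> 'a) set \<Rightarrow> 'a set" where
  "fixed_field H = {x. \<forall>\<sigma>\<in>H. \<sigma> x = x}"

lemma fixed_field_type_subfield:
  assumes "H \<subseteq> galois_group (E :: 'a :: field set)"
  shows "type_subfield (fixed_field H)"
proof -
  have *: "field_auto \<sigma>" if "\<sigma> \<in> H" for \<sigma>
    using galois_group_field_auto[of \<sigma> E] assms that by blast
  show ?thesis
    by unfold_locales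
       (auto simp: fixed_field_def field_auto.hom_zero[OF *] field_auto.hom_one[OF *] field_auto.hom_add[OF *]
         field_auto.hom_mult[OF *] field_auto.hom_uminus[OF *] field_auto.hom_inverse[OF *])
qed

text \<open>The roots form a list rather than a set because they may repeat.\<close>

lemma splitting_list:
  fixes p :: "'a :: field poly"
  assumes root: "\<And>p :: 'a poly. degree p > 0 \<Longrightarrow> \<exists>x. poly p x = 0" and "p \<noteq> 0"
  shows "\<exists>xs. length xs = degree p \<and> p = smult (lead_coeff p) (\<Prod>x\<leftarrow>xs. [:- x, 1:])"
  using \<open>p \<noteq> 0\<close>
proof (induction "degree p" arbitrary: p)
  case 0
  then obtain c where "p = [:c:]" by (metis degree_eq_zeroE)
  then show ?case by (intro exI[of _ "[]"]) simp
next
  case (Suc n)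
  then obtain x where "poly p x = 0" using root[of p] by auto
  then obtain q where q: "p = [:- x, 1:] * q" by (metis poly_eq_0_iff_dvd dvdE)
  with Suc.prems have q0: "q \<noteq> 0" by auto
  then have "degree p = Suc (degree q)" unfolding q by (subst degree_mult_eq) auto
  then obtain xs where xs: "length xs = degree q" "q = smult (lead_coeff q) (\<Prod>x\<leftarrow>xs. [:- x, 1:])"
    using Suc.hyps q0 by auto
  have "lead_coeff p = lead_coeff q" unfolding q by (subst lead_coeff_mult) simp
  moreover have "[:- x, 1:] * q = [:- x, 1:] * smult (lead_coeff q) (\<Prod>x\<leftarrow>xs. [:- x, 1:])"
    using xs(2) by (rule arg_cong)
  ultimately have "p = smult (lead_coeff p) (\<Prod>x\<leftarrow>x # xs. [:- x, 1:])"
    unfolding q[symmetric] by (simp only: list.map prod_list.Cons mult_smult_right)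
  then show ?case using xs(1) \<open>degree p = Suc (degree q)\<close> by (intro exI[of _ "x # xs"]) simp
qed

section \<open>Extending embeddings\<close>

definition polys_in :: "'a :: field set \<Rightarrow> 'a poly set" where
  "polys_in K = {p. \<forall>i. coeff p i \<in> K}"

context type_subfield
begin

lemma polys_in_0: "0 \<in> polys_in K" by (simp add: polys_in_def zero_mem)
lemma polys_in_pCons: "pCons c p \<in> polys_in K \<longleftrightarrow> c \<in> K \<and> p \<in> polys_in K"
  by (auto simp: polys_in_def coeff_pCons split: nat.splits)
lemma polys_in_add: "p \<in> polys_in K \<Longrightarrow> q \<in> polys_in K \<Longrightarrow> p + q \<in> polys_in K"
  by (simp add: polys_in_def add_mem)
lemma polys_in_diff: "p \<in> polys_in K \<Longrightarrow> q \<in> polys_in K \<Longrightarrow> p - q \<in> polys_in K"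
  by (simp add: polys_in_def diff_mem)
lemma polys_in_mult: "p \<in> polys_in K \<Longrightarrow> q \<in> polys_in K \<Longrightarrow> p * q \<in> polys_in K"
  by (auto simp: polys_in_def coeff_mult intro!: sum_mem mult_mem)
lemma polys_in_monom: "c \<in> K \<Longrightarrow> Polynomial.monom c n \<in> polys_in K"
  by (simp add: polys_in_def zero_mem)
lemma polys_in_smult: "c \<in> K \<Longrightarrow> p \<in> polys_in K \<Longrightarrow> smult c p \<in> polys_in K"
  by (simp add: polys_in_def mult_mem)
lemma polys_in_pderiv: "p \<in> polys_in K \<Longrightarrow> pderiv p \<in> polys_in K"
  by (simp add: polys_in_def coeff_pderiv mult_mem of_nat_mem del: of_nat_Suc)
lemma polys_in_poly_mem: "p \<in> polys_in K \<Longrightarrow> x \<in> K \<Longrightarrow> poly p x \<in> K"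
  by (rule poly_mem) (auto simp: polys_in_def)

text \<open>Each step of long division subtracts \<open>P\<close> times a monomial whose coefficient
  is a quotient of leading coefficients, so no coefficient leaves \<open>K\<close>.\<close>

lemma polys_in_divmod:
  assumes "P \<in> polys_in K" "P \<noteq> 0" "Q \<in> polys_in K"
  obtains A R where "A \<in> polys_in K" "R \<in> polys_in K" "Q = P * A + R" "R = 0 \<or> degree R < degree P"
proof -
  have "\<exists>A R. A \<in> polys_in K \<and> R \<in> polys_in K \<and> Q = P * A + R \<and> (R = 0 \<or> degree R < degree P)"
    using assms(3)
  proof (induction "degree Q" arbitrary: Q rule: less_induct)
    case less
    show ?case
    proof (cases "Q = 0 \<or> degree Q < degree P")
      case True
      then show ?thesis using less.prems by (intro exI[of _ 0] exI[of _ Q]) (auto simp: polys_in_0)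
    next
      case False
      define M where "M = Polynomial.monom (lead_coeff Q / lead_coeff P) (degree Q - degree P)"
      have M: "M \<in> polys_in K"
        unfolding M_def using assms(1) less.prems
        by (intro polys_in_monom divide_mem) (auto simp: polys_in_def)
      have lcM: "lead_coeff Q / lead_coeff P \<noteq> 0" using False assms(2) by simp
      then have M0: "M \<noteq> 0" by (simp add: M_def)
      have deg: "degree (P * M) = degree Q"
      proof -
        have "degree M = degree Q - degree P" unfolding M_def by (rule degree_monom_eq[OF lcM])
        then show ?thesis using False degree_mult_eq[OF assms(2) M0] by simp
      qed
      have lc: "lead_coeff (P * M) = lead_coeff Q"
      proof -
        have "lead_coeff M = lead_coeff Q / lead_coeff P" unfolding M_def by (rule lead_coeff_monom)
        then show ?thesis using assms(2) by (subst lead_coeff_mult) simp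
      qed
      show ?thesis
      proof (cases "Q - P * M = 0")
        case True
        then show ?thesis using M by (intro exI[of _ M] exI[of _ 0]) (auto simp: polys_in_0)
      next
        case F: False
        have "degree (Q - P * M) < degree Q"
        proof (rule ccontr)
          assume "\<not> degree (Q - P * M) < degree Q"
          moreover have "degree (Q - P * M) \<le> degree Q" using deg by (intro degree_diff_le) auto
          ultimately have e: "degree (Q - P * M) = degree Q" by simp
          have "lead_coeff (Q - P * M) = 0" unfolding e using lc deg by simp
          then have "Q - P * M = 0" by (rule leading_coeff_0_iff[THEN iffD1])
          then show False using F by contradiction
        qed
        moreover have "Q - P * M \<in> polys_in K" by (intro polys_in_diff polys_in_mult less.prems assms(1) M)
        ultimately obtain A R where AR: "A \<in> polys_in K" "R \<in> polys_in K" "Q - P * M = P * A + R"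
          "R = 0 \<or> degree R < degree P" using less.hyps by blast
        have "Q = P * (A + M) + R" using AR(3) by (simp add: algebra_simps)
        then show ?thesis using AR(1,2,4) polys_in_add[OF AR(1) M] by blast
      qed
    qed
  qed
  then show ?thesis using that by blast
qed

end

text \<open>The minimal polynomial up to a scalar factor; minimality of the degree stands in for
  irreducibility.\<close>

definition min_relation :: "'a :: field set \<Rightarrow> 'a \<Rightarrow> 'a poly \<Rightarrow> bool" where
  "min_relation K x P \<longleftrightarrow> P \<in> polys_in K \<and> P \<noteq> 0 \<and> poly P x = 0 \<and>
     (\<forall>Q\<in>polys_in K. Q \<noteq> 0 \<longrightarrow> poly Q x = 0 \<longrightarrow> degree P \<le> degree Q)"

lemma min_relation_exists:
  assumes "P \<in> polys_in K" "P \<noteq> 0" "poly P x = 0"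
  shows "\<exists>P. min_relation K x P"
proof -
  let ?S = "\<lambda>P. P \<in> polys_in K \<and> P \<noteq> 0 \<and> poly P x = 0"
  have "?S P" using assms by simp
  from ex_has_least_nat[of ?S, OF this, of degree] show ?thesis
    unfolding min_relation_def by blast
qed

lemma min_relation_degree_pos: "min_relation K x P \<Longrightarrow> degree P > 0"
  unfolding min_relation_def by (rule ccontr) (auto elim!: degree_eq_zeroE)

lemma min_relation_degree_le_1:
  assumes "type_subfield K" "min_relation K x P" "degree P \<le> 1"
  shows "x \<in> K"
proof -
  interpret type_subfield K by fact
  have d: "degree P = 1" using min_relation_degree_pos[OF assms(2)] assms(3) by simp
  have "P = [:coeff P 0, coeff P 1:]"
    by (rule poly_eqI) (use d in \<open>auto simp: coeff_pCons coeff_eq_0 split: nat.splits\<close>)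
  then have "poly P x = poly [:coeff P 0, coeff P 1:] x" by (rule arg_cong)
  then have "coeff P 0 + x * coeff P 1 = 0" using assms(2) by (simp add: min_relation_def)
  moreover have "coeff P 1 \<noteq> 0" using d leading_coeff_0_iff[of P] by auto
  ultimately have "x = - coeff P 0 / coeff P 1" by (simp add: field_simps add_eq_0_iff)
  moreover have "coeff P 0 \<in> K" "coeff P 1 \<in> K" using assms(2) by (auto simp: min_relation_def polys_in_def)
  ultimately show ?thesis by (auto intro: divide_mem uminus_mem)
qed

text \<open>An embedding of \<open>K\<close>, given as a total function whose values outside
  \<open>K\<close> are arbitrary.\<close>

locale partial_field_hom = type_subfield K for K :: "'a :: field set" +
  fixes \<phi> :: "'a \<Rightarrow> 'a"
  assumes phi_add: "x \<in> K \<Longrightarrow> y \<in> K \<Longrightarrow> \<phi> (x + y) = \<phi> x + \<phi> y"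
    and phi_mult: "x \<in> K \<Longrightarrow> y \<in> K \<Longrightarrow> \<phi> (x * y) = \<phi> x * \<phi> y"
    and phi_one: "\<phi> 1 = 1"
begin

lemma phi_zero: "\<phi> 0 = 0" using phi_add[OF zero_mem zero_mem] by (metis add.right_neutral add_cancel_left_right)

lemma phi_eq_0: "x \<in> K \<Longrightarrow> \<phi> x = 0 \<Longrightarrow> x = 0"
  by (metis inverse_mem mult_zero_left phi_mult phi_one right_inverse zero_neq_one)

lemma phi_sum: "(\<And>i. i \<in> I \<Longrightarrow> f i \<in> K) \<Longrightarrow> \<phi> (sum f I) = (\<Sum>i\<in>I. \<phi> (f i))"
  by (induction I rule: infinite_finite_induct) (auto simp: phi_zero phi_add sum_mem)

lemma map_poly_phi_add: "p \<in> polys_in K \<Longrightarrow> q \<in> polys_in K \<Longrightarrow> map_poly \<phi> (p + q) = map_poly \<phi> p + map_poly \<phi> q"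
  by (rule poly_eqI) (simp add: coeff_map_poly phi_zero phi_add polys_in_def)

lemma map_poly_phi_mult:
  "p \<in> polys_in K \<Longrightarrow> q \<in> polys_in K \<Longrightarrow> map_poly \<phi> (p * q) = map_poly \<phi> p * map_poly \<phi> q"
  by (rule poly_eqI) (simp add: coeff_map_poly phi_zero coeff_mult phi_sum phi_mult mult_mem polys_in_def)

lemma degree_map_poly_phi: "p \<in> polys_in K \<Longrightarrow> degree (map_poly \<phi> p) = degree p"
proof (rule antisym)
  show "degree (map_poly \<phi> p) \<le> degree p"
    by (rule degree_le) (simp add: coeff_map_poly phi_zero coeff_eq_0)
  assume p: "p \<in> polys_in K"
  show "degree p \<le> degree (map_poly \<phi> p)"
  proof (cases "p = 0")
    case False
    then have "\<phi> (lead_coeff p) \<noteq> 0" using phi_eq_0[of "lead_coeff p"] p by (auto simp: polys_in_def)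
    then show ?thesis by (intro le_degree) (simp add: coeff_map_poly phi_zero)
  qed simp
qed

text \<open>The remainder of \<open>Q\<close> modulo \<open>P\<close> vanishes at \<open>z\<close>
  and has too small a degree, so it is 0 and \<open>Q\<close> is a multiple of \<open>P\<close>.
  This makes the extension of \<open>\<phi>\<close> by \<open>z \<mapsto> z'\<close> well
  defined.\<close>

lemma poly_map_poly_root:
  assumes "min_relation K z P" "poly (map_poly \<phi> P) z' = 0" "Q \<in> polys_in K" "poly Q z = 0"
  shows "poly (map_poly \<phi> Q) z' = 0"
proof -
  have P: "P \<in> polys_in K" "P \<noteq> 0" "poly P z = 0" using assms(1) by (auto simp: min_relation_def)
  obtain A R where AR: "A \<in> polys_in K" "R \<in> polys_in K" "Q = P * A + R" "R = 0 \<or> degree R < degree P"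
    using polys_in_divmod[OF P(1,2) assms(3)] .
  have "poly R z = 0" using AR(3) P(3) assms(4) by simp
  then have "R = 0" using AR(2,4) assms(1) unfolding min_relation_def by force
  then show ?thesis using AR P map_poly_phi_mult[OF P(1) AR(1)] assms(2) by simp
qed

end

text \<open>Embeddings are represented by their graphs, so that Zorn's lemma applies to inclusion.\<close>

definition hom_graph :: "'a :: field set \<Rightarrow> ('a \<times> 'a) set \<Rightarrow> bool" where
  "hom_graph E S \<longleftrightarrow> (\<forall>q\<in>E. (q, q) \<in> S) \<and>
     (\<forall>x y x' y'. (x, y) \<in> S \<longrightarrow> (x', y') \<in> S \<longrightarrow> (x + x', y + y') \<in> S \<and> (x * x', y * y') \<in> S) \<and>
     (\<forall>z. (0, z) \<in> S \<longrightarrow> z = 0)"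

lemma hom_graphD:
  assumes "hom_graph E S"
  shows "q \<in> E \<Longrightarrow> (q, q) \<in> S"
    and "(x, y) \<in> S \<Longrightarrow> (x', y') \<in> S \<Longrightarrow> (x + x', y + y') \<in> S"
    and "(x, y) \<in> S \<Longrightarrow> (x', y') \<in> S \<Longrightarrow> (x * x', y * y') \<in> S"
    and "(0, z) \<in> S \<Longrightarrow> z = 0"
  using assms by (simp_all add: hom_graph_def)

context padic_closure
begin

lemma Qp_subfield: "type_subfield Qp"
  using closure_Qp unfolding algebraic_closure_def by (simp add: subfield_iff_type_subfield)

lemma poly_root: "degree (q :: 'a poly) > 0 \<Longrightarrow> \<exists>x. poly q x = 0"
  using algebraic_closure_poly_root[OF closure_Qp] .

lemma algebraic_Qp: "\<exists>q\<in>polys_in Qp. q \<noteq> 0 \<and> poly q x = 0"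
proof -
  have "ring.algebraic (ring_of_type_algebra :: 'a ring) Qp x"
    using algebraic_closure.algebraic_extension[OF closure_Qp, of x] by (simp add: over_def)
  then show ?thesis unfolding algebraic_iff_poly[OF Qp_subfield] polys_in_def by blast
qed

text \<open>Strip factors \<open>X\<close> from a polynomial relation of \<open>x\<close> until its
  constant term is nonzero, then solve for the inverse.\<close>

lemma inverse_poly_Qp:
  assumes "x \<noteq> 0"
  shows "\<exists>r\<in>polys_in Qp. poly r x = inverse x"
proof -
  interpret Qp: type_subfield Qp by (rule Qp_subfield)
  obtain q where "q \<in> polys_in Qp" "q \<noteq> 0" "poly q x = 0" using algebraic_Qp by blast
  then show ?thesis
  proof (induction q)
    case (pCons c q)
    show ?case
    proof (cases "c = 0")
      case True
      then show ?thesis using pCons assms by (simp add: Qp.polys_in_pCons)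
    next
      case False
      have "c + x * poly q x = 0" using pCons.prems by simp
      then have "x * (- poly q x / c) = 1" using False by (simp add: field_simps add_eq_0_iff)
      then have "inverse x = poly (smult (- inverse c) q) x"
        by (simp add: inverse_unique divide_inverse mult.commute)
      moreover have "smult (- inverse c) q \<in> polys_in Qp"
        using pCons.prems by (intro Qp.polys_in_smult Qp.uminus_mem Qp.inverse_mem) (auto simp: Qp.polys_in_pCons)
      ultimately show ?thesis by metis
    qed
  qed simp
qed

text \<open>Every element is algebraic over \<open>Qp\<close>, so its inverse is already a
  polynomial in it.\<close>

lemma subring_type_subfield:
  assumes "Qp \<subseteq> K" "\<And>x y. x \<in> K \<Longrightarrow> y \<in> K \<Longrightarrow> x + y \<in> K" "\<And>x y. x \<in> K \<Longrightarrow> y \<in> K \<Longrightarrow> x * y \<in> K"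
  shows "type_subfield K"
proof -
  interpret Qp: type_subfield Qp by (rule Qp_subfield)
  show ?thesis
  proof
    show "0 \<in> K" "1 \<in> K" using assms(1) Qp.zero_mem Qp.one_mem by auto
    fix x assume x: "x \<in> K"
    have "- 1 \<in> K" using assms(1) Qp.uminus_mem[OF Qp.one_mem] by auto
    then show "- x \<in> K" using assms(3)[of "- 1" x] x by simp
    show "inverse x \<in> K"
    proof (cases "x = 0")
      case False
      then obtain r where r: "r \<in> polys_in Qp" "poly r x = inverse x" using inverse_poly_Qp by blast
      have "poly r x \<in> K"
        using r(1)
      proof (induction r)
        case 0
        then show ?case using \<open>0 \<in> K\<close> by simp
      next
        case (pCons c r)
        then show ?case using assms x by (auto simp: Qp.polys_in_pCons)
      qed
      then show ?thesis using r by simp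
    qed (use \<open>0 \<in> K\<close> in simp)
  qed (use assms in auto)
qed

text \<open>The difference of two values at one point is a value at 0, hence 0; so the graph is
  single-valued.\<close>

lemma hom_graph_partial_field_hom:
  assumes "hom_graph E S" "Qp \<subseteq> E"
  obtains \<phi> where "partial_field_hom (Domain S) \<phi>" "S = {(x, \<phi> x) | x. x \<in> Domain S}"
proof -
  have ref: "\<And>q. q \<in> E \<Longrightarrow> (q, q) \<in> S"
    and add: "\<And>x y x' y'. (x, y) \<in> S \<Longrightarrow> (x', y') \<in> S \<Longrightarrow> (x + x', y + y') \<in> S"
    and mul: "\<And>x y x' y'. (x, y) \<in> S \<Longrightarrow> (x', y') \<in> S \<Longrightarrow> (x * x', y * y') \<in> S"
    and zer: "\<And>z. (0, z) \<in> S \<Longrightarrow> z = 0"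
    using assms(1) by (auto simp: hom_graph_def)
  interpret Qp: type_subfield Qp by (rule Qp_subfield)
  have m1: "(- 1, - 1) \<in> S" using ref assms(2) Qp.uminus_mem[OF Qp.one_mem] by blast
  have uniq: "y = y'" if "(x, y) \<in> S" "(x, y') \<in> S" for x y y'
    using zer[of "y - y'"] add[OF that(1) mul[OF m1 that(2)]] by simp
  define \<phi> where "\<phi> x = (SOME y. (x, y) \<in> S)" for x
  have phi: "(x, y) \<in> S \<longleftrightarrow> x \<in> Domain S \<and> y = \<phi> x" for x y
  proof
    assume xy: "(x, y) \<in> S"
    then have "(x, \<phi> x) \<in> S" unfolding \<phi>_def by (rule someI)
    then show "x \<in> Domain S \<and> y = \<phi> x" using uniq xy by blast
  next
    assume "x \<in> Domain S \<and> y = \<phi> x"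
    then show "(x, y) \<in> S" unfolding \<phi>_def by (auto intro: someI)
  qed
  have sub: "type_subfield (Domain S)"
  proof (rule subring_type_subfield)
    show "Qp \<subseteq> Domain S" using assms(2) ref by blast
  qed (use add mul in blast)+
  have "partial_field_hom (Domain S) \<phi>"
    unfolding partial_field_hom_def partial_field_hom_axioms_def
  proof (intro conjI allI impI sub)
    fix x y assume "x \<in> Domain S" "y \<in> Domain S"
    then have "(x, \<phi> x) \<in> S" "(y, \<phi> y) \<in> S" using phi by auto
    from add[OF this] mul[OF this] show "\<phi> (x + y) = \<phi> x + \<phi> y" "\<phi> (x * y) = \<phi> x * \<phi> y"
      using phi by auto
  next
    show "\<phi> 1 = 1" using phi ref assms(2) Qp.one_mem by auto
  qed
  moreover have "S = {(x, \<phi> x) | x. x \<in> Domain S}"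
  proof (rule Set.set_eqI)
    fix a show "a \<in> S \<longleftrightarrow> a \<in> {(x, \<phi> x) | x. x \<in> Domain S}"
      using phi[of "fst a" "snd a"] by (cases a) auto
  qed
  ultimately show ?thesis using that by blast
qed

text \<open>The new graph pairs the value of \<open>Q\<close> at \<open>z\<close> with the value of
  the transported polynomial at \<open>z'\<close>. That it has only 0 above 0 is
  \<open>poly_map_poly_root\<close>.\<close>

lemma hom_graph_step:
  assumes "hom_graph E S" "Qp \<subseteq> E" "partial_field_hom (Domain S) \<phi>" "S = {(x, \<phi> x) | x. x \<in> Domain S}"
    and "min_relation (Domain S) z P" "poly (map_poly \<phi> P) z' = 0"
  shows "\<exists>S'. hom_graph E S' \<and> S \<subseteq> S' \<and> (z, z') \<in> S'"
proof -
  interpret partial_field_hom "Domain S" \<phi> by fact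
  define S' where "S' = (\<lambda>Q. (poly Q z, poly (map_poly \<phi> Q) z')) ` polys_in (Domain S)"
  have sub: "S \<subseteq> S'"
  proof
    fix a assume "a \<in> S"
    then obtain x where x: "x \<in> Domain S" "a = (x, \<phi> x)" using assms(4) by blast
    then have "a = (poly [:x:] z, poly (map_poly \<phi> [:x:]) z')" by (simp add: map_poly_pCons phi_zero phi_eq_0)
    moreover have "[:x:] \<in> polys_in (Domain S)" using x by (simp add: polys_in_pCons polys_in_0)
    ultimately show "a \<in> S'" unfolding S'_def by blast
  qed
  moreover have "hom_graph E S'"
    unfolding hom_graph_def
  proof (intro conjI ballI allI impI)
    fix q assume "q \<in> E"
    then show "(q, q) \<in> S'" using sub assms(1) by (auto simp: hom_graph_def)
  next
    fix x y x' y' assume "(x, y) \<in> S'" "(x', y') \<in> S'"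
    then obtain Q Q' where Q: "Q \<in> polys_in (Domain S)" "x = poly Q z" "y = poly (map_poly \<phi> Q) z'"
      and Q': "Q' \<in> polys_in (Domain S)" "x' = poly Q' z" "y' = poly (map_poly \<phi> Q') z'"
      unfolding S'_def by auto
    have "(x + x', y + y') = (poly (Q + Q') z, poly (map_poly \<phi> (Q + Q')) z')"
      using Q Q' by (simp add: map_poly_phi_add)
    then show "(x + x', y + y') \<in> S'" unfolding S'_def using polys_in_add[OF Q(1) Q'(1)] by blast
    have "(x * x', y * y') = (poly (Q * Q') z, poly (map_poly \<phi> (Q * Q')) z')"
      using Q Q' by (simp add: map_poly_phi_mult)
    then show "(x * x', y * y') \<in> S'" unfolding S'_def using polys_in_mult[OF Q(1) Q'(1)] by blast
  next
    fix w assume "(0, w) \<in> S'"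
    then show "w = 0" unfolding S'_def using poly_map_poly_root[OF assms(5,6)] by auto
  qed
  moreover have "(z, z') \<in> S'"
  proof -
    have "[:0, 1:] \<in> polys_in (Domain S)" by (simp add: polys_in_pCons polys_in_0 zero_mem one_mem)
    moreover have "(z, z') = (poly [:0, 1:] z, poly (map_poly \<phi> [:0, 1:]) z')"
      by (simp add: map_poly_pCons phi_zero phi_one)
    ultimately show ?thesis unfolding S'_def by blast
  qed
  ultimately show ?thesis by blast
qed

text \<open>A maximal graph is defined everywhere, since any missing \<open>z\<close> could be sent
  to a root of its transported minimal relation.\<close>

lemma hom_graph_extends:
  assumes "hom_graph E S0" "Qp \<subseteq> E"
  shows "\<exists>\<sigma>\<in>galois_group E. \<forall>(x, y)\<in>S0. \<sigma> x = y"
proof -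
  let ?A = "{S. hom_graph E S \<and> S0 \<subseteq> S}"
  have "\<exists>M\<in>?A. \<forall>X\<in>?A. M \<subseteq> X \<longrightarrow> X = M"
  proof (rule subset_Zorn_nonempty)
    show "?A \<noteq> {}" using assms(1) by blast
    fix C assume C: "C \<noteq> {}" "subset.chain ?A C"
    have CA: "\<And>S. S \<in> C \<Longrightarrow> hom_graph E S \<and> S0 \<subseteq> S" using C(2) by (auto simp: subset.chain_def)
    have two: "\<exists>S\<in>C. a \<in> S \<and> b \<in> S" if ab: "a \<in> \<Union>C" "b \<in> \<Union>C" for a b
    proof -
      obtain S T where ST: "S \<in> C" "a \<in> S" "T \<in> C" "b \<in> T" using ab by blast
      moreover have "S \<subseteq> T \<or> T \<subseteq> S" using C(2) ST unfolding subset_chain_def by blast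
      ultimately show ?thesis by blast
    qed
    have "hom_graph E (\<Union>C)"
      unfolding hom_graph_def
    proof (intro conjI ballI allI impI)
      fix q assume "q \<in> E"
      obtain S where "S \<in> C" using C(1) by blast
      then have "(q, q) \<in> S" using CA hom_graphD(1) \<open>q \<in> E\<close> by metis
      then show "(q, q) \<in> \<Union>C" using \<open>S \<in> C\<close> by (rule UnionI[rotated])
    next
      fix x y x' y' assume "(x, y) \<in> \<Union>C" "(x', y') \<in> \<Union>C"
      then obtain S where S: "S \<in> C" "(x, y) \<in> S" "(x', y') \<in> S" using two by blast
      then have "(x + x', y + y') \<in> S" "(x * x', y * y') \<in> S"
        using CA[OF S(1)] hom_graphD(2,3) by metis+
      then show "(x + x', y + y') \<in> \<Union>C" "(x * x', y * y') \<in> \<Union>C"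
        using S(1) by (auto intro: UnionI[rotated])
    next
      fix z assume "(0, z) \<in> \<Union>C"
      then obtain S where "S \<in> C" "(0, z) \<in> S" by blast
      then show "z = 0" using CA hom_graphD(4) by metis
    qed
    then show "\<Union>C \<in> ?A" using C(1) CA by blast
  qed
  then obtain M where M0: "M \<in> ?A" "\<forall>X\<in>?A. M \<subseteq> X \<longrightarrow> X = M" ..
  have M: "hom_graph E M" "S0 \<subseteq> M" using M0(1) by auto
  have max: "S = M" if "hom_graph E S" "M \<subseteq> S" for S
    using M0(2) M(2) that by auto
  obtain \<phi> where \<phi>: "partial_field_hom (Domain M) \<phi>" "M = {(x, \<phi> x) | x. x \<in> Domain M}"
    using hom_graph_partial_field_hom[OF M(1) assms(2)] .
  interpret partial_field_hom "Domain M" \<phi> by fact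
  have mem: "y = \<phi> x" if "(x, y) \<in> M" for x y using that by (subst (asm) \<phi>(2)) blast
  have EM: "E \<subseteq> Domain M" using M(1) by (auto simp: hom_graph_def)
  have full: "z \<in> Domain M" for z
  proof -
    obtain q where "q \<in> polys_in Qp" "q \<noteq> 0" "poly q z = 0" using algebraic_Qp by blast
    then have "q \<in> polys_in (Domain M)" using EM assms(2) by (auto simp: polys_in_def)
    then obtain P where P: "min_relation (Domain M) z P"
      using min_relation_exists \<open>q \<noteq> 0\<close> \<open>poly q z = 0\<close> by blast
    then have "degree (map_poly \<phi> P) > 0"
      using min_relation_degree_pos[OF P] degree_map_poly_phi[of P] by (simp add: min_relation_def)
    then obtain z' where "poly (map_poly \<phi> P) z' = 0" using poly_root by blast
    then obtain S' where "hom_graph E S'" "M \<subseteq> S'" "(z, z') \<in> S'"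
      using hom_graph_step[OF M(1) assms(2) \<phi> P] by blast
    then show ?thesis using max by blast
  qed
  have inj: "inj \<phi>"
  proof (rule injI)
    fix x y assume "\<phi> x = \<phi> y"
    moreover have "\<phi> (x - y) + \<phi> y = \<phi> x" using phi_add[of "x - y" y] full by simp
    ultimately have "\<phi> (x - y) = 0" by simp
    then show "x = y" using phi_eq_0[of "x - y"] full by simp
  qed
  have fixE: "\<phi> x = x" if "x \<in> E" for x
  proof -
    have "(x, x) \<in> M" using M(1) that by (auto simp: hom_graph_def)
    then show ?thesis using mem by metis
  qed
  have hom: "map_poly \<phi> q = q" if "q \<in> polys_in Qp" for q
    by (rule poly_eqI) (use that fixE assms(2) in \<open>auto simp: coeff_map_poly phi_zero polys_in_def\<close>)
  have hom2: "\<phi> (poly q x) = poly (map_poly \<phi> q) (\<phi> x)" for q x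
    by (induction q) (simp_all add: phi_zero phi_add phi_mult full map_poly_pCons phi_eq_0)
  \<comment> \<open>The roots of \<open>q\<close> are finitely many, and \<open>\<phi>\<close> maps
    them injectively to themselves because it fixes the coefficients of \<open>q\<close>.\<close>
  have "surj \<phi>"
  proof (unfold surj_def, rule allI)
    fix y
    obtain q where q: "q \<in> polys_in Qp" "q \<noteq> 0" "poly q y = 0" using algebraic_Qp by blast
    let ?R = "{x. poly q x = 0}"
    have "poly q (\<phi> x) = 0" if "poly q x = 0" for x
      using hom2[of q x] hom[OF q(1)] phi_zero that by simp
    then have "\<phi> ` ?R \<subseteq> ?R" by auto
    then have "\<phi> ` ?R = ?R" using endo_inj_surj[of ?R \<phi>] poly_roots_finite[OF q(2)] inj_on_subset[OF inj] by blast
    then show "\<exists>x. y = \<phi> x" using q(3) by blast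
  qed
  then have "\<phi> \<in> galois_group E"
    using inj fixE full phi_add phi_mult phi_one by (auto simp: galois_group_iff bij_def)
  moreover have "\<forall>(x, y)\<in>S0. \<phi> x = y" using M(2) mem by auto
  ultimately show ?thesis by blast
qed

text \<open>In characteristic 0 the derivative of a minimal relation is nonzero of smaller degree,
  so \<open>x\<close> is a simple root. A root \<open>y\<close> of the cofactor \<open>R\<close>
  therefore differs from \<open>x\<close>, and \<open>x \<mapsto> y\<close> extends.\<close>

lemma galois_group_moves:
  assumes E: "type_subfield E" "Qp \<subseteq> E" and x: "x \<notin> E"
  shows "\<exists>\<sigma>\<in>galois_group E. \<sigma> x \<noteq> x"
proof -
  interpret E: type_subfield E by fact
  obtain q where "q \<in> polys_in Qp" "q \<noteq> 0" "poly q x = 0" using algebraic_Qp by blast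
  then have "q \<in> polys_in E" using assms(2) by (auto simp: polys_in_def)
  then obtain P where P: "min_relation E x P" using min_relation_exists \<open>q \<noteq> 0\<close> \<open>poly q x = 0\<close> by blast
  have deg: "degree P \<ge> 2" using min_relation_degree_le_1[OF E(1) P] x by linarith
  from P obtain R where R: "P = [:- x, 1:] * R" unfolding min_relation_def by (metis poly_eq_0_iff_dvd dvdE)
  have "pderiv P \<noteq> 0" using deg by (simp add: pderiv_eq_0_iff)
  then have "poly (pderiv P) x \<noteq> 0"
    using P E.polys_in_pderiv[of P] deg unfolding min_relation_def by (force simp: degree_pderiv)
  then have Rx: "poly R x \<noteq> 0" unfolding R pderiv_mult by (simp add: pderiv_pCons)
  have "R \<noteq> 0" using Rx by auto
  then have "degree P = Suc (degree R)" unfolding R by (subst degree_mult_eq) auto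
  then obtain y where y: "poly R y = 0" using poly_root[of R] deg by auto
  let ?S = "{(e, e) | e. e \<in> E}"
  have S: "hom_graph E ?S" by (auto simp: hom_graph_def E.add_mem E.mult_mem)
  have dom: "Domain ?S = E" by auto
  have "partial_field_hom (Domain ?S) id" unfolding dom
    by unfold_locales simp_all
  moreover have "?S = {(e, id e) | e. e \<in> Domain ?S}" by auto
  moreover have "poly (map_poly id P) y = 0" using y by (simp add: R map_poly_id)
  ultimately obtain S' where "hom_graph E S'" "(x, y) \<in> S'"
    using hom_graph_step[OF S E(2), of id x P y] P unfolding dom by blast
  then obtain \<sigma> where "\<sigma> \<in> galois_group E" "\<sigma> x = y" using hom_graph_extends[OF _ E(2), of S'] by fast
  then show ?thesis using y Rx by metis
qed

lemma fixed_field_galois_group: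
  assumes "type_subfield E" "Qp \<subseteq> E"
  shows "fixed_field (galois_group E) = E"
  using galois_group_moves[OF assms] by (auto simp: fixed_field_def galois_group_fix)

end

section \<open>The absolute value\<close>

context padic_closure
begin

sublocale Qp: type_subfield Qp by (rule Qp_subfield)

lemma p_gt_1: "1 < real p"
  using prime_p prime_gt_1_nat by simp

lemma av_0 [simp]: "av 0 = 0" by (simp add: av_eq_0_iff)

lemma av_pos_iff: "0 < av x \<longleftrightarrow> x \<noteq> 0"
  using av_nonneg[of x] av_eq_0_iff[of x] by linarith

lemma av_1 [simp]: "av 1 = 1"
  using av_mult[of 1 1] av_eq_0_iff[of 1] by simp

lemma av_minus [simp]: "av (- x) = av x"
proof -
  have "av (- 1) ^ 2 = 1" using av_mult[of "- 1" "- 1"] by (simp add: power2_eq_square)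
  then have "av (- 1) = 1" using av_nonneg[of "- 1"] by (simp add: power2_eq_1_iff)
  then show ?thesis using av_mult[of "- 1" x] by simp
qed

lemma av_diff_commute: "av (x - y) = av (y - x)"
  using av_minus[of "x - y"] by simp

lemma av_diff_le: "av (x - y) \<le> max (av x) (av y)"
  using av_ultrametric[of x "- y"] by simp

lemma av_triangle: "av (x - z) \<le> max (av (x - y)) (av (y - z))"
  using av_ultrametric[of "x - y" "y - z"] by simp

lemma av_triangle_le: "av (x - y) \<le> c \<Longrightarrow> av (y - z) \<le> c \<Longrightarrow> av (x - z) \<le> c"
  using av_triangle[of x z y] by simp

lemma av_triangle_less: "av (x - y) < c \<Longrightarrow> av (y - z) < c \<Longrightarrow> av (x - z) < c"
  using av_triangle[of x z y] by simp

lemma av_isosceles: "av (x - y) < av y \<Longrightarrow> av x = av y"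
  using av_ultrametric[of "x - y" y] av_diff_le[of x "x - y"] by auto

lemma av_inverse: "av (inverse x) = inverse (av x)"
proof (cases "x = 0")
  case False
  then have "av x * av (inverse x) = 1" by (simp flip: av_mult)
  then show ?thesis by (metis inverse_unique)
qed simp

lemma av_divide: "av (x / y) = av x / av y"
  by (simp add: divide_inverse av_mult av_inverse)

lemma av_power: "av (x ^ n) = av x ^ n"
  by (induction n) (simp_all add: av_mult)

lemma av_powi: "av (x powi n) = av x powi n"
  by (simp add: power_int_def av_power av_inverse)

lemma av_prod: "av (prod f I) = (\<Prod>i\<in>I. av (f i))"
  by (induction I rule: infinite_finite_induct) (simp_all add: av_mult)

lemma av_prod_list: "av (prod_list xs) = prod_list (map av xs)"
  by (induction xs) (simp_all add: av_mult)

lemma av_sum_le: "(\<And>i. i \<in> I \<Longrightarrow> av (f i) \<le> c) \<Longrightarrow> 0 \<le> c \<Longrightarrow> av (sum f I) \<le> c"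
proof (induction I rule: infinite_finite_induct)
  case (insert i I)
  have "av (f i + sum f I) \<le> max (av (f i)) (av (sum f I))" by (rule av_ultrametric)
  also have "\<dots> \<le> c" using insert by simp
  finally show ?case using insert.hyps by simp
qed auto

lemma av_sum_less: "(\<And>i. i \<in> I \<Longrightarrow> av (f i) < c) \<Longrightarrow> 0 < c \<Longrightarrow> av (sum f I) < c"
proof (induction I rule: infinite_finite_induct)
  case (insert i I)
  have "av (f i + sum f I) \<le> max (av (f i)) (av (sum f I))" by (rule av_ultrametric)
  also have "\<dots> < c" using insert by simp
  finally show ?case using insert.hyps by simp
qed auto

lemma av_of_nat_le: "av (of_nat n) \<le> 1"
proof (induction n)
  case (Suc n)
  then show ?case using av_ultrametric[of 1 "of_nat n"] by simp
qed simp

lemma av_of_int_le: "av (of_int a) \<le> 1"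
  by (cases a rule: int_cases2) (use av_of_nat_le in auto)

text \<open>If \<open>a\<close> had absolute value below 1, both terms of a Bezout relation between
  \<open>p\<close> and \<open>a\<close> would too, but they add up to 1.\<close>

lemma av_of_int_coprime:
  assumes "\<not> int p dvd a"
  shows "av (of_int a) = 1"
proof (rule ccontr)
  assume "av (of_int a) \<noteq> 1"
  then have lt: "av (of_int a) < 1" using av_of_int_le[of a] by simp
  have "prime (int p)" using prime_p by simp
  then have "coprime (int p) a" using assms by (rule prime_imp_coprime)
  then obtain u v where "u * int p + v * a = 1" using coprime_iff_gcd_eq_1 bezout_int by metis
  then have "of_int u * of_nat p + of_int v * of_int a = (1 :: 'a)"
  proof -
    have "of_int (u * int p + v * a) = (of_int 1 :: 'a)" using \<open>u * int p + v * a = 1\<close> by (rule arg_cong)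
    then show ?thesis by simp
  qed
  moreover have "av (of_int u * of_nat p) < 1"
  proof -
    have "av (of_int u) * (1 / real p) \<le> 1 * (1 / real p)"
      by (rule mult_right_mono[OF av_of_int_le]) simp
    also have "\<dots> < 1" using p_gt_1 by simp
    finally show ?thesis by (simp add: av_mult av_p)
  qed
  moreover have "av (of_int v * of_int a) < 1"
    using mult_left_le_one_le[OF av_nonneg[of "of_int a"] av_nonneg[of "of_int v"] av_of_int_le] lt by (simp add: av_mult)
  ultimately show False using av_ultrametric[of "of_int u * of_nat p" "of_int v * of_int a"] by simp
qed

lemma av_p_power: "av (of_nat p ^ k) = (1 / real p) ^ k"
  by (simp add: av_power av_p)

lemma av_of_int_value: "a \<noteq> 0 \<Longrightarrow> \<exists>k. av (of_int a) = (1 / real p) ^ k"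
proof (induction "nat \<bar>a\<bar>" arbitrary: a rule: less_induct)
  case less
  show ?case
  proof (cases "int p dvd a")
    case True
    then obtain b where b: "a = int p * b" by blast
    have "b \<noteq> 0" using less.prems b by auto
    then have "\<bar>b\<bar> < \<bar>a\<bar>" using p_gt_1 unfolding b abs_mult by simp
    then have "nat \<bar>b\<bar> < nat \<bar>a\<bar>" by simp
    then obtain k where "av (of_int b) = (1 / real p) ^ k" using less.hyps[of b] \<open>b \<noteq> 0\<close> by blast
    then have "av (of_int a) = (1 / real p) ^ Suc k" by (simp add: b av_mult av_p)
    then show ?thesis by blast
  next
    case False
    then show ?thesis using av_of_int_coprime by (intro exI[of _ 0]) simp
  qed
qed

text \<open>A rational number nearer to \<open>x\<close> than \<open>av x\<close> has the same
  absolute value as \<open>x\<close>, which reduces the claim to fractions.\<close>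

lemma av_Qp_value:
  assumes "x \<in> Qp" "x \<noteq> 0"
  shows "\<exists>k :: int. av x = real p powi k"
proof -
  obtain q where q: "av (x - of_rat q) < av x" using rat_dense[OF assms(1)] av_pos_iff assms(2) by blast
  then have eq: "av (of_rat q) = av x" using av_isosceles[of "of_rat q" x] av_diff_commute by metis
  obtain a b where ab: "q = Rat.Fract a b" "b > 0" by (cases q)
  have "of_rat q \<noteq> (0 :: 'a)" using eq assms(2) av_pos_iff by (metis av_0 less_irrefl)
  then have "a \<noteq> 0" using ab by (auto simp: rat_number_collapse)
  obtain k where k: "av (of_int a) = (1 / real p) ^ k" using av_of_int_value[OF \<open>a \<noteq> 0\<close>] by blast
  obtain l where l: "av (of_int b) = (1 / real p) ^ l" using av_of_int_value[of b] ab by auto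
  have "av (of_rat q) = (1 / real p) ^ k / (1 / real p) ^ l"
    using ab k l by (simp add: of_rat_rat av_divide)
  also have "\<dots> = real p powi (int l - int k)"
    using p_gt_1 by (simp add: power_int_diff power_one_over)
  finally show ?thesis using eq by metis
qed

text \<open>Approximate \<open>x\<close> by a fraction in lowest terms. Being integral, it has a
  denominator prime to \<open>p\<close>, which can be inverted modulo \<open>p ^ M\<close>.\<close>

lemma Qp_integer_approx:
  assumes "x \<in> Qp" "av x \<le> 1"
  shows "\<exists>j < p ^ M. av (x - of_nat j) \<le> (1 / real p) ^ M"
proof -
  have pM: "0 < (1 / real p) ^ M" "(1 / real p) ^ M \<le> 1" using p_gt_1 by (simp_all add: power_le_one)
  obtain q where q: "av (x - of_rat q) < (1 / real p) ^ M" using rat_dense[OF assms(1) pM(1)] by blast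
  have "av (of_rat q) \<le> 1"
    using av_diff_le[of x "x - of_rat q"] q pM assms(2) by auto
  obtain a b where ab: "q = Rat.Fract a b" "b > 0" "coprime a b" by (cases q)
  have "\<not> int p dvd b"
  proof
    assume b: "int p dvd b"
    have "\<not> int p dvd a"
    proof
      assume "int p dvd a"
      then have "is_unit (int p)" using coprime_common_divisor[OF ab(3)] b by blast
      then show False using p_gt_1 by simp
    qed
    then have a1: "av (of_int a) = 1" by (rule av_of_int_coprime)
    obtain c where c: "b = int p * c" using b by blast
    have "av (of_int b) \<le> 1 / real p"
      unfolding c using av_of_int_le[of c] p_gt_1 by (simp add: av_mult av_p divide_right_mono)
    also have "\<dots> < 1" using p_gt_1 by simp
    finally have "av (of_int b) < 1" .
    moreover have "av (of_int b) > 0" using ab(2) by (simp add: av_pos_iff)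
    ultimately have "av (of_rat q) > 1" using a1 ab by (simp add: of_rat_rat av_divide)
    then show False using \<open>av (of_rat q) \<le> 1\<close> by simp
  qed
  then have b1: "av (of_int b) = 1" and "coprime (int p) b"
    using av_of_int_coprime prime_p by (auto intro: prime_imp_coprime)
  then have "coprime b (int p ^ M)" by (simp add: coprime_commute)
  then obtain u v where uv: "u * b + v * int p ^ M = 1" using coprime_iff_gcd_eq_1 bezout_int by metis
  \<comment> \<open>\<open>u\<close> inverts \<open>b\<close> modulo \<open>p ^ M\<close>, so
    \<open>a * u\<close> represents the fraction there.\<close>
  define j where "j = nat ((a * u) mod int p ^ M)"
  have pMi: "int p ^ M > 0" using prime_p prime_gt_0_nat by simp
  have j: "int j = (a * u) mod int p ^ M" using pMi by (simp add: j_def)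
  have "a - b * int j = a * (1 - u * b) + b * (a * u - int j)" by (simp add: algebra_simps)
  also have "1 - u * b = v * int p ^ M" using uv by simp
  also have "a * u - int j = int p ^ M * ((a * u) div int p ^ M)"
    unfolding j by (simp add: minus_mod_eq_mult_div)
  finally have "a - b * int j = int p ^ M * (a * v + b * ((a * u) div int p ^ M))"
    by (simp add: algebra_simps)
  then obtain w where w: "a - b * int j = int p ^ M * w" by blast
  have "of_rat q - of_nat j = (of_int (a - b * int j) / of_int b :: 'a)"
    using ab by (simp add: of_rat_rat field_simps)
  then have "av (of_rat q - of_nat j) = (1 / real p) ^ M * av (of_int w)"
    unfolding w by (simp add: av_divide b1 av_mult av_power av_p)
  also have "\<dots> \<le> (1 / real p) ^ M" using av_of_int_le[of w] pM by (simp add: mult_left_le)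
  finally have "av (x - of_nat j) \<le> (1 / real p) ^ M" using av_triangle_le[of x "of_rat q"] q by simp
  moreover have "j < p ^ M"
    using j pMi pos_mod_bound[of "int p ^ M" "a * u"] by (metis of_nat_less_iff of_nat_power)
  ultimately show ?thesis by blast
qed

section \<open>Completeness of \<open>Qp\<close> and equivalence of norms\<close>

lemma Qp_complete:
  assumes s: "\<And>n. s n \<in> Qp" and cauchy: "\<And>e. 0 < e \<Longrightarrow> \<exists>N. \<forall>m\<ge>N. \<forall>n\<ge>N. av (s m - s n) < e"
  shows "\<exists>l\<in>Qp. (\<lambda>n. av (s n - l)) \<longlonglongrightarrow> 0"
proof -
  interpret M: Metric_space Qp "\<lambda>x y. av (x - y)"
  proof
    fix x y z :: 'a
    show "0 \<le> av (x - y)" by (rule av_nonneg)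
    show "av (x - y) = av (y - x)" by (rule av_diff_commute)
    show "av (x - y) = 0 \<longleftrightarrow> x = y" by (simp add: av_eq_0_iff)
    show "av (x - z) \<le> av (x - y) + av (y - z)"
      using av_triangle[of x z y] av_nonneg[of "x - y"] av_nonneg[of "y - z"] by simp
  qed
  have "M.MCauchy s" unfolding M.MCauchy_def using s cauchy by auto
  then obtain l where "limitin M.mtopology s l sequentially"
    using complete_Qp unfolding M.mcomplete_def by blast
  then have l: "l \<in> Qp" "\<forall>e>0. \<exists>N. \<forall>n\<ge>N. s n \<in> Qp \<and> av (s n - l) < e"
    unfolding M.limit_metric_sequentially by auto
  have "\<exists>N. \<forall>n\<ge>N. norm (av (s n - l) - 0) < e" if "0 < e" for e
    using l(2)[rule_format, OF that] av_nonneg by auto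
  then have "(\<lambda>n. av (s n - l)) \<longlonglongrightarrow> 0" by (rule LIMSEQ_I)
  then show ?thesis using l(1) by blast
qed

text \<open>The error of the limiting combination is at most \<open>r m\<close> plus the coefficient
  errors weighted by \<open>av (f v)\<close>, and all of these tend to 0.\<close>

lemma combination_limit:
  assumes lim: "\<And>v. v \<in> W \<Longrightarrow> (\<lambda>m. av (C m v - c v)) \<longlonglongrightarrow> 0" and r: "r \<longlonglongrightarrow> 0"
    and close: "\<And>m. av (x - (\<Sum>v\<in>W. C m v * f v)) \<le> r m" and W: "finite W"
  shows "x = (\<Sum>v\<in>W. c v * f v)"
proof -
  have "av (x - (\<Sum>v\<in>W. c v * f v)) \<le> 0"
  proof (rule LIMSEQ_le_const)
    have "(\<lambda>m. r m + (\<Sum>v\<in>W. av (C m v - c v) * av (f v))) \<longlonglongrightarrow> 0 + (\<Sum>v\<in>W. 0 * av (f v))"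
      by (intro tendsto_intros lim r)
    then show "(\<lambda>m. r m + (\<Sum>v\<in>W. av (C m v - c v) * av (f v))) \<longlonglongrightarrow> 0" by simp
    have "av (x - (\<Sum>v\<in>W. c v * f v)) \<le> r m + (\<Sum>v\<in>W. av (C m v - c v) * av (f v))" for m
    proof -
      have nn: "0 \<le> (\<Sum>v\<in>W. av (C m v - c v) * av (f v))"
        by (auto intro!: sum_nonneg mult_nonneg_nonneg av_nonneg)
      have d: "x - (\<Sum>v\<in>W. c v * f v) = (x - (\<Sum>v\<in>W. C m v * f v)) + (\<Sum>v\<in>W. (C m v - c v) * f v)"
        by (simp add: sum_subtractf left_diff_distrib)
      have "av (\<Sum>v\<in>W. (C m v - c v) * f v) \<le> (\<Sum>v\<in>W. av (C m v - c v) * av (f v))"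
      proof (rule av_sum_le)
        fix v assume "v \<in> W"
        then show "av ((C m v - c v) * f v) \<le> (\<Sum>v\<in>W. av (C m v - c v) * av (f v))"
          unfolding av_mult using W by (intro member_le_sum) (auto intro: mult_nonneg_nonneg av_nonneg)
      qed (rule nn)
      then show ?thesis
        unfolding d using av_ultrametric[of "x - (\<Sum>v\<in>W. C m v * f v)" "\<Sum>v\<in>W. (C m v - c v) * f v"]
          close[of m] av_nonneg[of "x - (\<Sum>v\<in>W. C m v * f v)"] nn by linarith
    qed
    then show "\<exists>N. \<forall>m\<ge>N. av (x - (\<Sum>v\<in>W. c v * f v)) \<le> r m + (\<Sum>v\<in>W. av (C m v - c v) * av (f v))" by blast
  qed
  then have "\<not> 0 < av (x - (\<Sum>v\<in>W. c v * f v))" by linarith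
  then show ?thesis unfolding av_pos_iff by simp
qed

text \<open>
  In the induction step, the span of the previous vectors is complete, hence at positive distance from
  the new one.
\<close>

lemma norm_equivalence:
  fixes n d :: nat
  assumes indep: "\<And>c. (\<And>i. c i \<in> Qp) \<Longrightarrow> (\<Sum>i<n. c i * e i) = 0 \<Longrightarrow> \<forall>i<n. c i = 0" and "d \<le> n"
  shows "\<exists>C>0. \<forall>c. (\<forall>i. c i \<in> Qp) \<longrightarrow> (\<forall>i<d. av (c i) \<le> C * av (\<Sum>i<d. c i * e i))"
  using \<open>d \<le> n\<close>
proof (induction d)
  case 0
  then show ?case by (intro exI[of _ 1]) simp
next
  case (Suc d)
  then obtain C where C: "C > 0" "\<And>c i. (\<And>i. c i \<in> Qp) \<Longrightarrow> i < d \<Longrightarrow> av (c i) \<le> C * av (\<Sum>i<d. c i * e i)"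
    by auto
  have "\<exists>\<eta>>0. \<forall>c. (\<forall>i. c i \<in> Qp) \<longrightarrow> \<eta> \<le> av (e d - (\<Sum>i<d. c i * e i))"
  proof (rule ccontr)
    assume "\<not> ?thesis"
    then have "\<forall>k. \<exists>c. (\<forall>i. c i \<in> Qp) \<and> av (e d - (\<Sum>i<d. c i * e i)) < 1 / Suc k"
      by (auto simp: not_le)
    then obtain c where c: "\<And>k i. c k i \<in> Qp" "\<And>k. av (e d - (\<Sum>i<d. c k i * e i)) < 1 / Suc k"
      by metis
    have diff: "av (c k i - c l i) < C * (1 / Suc (min k l))" if "i < d" for k l i
    proof -
      have "av (c k i - c l i) \<le> C * av (\<Sum>i<d. (c k i - c l i) * e i)"
        using C(2)[of "\<lambda>i. c k i - c l i"] c(1) that by (simp add: Qp.diff_mem)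
      also have "(\<Sum>i<d. (c k i - c l i) * e i) = (e d - (\<Sum>i<d. c l i * e i)) - (e d - (\<Sum>i<d. c k i * e i))"
        by (simp add: algebra_simps sum_subtractf)
      also have "av \<dots> < 1 / Suc (min k l)"
      proof -
        have "1 / real (Suc k) \<le> 1 / real (Suc (min k l))" "1 / real (Suc l) \<le> 1 / real (Suc (min k l))"
          by (intro divide_left_mono; simp)+
        then show ?thesis using av_diff_le[of "e d - (\<Sum>i<d. c l i * e i)" "e d - (\<Sum>i<d. c k i * e i)"] c(2)[of k] c(2)[of l]
          by linarith
      qed
      finally show ?thesis using C(1) by simp
    qed
    have "\<exists>l\<in>Qp. (\<lambda>k. av (c k i - l)) \<longlonglongrightarrow> 0" if "i < d" for i
    proof (rule Qp_complete)
      fix \<epsilon> :: real assume "0 < \<epsilon>"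
      then have "0 < \<epsilon> / C" using C(1) by simp
      then obtain N where N: "1 / real (Suc N) < \<epsilon> / C" using nat_approx_posE by metis
      show "\<exists>N. \<forall>m\<ge>N. \<forall>n\<ge>N. av (c m i - c n i) < \<epsilon>"
      proof (intro exI[of _ N] allI impI)
        fix m n assume "m \<ge> N" "n \<ge> N"
        then have "1 / real (Suc (min m n)) \<le> 1 / real (Suc N)" by (intro divide_left_mono) auto
        then have "1 / real (Suc (min m n)) < \<epsilon> / C" using N by linarith
        then have "C * (1 / real (Suc (min m n))) < \<epsilon>" using C(1) by (simp add: pos_less_divide_eq mult.commute)
        then show "av (c m i - c n i) < \<epsilon>" using diff[OF that, of m n] by linarith
      qed
    qed (rule c(1))
    then obtain l where l: "\<And>i. i < d \<Longrightarrow> l i \<in> Qp" "\<And>i. i < d \<Longrightarrow> (\<lambda>k. av (c k i - l i)) \<longlonglongrightarrow> 0"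
      by metis
    have z: "e d = (\<Sum>i<d. l i * e i)"
    proof (rule combination_limit)
      show "av (e d - (\<Sum>i<d. c m i * e i)) \<le> 1 / real (Suc m)" for m using c(2)[of m] by simp
    qed (use l(2) LIMSEQ_inverse_real_of_nat in \<open>auto simp: inverse_eq_divide\<close>)
    \<comment> \<open>The limit relation, padded with zeros up to \<open>n\<close>, contradicts
      independence: its coefficient at \<open>d\<close> is 1.\<close>
    define c' where "c' i = (if i < d then - l i else if i = d then 1 else 0)" for i
    have "c' i \<in> Qp" for i using l(1) by (auto simp: c'_def Qp.uminus_mem Qp.one_mem Qp.zero_mem)
    moreover have "(\<Sum>i<n. c' i * e i) = 0"
    proof -
      have "(\<Sum>i<n. c' i * e i) = (\<Sum>i<Suc d. c' i * e i)"
        by (rule sum.mono_neutral_right) (use Suc.prems in \<open>auto simp: c'_def\<close>)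
      also have "\<dots> = (\<Sum>i<d. c' i * e i) + c' d * e d" by simp
      also have "(\<Sum>i<d. c' i * e i) = (\<Sum>i<d. - (l i * e i))"
        by (rule sum.cong) (simp_all add: c'_def)
      finally show ?thesis using z by (simp add: c'_def sum_negf)
    qed
    ultimately have "\<forall>i<n. c' i = 0" by (rule indep)
    then have "c' d = 0" using Suc.prems by simp
    then show False by (simp add: c'_def)
  qed
  then obtain \<eta> where \<eta>: "\<eta> > 0" "\<And>c. (\<And>i. c i \<in> Qp) \<Longrightarrow> \<eta> \<le> av (e d - (\<Sum>i<d. c i * e i))" by blast
  \<comment> \<open>The first summand bounds \<open>c d\<close>, by the distance
    \<open>\<eta>\<close>. The second bounds the other coefficients, whose combination is the whole
    sum minus \<open>c d * e d\<close>.\<close>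
  define C' where "C' = 1 / \<eta> + C * (1 + av (e d) / \<eta>)"
  have "C' > 0" unfolding C'_def using \<eta>(1) C(1) av_nonneg[of "e d"]
    by (intro add_pos_nonneg mult_nonneg_nonneg) auto
  moreover have "av (c i) \<le> C' * av (\<Sum>i<Suc d. c i * e i)" if c: "\<forall>i. c i \<in> Qp" and i: "i < Suc d" for c i
  proof -
    define v where "v = (\<Sum>i<d. c i * e i)"
    define s where "s = v + c d * e d"
    have s: "(\<Sum>i<Suc d. c i * e i) = s" by (simp add: s_def v_def)
    have cd: "av (c d) \<le> av s / \<eta>"
    proof (cases "c d = 0")
      case True
      then show ?thesis using \<eta>(1) av_nonneg[of s] by simp
    next
      case False
      have "\<eta> \<le> av (e d - (\<Sum>i<d. - (c i / c d) * e i))"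
        using c by (intro \<eta>(2)) (auto intro: Qp.uminus_mem Qp.divide_mem)
      also have "e d - (\<Sum>i<d. - (c i / c d) * e i) = s / c d"
        using False by (simp add: s_def v_def sum_negf add_divide_distrib sum_divide_distrib)
      finally have "\<eta> \<le> av s / av (c d)" by (simp add: av_divide)
      then show ?thesis using False \<eta>(1) av_pos_iff[of "c d"] by (simp add: field_simps)
    qed
    have sn: "0 \<le> av s" by (rule av_nonneg)
    have "av v \<le> max (av s) (av (c d) * av (e d))"
      using av_diff_le[of s "c d * e d"] by (simp add: s_def av_mult)
    also have "\<dots> \<le> av s + av s / \<eta> * av (e d)"
      using mult_right_mono[OF cd av_nonneg[of "e d"]] sn mult_nonneg_nonneg[OF av_nonneg[of "c d"] av_nonneg[of "e d"]]
      by linarith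
    also have "\<dots> = (1 + av (e d) / \<eta>) * av s" by (simp add: algebra_simps)
    finally have v: "av v \<le> (1 + av (e d) / \<eta>) * av s" .
    have t1: "0 \<le> av s / \<eta>" using sn \<eta>(1) by simp
    have t2: "0 \<le> C * ((1 + av (e d) / \<eta>) * av s)"
      using C(1) \<eta>(1) sn av_nonneg[of "e d"] by (intro mult_nonneg_nonneg add_nonneg_nonneg) auto
    have C's: "C' * av s = av s / \<eta> + C * ((1 + av (e d) / \<eta>) * av s)" by (simp add: C'_def algebra_simps)
    show ?thesis unfolding s
    proof (cases "i = d")
      case True
      then show "av (c i) \<le> C' * av s" using cd t2 C's by simp
    next
      case False
      then have "av (c i) \<le> C * av v" using C(2)[of c i] c i unfolding v_def by simp
      also have "\<dots> \<le> C * ((1 + av (e d) / \<eta>) * av s)" using v C(1) by (intro mult_left_mono) auto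
      finally show "av (c i) \<le> C' * av s" using t1 C's by simp
    qed
  qed
  ultimately show ?case by blast
qed

section \<open>Galois conjugation is isometric\<close>

text \<open>Reduce the monomial of exponent \<open>k\<close> modulo \<open>P\<close>.\<close>

lemma power_in_span:
  assumes "min_relation Qp x P"
  shows "\<exists>c. (\<forall>i. c i \<in> Qp) \<and> (\<Sum>i<degree P. c i * x ^ i) = x ^ k"
proof -
  have P: "P \<in> polys_in Qp" "P \<noteq> 0" "poly P x = 0" using assms by (auto simp: min_relation_def)
  have "Polynomial.monom 1 k \<in> polys_in Qp" by (rule Qp.polys_in_monom[OF Qp.one_mem])
  then obtain A R where AR: "R \<in> polys_in Qp" "Polynomial.monom 1 k = P * A + R" "R = 0 \<or> degree R < degree P"
    using Qp.polys_in_divmod[OF P(1,2)] by metis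
  have "x ^ k = poly R x" using arg_cong[OF AR(2), of "\<lambda>q. poly q x"] P(3) by (simp add: poly_monom)
  also have "\<dots> = (\<Sum>i\<le>degree R. coeff R i * x ^ i)" by (rule poly_altdef)
  also have "\<dots> = (\<Sum>i<degree P. coeff R i * x ^ i)"
  proof (cases "R = 0")
    case False
    then show ?thesis using AR(3) by (intro sum.mono_neutral_left) (auto simp: coeff_eq_0)
  qed simp
  finally show ?thesis using AR(1) by (intro exI[of _ "coeff R"]) (simp add: polys_in_def)
qed

text \<open>Norm equivalence on the span of the powers of \<open>x\<close> bounds
  \<open>av (\<sigma> x) ^ k\<close> by a constant times \<open>av x ^ k\<close> for every
  \<open>k\<close>. For large \<open>k\<close> the constant is negligible.\<close>

lemma av_galois_le:
  assumes "\<sigma> \<in> galois_group Qp"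
  shows "av (\<sigma> x) \<le> av x"
proof (rule ccontr)
  assume "\<not> av (\<sigma> x) \<le> av x"
  then have lt: "av x < av (\<sigma> x)" by simp
  interpret field_auto \<sigma> using assms by (rule galois_group_field_auto)
  have x: "x \<noteq> 0" using lt hom_zero by auto
  obtain P where P: "min_relation Qp x P" using algebraic_Qp[of x] min_relation_exists by blast
  let ?n = "degree P"
  have "\<forall>i<?n. c i = 0" if c: "\<And>i. c i \<in> Qp" and z: "(\<Sum>i<?n. c i * x ^ i) = 0" for c
  proof -
    define Q where "Q = (\<Sum>i<?n. Polynomial.monom (c i) i)"
    have co: "coeff Q i = (if i < ?n then c i else 0)" for i
      unfolding Q_def coeff_sum by simp
    have "poly Q x = 0" using z by (simp add: Q_def poly_sum poly_monom)
    moreover have "Q \<in> polys_in Qp" using c Qp.zero_mem by (simp add: polys_in_def co)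
    moreover have "Q \<noteq> 0 \<Longrightarrow> degree Q < ?n"
      using co leading_coeff_0_iff[of Q] by (metis)
    ultimately have "Q = 0" using P unfolding min_relation_def by force
    then show ?thesis using co by (metis coeff_0)
  qed
  from norm_equivalence[where n = ?n and d = ?n and e = "\<lambda>i. x ^ i", OF this order.refl]
  obtain C where C: "C > 0" "\<And>c i. (\<And>i. c i \<in> Qp) \<Longrightarrow> i < ?n \<Longrightarrow> av (c i) \<le> C * av (\<Sum>i<?n. c i * x ^ i)"
    by auto
  \<comment> \<open>\<open>C\<close> comes from the norm equivalence; the power dominates
    \<open>av (\<sigma> x) ^ i\<close> for all \<open>i\<close> below the degree.\<close>
  define B where "B = C * (1 + av (\<sigma> x)) ^ ?n"
  have bound: "av (\<sigma> x) ^ k \<le> B * av x ^ k" for k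
  proof -
    obtain c where c: "\<And>i. c i \<in> Qp" "(\<Sum>i<?n. c i * x ^ i) = x ^ k" using power_in_span[OF P] by metis
    have "av (\<sigma> x) ^ k = av (\<sigma> (\<Sum>i<?n. c i * x ^ i))" by (simp add: c(2) hom_power av_power)
    also have "\<sigma> (\<Sum>i<?n. c i * x ^ i) = (\<Sum>i<?n. c i * \<sigma> x ^ i)"
      using galois_group_fix[OF assms c(1)] by (simp add: hom_sum hom_mult hom_power)
    also have "av \<dots> \<le> B * av x ^ k"
    proof (rule av_sum_le)
      fix i assume i: "i \<in> {..<?n}"
      have "av (c i) \<le> C * av x ^ k" using C(2)[of c i] c i by (simp add: av_power)
      moreover have "av (\<sigma> x) ^ i \<le> (1 + av (\<sigma> x)) ^ ?n"
      proof -
        have "av (\<sigma> x) ^ i \<le> (1 + av (\<sigma> x)) ^ i" by (intro power_mono) (auto simp: av_nonneg)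
        also have "\<dots> \<le> (1 + av (\<sigma> x)) ^ ?n" using i by (intro power_increasing) (auto simp: av_nonneg)
        finally show ?thesis .
      qed
      ultimately have "av (c i) * av (\<sigma> x) ^ i \<le> (C * av x ^ k) * (1 + av (\<sigma> x)) ^ ?n"
        using C(1) by (intro mult_mono) (auto intro!: mult_nonneg_nonneg zero_le_power av_nonneg)
      then show "av (c i * \<sigma> x ^ i) \<le> B * av x ^ k" by (simp add: B_def av_mult av_power mult_ac)
    next
      show "0 \<le> B * av x ^ k" unfolding B_def
        using C(1) by (auto intro!: mult_nonneg_nonneg zero_le_power av_nonneg add_nonneg_nonneg)
    qed
    finally show ?thesis .
  qed
  have "1 < av (\<sigma> x) / av x" using lt x av_pos_iff[of x] by simp
  then obtain k where "B < (av (\<sigma> x) / av x) ^ k" using real_arch_pow by blast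
  then show False using bound[of k] x av_pos_iff[of x] by (simp add: power_divide field_simps)
qed

lemma av_galois:
  assumes "\<sigma> \<in> galois_group Qp"
  shows "av (\<sigma> x) = av x"
proof (rule antisym)
  show "av x \<le> av (\<sigma> x)"
    using av_galois_le[OF galois_group_inv[OF assms], of "\<sigma> x"] galois_group_inv_apply(1)[OF assms] by simp
qed (rule av_galois_le[OF assms])

lemma av_galois_diff:
  assumes "\<sigma> \<in> galois_group Qp"
  shows "av (\<sigma> x - \<sigma> y) = av (x - y)"
  using av_galois[OF assms, of "x - y"] field_auto.hom_diff[OF galois_group_field_auto[OF assms]] by simp

end

section \<open>Conjugates\<close>

text \<open>\<open>f\<close> factors through \<open>g\<close> on \<open>S\<close>; used to compare
  orbits of points with orbits of disks.\<close>

lemma image_factor: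
  assumes "finite (g ` S)" "\<And>x y. x \<in> S \<Longrightarrow> y \<in> S \<Longrightarrow> g x = g y \<Longrightarrow> f x = f y"
  shows "finite (f ` S)" "card (f ` S) \<le> card (g ` S)"
proof -
  define h where "h z = f (SOME x. x \<in> S \<and> g x = z)" for z
  have "f x = h (g x)" if x: "x \<in> S" for x
  proof -
    have "(SOME y. y \<in> S \<and> g y = g x) \<in> S \<and> g (SOME y. y \<in> S \<and> g y = g x) = g x"
      by (rule someI[of _ x]) (use x in simp)
    then show ?thesis unfolding h_def using assms(2)[OF x] by metis
  qed
  then have "f ` S = h ` (g ` S)" by (auto simp: image_image)
  then show "finite (f ` S)" "card (f ` S) \<le> card (g ` S)" using assms(1) card_image_le by auto
qed

context padic_closure
begin

text \<open>
  The number \<open>card (orb x)\<close> of conjugates serves as the degree of \<open>x\<close> over \<open>Qp\<close>.  Note that \<^const>\<open>galois_group\<close>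
  may be applied to any set: \<open>galois_group (Qp \<union> A)\<close> consists of the automorphisms fixing \<open>A\<close>.
\<close>

definition orb :: "'a \<Rightarrow> 'a set" where
  "orb x = (\<lambda>\<sigma>. \<sigma> x) ` galois_group Qp"

lemma orb_self: "x \<in> orb x"
  unfolding orb_def using galois_group_id[of Qp] by (metis id_apply image_eqI)

lemma orb_galois: "\<sigma> \<in> galois_group Qp \<Longrightarrow> \<sigma> x \<in> orb x"
  unfolding orb_def by blast

lemma av_orb: "y \<in> orb x \<Longrightarrow> av y = av x"
  unfolding orb_def using av_galois by auto

lemma galois_root:
  assumes "\<sigma> \<in> galois_group E" "q \<in> polys_in E" "poly q x = 0"
  shows "poly q (\<sigma> x) = 0"
proof -
  interpret field_auto \<sigma> using assms(1) by (rule galois_group_field_auto)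
  have "map_poly \<sigma> q = q"
    using assms(2) galois_group_fix[OF assms(1)] by (intro poly_eqI) (simp add: coeff_map_poly hom_zero polys_in_def)
  then show ?thesis using hom_poly[of q x] assms(3) hom_zero by simp
qed

lemma card_orb_le_degree:
  assumes "q \<in> polys_in Qp" "q \<noteq> 0" "poly q x = 0"
  shows "finite (orb x)" and "card (orb x) \<le> degree q"
proof -
  have sub: "orb x \<subseteq> {y. poly q y = 0}"
    unfolding orb_def using galois_root[OF _ assms(1,3)] by auto
  have fin: "finite {y. poly q y = 0}" by (rule poly_roots_finite[OF assms(2)])
  show "finite (orb x)" using sub fin by (rule finite_subset)
  show "card (orb x) \<le> degree q"
    using card_mono[OF fin sub] card_poly_roots_bound[OF assms(2)] by simp
qed

lemma finite_orb: "finite (orb x)"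
  using algebraic_Qp[of x] card_orb_le_degree(1) by blast

lemma card_orb_pos: "card (orb x) > 0"
  using finite_orb[of x] orb_self[of x] card_gt_0_iff by blast

lemma galois_orb_image:
  assumes "\<sigma> \<in> galois_group Qp"
  shows "\<sigma> ` orb x = orb x"
proof -
  have "\<sigma> ` orb x \<subseteq> orb x" 
  proof
    fix y assume "y \<in> \<sigma> ` orb x"
    then obtain \<tau> where t: "\<tau> \<in> galois_group Qp" "y = \<sigma> (\<tau> x)" by (auto simp: orb_def)
    then show "y \<in> orb x" using orb_galois[OF galois_group_comp[OF assms t(1)], of x] by simp
  qed
  moreover have "inj_on \<sigma> (orb x)"
    using assms by (auto simp: galois_group_iff bij_def intro: inj_on_subset)
  ultimately show ?thesis by (rule endo_inj_surj[OF finite_orb])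
qed

lemma prod_orb_galois:
  assumes "\<sigma> \<in> galois_group Qp"
  shows "(\<Prod>y\<in>orb x. f (\<sigma> y)) = (\<Prod>y\<in>orb x. f y)"
proof -
  have "inj_on \<sigma> (orb x)"
    using assms by (auto simp: galois_group_iff bij_def intro: inj_on_subset)
  from prod.reindex[OF this, of f] show ?thesis by (simp add: galois_orb_image[OF assms])
qed

lemma Qp_iff_galois_fixed: "x \<in> Qp \<longleftrightarrow> (\<forall>\<sigma>\<in>galois_group Qp. \<sigma> x = x)"
  using fixed_field_galois_group[OF Qp_subfield order.refl] by (auto simp: fixed_field_def)

text \<open>The minimal polynomial of \<open>x\<close> over \<open>Qp\<close>.\<close>

definition conj_poly :: "'a \<Rightarrow> 'a poly" where
  "conj_poly x = (\<Prod>y\<in>orb x. [:- y, 1:])"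

lemma conj_poly_in: "conj_poly x \<in> polys_in Qp"
proof -
  have "\<sigma> (coeff (conj_poly x) i) = coeff (conj_poly x) i" if s: "\<sigma> \<in> galois_group Qp" for \<sigma> i
  proof -
    interpret field_auto \<sigma> using s by (rule galois_group_field_auto)
    have "map_poly \<sigma> (conj_poly x) = (\<Prod>y\<in>orb x. [:- \<sigma> y, 1:])"
      unfolding conj_poly_def map_poly_prod by (simp add: map_poly_pCons hom_zero hom_one hom_uminus)
    also have "\<dots> = conj_poly x" unfolding conj_poly_def by (rule prod_orb_galois[OF s])
    finally have "coeff (map_poly \<sigma> (conj_poly x)) i = coeff (conj_poly x) i" by simp
    then show ?thesis by (simp add: coeff_map_poly hom_zero)
  qed
  then show ?thesis unfolding polys_in_def using Qp_iff_galois_fixed by blast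
qed

lemma degree_conj_poly: "degree (conj_poly x) = card (orb x)"
  unfolding conj_poly_def by (subst degree_prod_sum_eq) auto

lemma lead_coeff_conj_poly: "lead_coeff (conj_poly x) = 1"
  unfolding conj_poly_def by (subst lead_coeff_prod) simp

lemma poly_conj_poly: "poly (conj_poly x) z = (\<Prod>y\<in>orb x. z - y)"
  unfolding conj_poly_def by (simp add: poly_prod)

lemma poly_conj_poly_self: "poly (conj_poly x) x = 0"
  unfolding poly_conj_poly using finite_orb orb_self by (intro prod_zero) auto

text \<open>Multiplying by one linear factor at a time keeps the coefficients integral, because all
  conjugates have the absolute value of \<open>x\<close>.\<close>

lemma av_coeff_conj_poly_le:
  assumes "av x \<le> 1"
  shows "av (coeff (conj_poly x) i) \<le> 1"
proof -
  have "\<forall>i. av (coeff (\<Prod>y\<in>S. [:- y, 1:]) i) \<le> 1" if "finite S" "\<And>y. y \<in> S \<Longrightarrow> av y \<le> 1" for S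
    using that
  proof (induction S rule: finite_induct)
    case empty
    then show ?case by (simp add: coeff_1)
  next
    case (insert s S)
    show ?case
    proof
      fix i
      have IH: "av (coeff (\<Prod>y\<in>S. [:- y, 1:]) j) \<le> 1" for j using insert by simp
      let ?P = "\<Prod>y\<in>S. [:- y, 1:]"
      have c: "coeff ([:- s, 1:] * ?P) i = coeff (pCons 0 ?P) i - s * coeff ?P i" by simp
      have "av (coeff (pCons 0 ?P) i) \<le> 1" using IH by (simp add: coeff_pCons split: nat.splits)
      moreover have "av (s * coeff ?P i) \<le> 1"
        unfolding av_mult using insert.prems[of s] IH[of i] av_nonneg by (simp add: mult_le_one)
      ultimately have "av (coeff ([:- s, 1:] * ?P) i) \<le> 1" unfolding c using av_diff_le by (meson max.bounded_iff order_trans)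
      then show "av (coeff (\<Prod>y\<in>insert s S. [:- y, 1:]) i) \<le> 1" using insert.hyps by simp
    qed
  qed
  then show ?thesis unfolding conj_poly_def using finite_orb av_orb assms by metis
qed

text \<open>The product of the conjugates is the norm: it lies in \<open>Qp\<close>, and each factor
  has absolute value \<open>av x\<close>.\<close>

lemma av_value_power_orb:
  assumes "x \<noteq> 0"
  shows "\<exists>k :: int. av x ^ card (orb x) = real p powi k"
proof -
  have "(\<Prod>y\<in>orb x. y) \<in> Qp"
    unfolding Qp_iff_galois_fixed
  proof
    fix \<sigma> assume s: "\<sigma> \<in> galois_group Qp"
    interpret field_auto \<sigma> using s by (rule galois_group_field_auto)
    show "\<sigma> (\<Prod>y\<in>orb x. y) = (\<Prod>y\<in>orb x. y)" using prod_orb_galois[OF s, of "\<lambda>y. y"] by (simp add: hom_prod)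
  qed
  moreover have av: "av (\<Prod>y\<in>orb x. y) = av x ^ card (orb x)"
    unfolding av_prod using av_orb by simp
  moreover have "(\<Prod>y\<in>orb x. y) \<noteq> 0"
  proof
    assume "(\<Prod>y\<in>orb x. y) = 0"
    then have "av x ^ card (orb x) = 0" using av by simp
    then show False using assms av_eq_0_iff by simp
  qed
  ultimately show ?thesis using av_Qp_value by metis
qed

text \<open>An index argument. The restriction to \<open>A\<close> determines an element of
  \<open>galois_group Qp\<close> up to composition on the right with \<open>galois_group E\<close>,
  and there are at most as many restrictions as the product of the orbits allows. \<open>act\<close>
  abstracts the action, so that the bound serves both points and disks.\<close>

lemma card_galois_image_le:
  assumes A: "finite A" "\<And>\<sigma>. \<sigma> \<in> galois_group Qp \<Longrightarrow> (\<And>a. a \<in> A \<Longrightarrow> \<sigma> a = a) \<Longrightarrow> \<sigma> \<in> galois_group E"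
    and act: "\<And>\<sigma> \<tau>. \<sigma> \<in> galois_group Qp \<Longrightarrow> \<tau> \<in> galois_group E \<Longrightarrow> \<Phi> (\<sigma> \<circ> \<tau>) = act \<sigma> (\<Phi> \<tau>)"
    and fin: "finite (\<Phi> ` galois_group E)"
  shows "card (\<Phi> ` galois_group Qp) \<le> (\<Prod>a\<in>A. card (orb a)) * card (\<Phi> ` galois_group E)"
proof -
  let ?r = "\<lambda>\<sigma>. restrict \<sigma> A"
  let ?R = "?r ` galois_group Qp"
  define rep where "rep f = (SOME \<sigma>. \<sigma> \<in> galois_group Qp \<and> ?r \<sigma> = f)" for f
  have sub: "?R \<subseteq> (\<Pi>\<^sub>E a\<in>A. orb a)" using orb_galois by auto
  have finP: "finite (\<Pi>\<^sub>E a\<in>A. orb a)" using A(1) finite_orb by (simp add: finite_PiE)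
  have cR: "card ?R \<le> (\<Prod>a\<in>A. card (orb a))"
    using card_mono[OF finP sub] card_PiE[OF A(1), of orb] by simp
  have "\<Phi> \<sigma> \<in> (\<Union>f\<in>?R. act (rep f) ` (\<Phi> ` galois_group E))" if s: "\<sigma> \<in> galois_group Qp" for \<sigma>
  proof -
    have \<rho>: "rep (?r \<sigma>) \<in> galois_group Qp \<and> ?r (rep (?r \<sigma>)) = ?r \<sigma>"
      unfolding rep_def by (rule someI[of _ \<sigma>]) (use s in simp)
    define \<rho> where "\<rho> = rep (?r \<sigma>)"
    have \<rho>G: "\<rho> \<in> galois_group Qp" using \<rho> by (simp add: \<rho>_def)
    have eq: "\<rho> a = \<sigma> a" if "a \<in> A" for a
      using fun_cong[OF \<rho>[THEN conjunct2], of a] that by (simp add: \<rho>_def)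
    define \<tau> where "\<tau> = inv_into UNIV \<rho> \<circ> \<sigma>"
    have "\<tau> \<in> galois_group Qp" unfolding \<tau>_def by (intro galois_group_comp galois_group_inv \<rho>G s)
    moreover have "\<tau> a = a" if "a \<in> A" for a
      using galois_group_inv_apply(1)[OF \<rho>G, of a] eq[OF that] by (simp add: \<tau>_def)
    ultimately have \<tau>: "\<tau> \<in> galois_group E" by (rule A(2))
    have "\<rho> \<circ> \<tau> = \<sigma>" using galois_group_inv_apply(2)[OF \<rho>G] by (auto simp: \<tau>_def)
    then have "\<Phi> \<sigma> = act \<rho> (\<Phi> \<tau>)" using act[OF \<rho>G \<tau>] by simp
    then show ?thesis using s \<tau> unfolding \<rho>_def by blast
  qed
  then have sub2: "\<Phi> ` galois_group Qp \<subseteq> (\<Union>f\<in>?R. act (rep f) ` (\<Phi> ` galois_group E))" by blast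
  have finR: "finite ?R" using finite_subset[OF sub finP] .
  have "card (\<Phi> ` galois_group Qp) \<le> card (\<Union>f\<in>?R. act (rep f) ` (\<Phi> ` galois_group E))"
    by (rule card_mono[OF _ sub2]) (use finR fin in blast)
  also have "\<dots> \<le> (\<Sum>f\<in>?R. card (act (rep f) ` (\<Phi> ` galois_group E)))" by (rule card_UN_le[OF finR])
  also have "\<dots> \<le> (\<Sum>f\<in>?R. card (\<Phi> ` galois_group E))" by (intro sum_mono card_image_le fin)
  also have "\<dots> \<le> (\<Prod>a\<in>A. card (orb a)) * card (\<Phi> ` galois_group E)" using cR by simp
  finally show ?thesis .
qed

text \<open>Automorphisms fixing \<open>A\<close> fix \<open>x\<close>, so the orbit under them is a
  single point and only the index remains.\<close>

lemma card_orb_determined: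
  assumes "finite A"
    and det: "\<And>\<sigma> \<tau>. \<sigma> \<in> galois_group Qp \<Longrightarrow> \<tau> \<in> galois_group Qp \<Longrightarrow> (\<And>a. a \<in> A \<Longrightarrow> \<sigma> a = \<tau> a) \<Longrightarrow> \<sigma> x = \<tau> x"
  shows "card (orb x) \<le> (\<Prod>a\<in>A. card (orb a))"
proof -
  have "\<tau> x = x" if "\<tau> \<in> galois_group (Qp \<union> A)" for \<tau>
    using det[of \<tau> id] that galois_group_id by (auto simp: galois_group_iff)
  then have fixed: "(\<lambda>\<sigma>. \<sigma> x) ` galois_group (Qp \<union> A) \<subseteq> {x}" by blast
  have "card ((\<lambda>\<sigma>. \<sigma> x) ` galois_group Qp)
      \<le> (\<Prod>a\<in>A. card (orb a)) * card ((\<lambda>\<sigma>. \<sigma> x) ` galois_group (Qp \<union> A))"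
  proof (rule card_galois_image_le[OF assms(1)])
    show "(\<sigma> \<circ> \<tau>) x = \<sigma> (\<tau> x)" for \<sigma> \<tau> :: "'a \<Rightarrow> 'a" by simp
    show "finite ((\<lambda>\<sigma>. \<sigma> x) ` galois_group (Qp \<union> A))" using fixed finite_subset by blast
  qed (auto simp: galois_group_iff)
  also have "\<dots> \<le> (\<Prod>a\<in>A. card (orb a)) * 1"
    using card_mono[OF _ fixed] by (intro mult_left_mono) auto
  finally show ?thesis by (simp add: orb_def)
qed

lemma galois_group_inv_comp:
  assumes "\<sigma> \<in> galois_group Qp" "\<tau> \<in> galois_group Qp" "\<And>x. x \<in> E \<Longrightarrow> \<sigma> x = \<tau> x"
  shows "inv_into UNIV \<tau> \<circ> \<sigma> \<in> galois_group E"
proof -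
  have "inv_into UNIV \<tau> \<circ> \<sigma> \<in> galois_group Qp"
    by (intro galois_group_comp galois_group_inv assms)
  moreover have "(inv_into UNIV \<tau> \<circ> \<sigma>) x = x" if "x \<in> E" for x
    using assms(3)[OF that] galois_group_inv_apply(1)[OF assms(2)] by simp
  ultimately show ?thesis by (simp add: galois_group_iff)
qed

lemma galois_agree_fixed_field:
  assumes "\<sigma> \<in> galois_group Qp" "\<tau> \<in> galois_group Qp" "\<And>a. a \<in> A \<Longrightarrow> \<sigma> a = \<tau> a"
    and "x \<in> fixed_field (galois_group (Qp \<union> A))"
  shows "\<sigma> x = \<tau> x"
proof -
  have "\<sigma> a = \<tau> a" if "a \<in> Qp \<union> A" for a
    using that assms(3) galois_group_fix[OF assms(1)] galois_group_fix[OF assms(2)] by auto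
  then have "inv_into UNIV \<tau> \<circ> \<sigma> \<in> galois_group (Qp \<union> A)"
    by (rule galois_group_inv_comp[OF assms(1,2)])
  then have "(inv_into UNIV \<tau> \<circ> \<sigma>) x = x" using assms(4) unfolding fixed_field_def by blast
  then show ?thesis using galois_group_inv_apply(2)[OF assms(2)] by (metis comp_apply)
qed

lemma fixed_field_mono: "A \<subseteq> B \<Longrightarrow> fixed_field (galois_group (Qp \<union> A)) \<subseteq> fixed_field (galois_group (Qp \<union> B))"
  using galois_group_antimono[of "Qp \<union> A" "Qp \<union> B"] by (auto simp: fixed_field_def)

lemma fixed_field_mem: "x \<in> A \<Longrightarrow> x \<in> fixed_field (galois_group A)"
  by (simp add: fixed_field_def galois_group_fix)

section \<open>Total boundedness in bounded degree\<close>

text \<open>If all roots were at distance at least \<open>\<delta>\<close> from \<open>x\<close>,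
  the product of the distances, which is \<open>av (poly g x)\<close>, would be at least
  \<open>\<delta> ^ degree g\<close>.\<close>

lemma close_root:
  assumes "lead_coeff g = 1" "0 < \<delta>" "av (poly g x) < \<delta> ^ degree g"
  shows "\<exists>\<beta>. poly g \<beta> = 0 \<and> av (x - \<beta>) < \<delta>"
proof (rule ccontr)
  assume neg: "\<not> ?thesis"
  have "g \<noteq> 0" using assms(1) by auto
  from splitting_list[OF poly_root this] obtain xs where
    xs: "length xs = degree g" "g = (\<Prod>x\<leftarrow>xs. [:- x, 1:])" using assms(1) by auto
  have ev: "poly (\<Prod>x\<leftarrow>ys. [:- x, 1:]) z = (\<Prod>y\<leftarrow>ys. z - y)" for ys and z :: 'a
    by (induction ys) (auto simp: algebra_simps)
  have root: "poly g y = 0" if "y \<in> set xs" for y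
    unfolding xs(2) ev using that by (induction xs) auto
  have "\<delta> ^ length ys \<le> (\<Prod>y\<leftarrow>ys. av (x - y))" if "\<And>y. y \<in> set ys \<Longrightarrow> \<delta> \<le> av (x - y)" for ys
    using that
  proof (induction ys)
    case (Cons y ys)
    then have "\<delta> * \<delta> ^ length ys \<le> av (x - y) * (\<Prod>y\<leftarrow>ys. av (x - y))"
      using assms(2) by (intro mult_mono) (auto simp: av_nonneg)
    then show ?case by simp
  qed simp
  then have "\<delta> ^ length xs \<le> (\<Prod>y\<leftarrow>xs. av (x - y))" using neg root by force
  also have "\<dots> = av (poly g x)" by (subst xs(2)) (simp add: ev av_prod_list comp_def)
  finally show False using assms(3) xs(1) by simp
qed

lemma finite_polys_coeffs_in:
  assumes "finite S"
  shows "finite {q :: 'a poly. degree q \<le> n \<and> (\<forall>i. coeff q i \<in> S)}"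
proof (rule finite_imageD)
  show "finite (coeffs ` {q :: 'a poly. degree q \<le> n \<and> (\<forall>i. coeff q i \<in> S)})"
    by (rule finite_subset[OF _ finite_lists_length_le[OF assms, of "Suc n"]])
       (auto simp: length_coeffs coeffs_def split: if_splits)
  show "inj_on coeffs {q :: 'a poly. degree q \<le> n \<and> (\<forall>i. coeff q i \<in> S)}"
    by (rule inj_onI) (metis Poly_coeffs)
qed

text \<open>Rounding the coefficients of \<open>conj_poly x\<close> to natural numbers up to
  \<open>p ^ M\<close> gives one of finitely many polynomials. Its value at \<open>x\<close> is
  tiny, so one of its roots is near \<open>x\<close>; \<open>Z\<close> collects all these
  roots.\<close>

lemma totally_bounded_integral:
  assumes "0 < \<delta>"
  shows "\<exists>Z. finite Z \<and> (\<forall>x. av x \<le> 1 \<longrightarrow> card (orb x) \<le> n \<longrightarrow> (\<exists>\<alpha>\<in>Z. av (x - \<alpha>) < \<delta>))"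
proof -
  \<comment> \<open>With \<open>\<epsilon> \<le> 1\<close>, the one \<open>M\<close> chosen for the
    exponent \<open>n\<close> also serves smaller degrees.\<close>
  define \<epsilon> where "\<epsilon> = min \<delta> 1"
  have \<epsilon>: "0 < \<epsilon>" "\<epsilon> \<le> 1" "\<epsilon> \<le> \<delta>" using assms by (auto simp: \<epsilon>_def)
  obtain M where M: "(1 / real p) ^ M < \<epsilon> ^ n"
    using real_arch_pow_inv[of "\<epsilon> ^ n" "1 / real p"] \<epsilon>(1) p_gt_1 by auto
  define S where "S = (of_nat :: nat \<Rightarrow> 'a) ` {..p ^ M}"
  define Q where "Q = {q :: 'a poly. degree q \<le> n \<and> (\<forall>i. coeff q i \<in> S)}"
  define Z where "Z = (\<Union>q\<in>Q - {0}. {z. poly q z = 0})"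
  have "finite Z" unfolding Z_def Q_def
    using finite_polys_coeffs_in[of S n] poly_roots_finite by (auto simp: S_def)
  moreover have "\<exists>\<alpha>\<in>Z. av (x - \<alpha>) < \<delta>" if x: "av x \<le> 1" and deg: "card (orb x) \<le> n" for x
  proof -
    let ?f = "conj_poly x" let ?n = "card (orb x)"
    have "\<exists>j\<le>p ^ M. av (coeff ?f i - of_nat j) \<le> (1 / real p) ^ M" for i
    proof -
      have "coeff ?f i \<in> Qp" using conj_poly_in[of x] by (simp add: polys_in_def)
      from Qp_integer_approx[OF this av_coeff_conj_poly_le[OF x], of M] show ?thesis
        using less_imp_le by blast
    qed
    then obtain j where j: "\<And>i. j i \<le> p ^ M" "\<And>i. av (coeff ?f i - of_nat (j i)) \<le> (1 / real p) ^ M" by metis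
    \<comment> \<open>The leading coefficient stays 1, so that \<open>g\<close> is monic of the same
      degree and \<open>close_root\<close> applies.\<close>
    define c where "c i = (if i < ?n then of_nat (j i) else if i = ?n then 1 else 0 :: 'a)" for i
    define g where "g = (\<Sum>i\<le>?n. Polynomial.monom (c i) i)"
    have co: "coeff g i = c i" for i unfolding g_def coeff_sum by (simp add: c_def)
    have gn: "degree g = ?n"
    proof (rule antisym)
      show "degree g \<le> ?n" by (rule degree_le) (simp add: co c_def)
      show "?n \<le> degree g" by (rule le_degree) (simp add: co c_def)
    qed
    have lc: "lead_coeff g = 1" by (simp add: gn co c_def)
    have "1 \<le> p ^ M" using p_gt_1 by simp
    then have cS: "c i \<in> S" for i
      unfolding S_def c_def using j(1)[of i] by (auto intro: image_eqI[of _ _ 0] image_eqI[of _ _ 1])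
    then have "g \<in> Q" unfolding Q_def using gn deg co by simp
    have "av (poly g x) \<le> (1 / real p) ^ M"
    proof -
      have "poly g x = poly g x - poly ?f x" by (simp add: poly_conj_poly_self)
      also have "\<dots> = (\<Sum>i\<le>?n. (c i - coeff ?f i) * x ^ i)"
        unfolding poly_altdef gn degree_conj_poly co by (simp add: sum_subtractf left_diff_distrib)
      also have "av \<dots> \<le> (1 / real p) ^ M"
      proof (rule av_sum_le)
        fix i assume i: "i \<in> {..?n}"
        have "av (c i - coeff ?f i) \<le> (1 / real p) ^ M"
        proof (cases "i < ?n")
          case True
          then show ?thesis using j(2)[of i] by (simp add: c_def av_diff_commute)
        next
          case False
          then have "c i - coeff ?f i = 0"
            using i lead_coeff_conj_poly[of x] by (simp add: c_def degree_conj_poly)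
          then show ?thesis by simp
        qed
        moreover have "av x ^ i \<le> 1" using x av_nonneg by (simp add: power_le_one)
        ultimately show "av ((c i - coeff ?f i) * x ^ i) \<le> (1 / real p) ^ M"
          unfolding av_mult av_power using mult_mono[of "av (c i - coeff ?f i)" "(1 / real p) ^ M" "av x ^ i" 1] av_nonneg by simp
      qed simp
      finally show ?thesis .
    qed
    also have "\<dots> < \<epsilon> ^ n" by (rule M)
    also have "\<dots> \<le> \<epsilon> ^ degree g" using \<epsilon> gn deg by (intro power_decreasing) auto
    finally obtain \<beta> where "poly g \<beta> = 0" "av (x - \<beta>) < \<epsilon>" using close_root[OF lc \<epsilon>(1)] by blast
    moreover have "g \<noteq> 0" using lc by auto
    ultimately show ?thesis using \<open>g \<in> Q\<close> \<epsilon>(3) unfolding Z_def by force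
  qed
  ultimately show ?thesis by blast
qed

section \<open>Disks with few conjugates and a point of bounded degree\<close>

text \<open>No condition ties the radius to the value group; that condition enters later with
  \<open>open_disk\<close> and \<open>closed_disk\<close>.\<close>

definition is_disk :: "'a set \<Rightarrow> bool" where
  "is_disk D \<longleftrightarrow> (\<exists>a r. 0 < r \<and> (D = {x. av (x - a) \<le> r} \<or> D = {x. av (x - a) < r}))"

lemma ball_recenter:
  assumes "av (b - a) \<le> r"
  shows "{x. av (x - b) \<le> r} = {x. av (x - a) \<le> r}"
  using assms av_triangle_le[of _ b r a] av_triangle_le[of _ a r b] av_diff_commute[of a b] by auto

lemma open_ball_recenter:
  assumes "av (b - a) < r"
  shows "{x. av (x - b) < r} = {x. av (x - a) < r}"
  using assms av_triangle_less[of _ b r a] av_triangle_less[of _ a r b] av_diff_commute[of a b] by auto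

lemma disk_recenter:
  assumes "is_disk D" "a \<in> D"
  obtains r where "0 < r" "D = {x. av (x - a) \<le> r} \<or> D = {x. av (x - a) < r}"
proof -
  obtain b r where r: "0 < r" "D = {x. av (x - b) \<le> r} \<or> D = {x. av (x - b) < r}"
    using assms(1) is_disk_def by auto
  from r(2) have "D = {x. av (x - a) \<le> r} \<or> D = {x. av (x - a) < r}"
  proof (rule disj_forward)
    show "D = {x. av (x - a) \<le> r}" if "D = {x. av (x - b) \<le> r}" using that assms(2) ball_recenter[of a b r] by simp
    show "D = {x. av (x - a) < r}" if "D = {x. av (x - b) < r}" using that assms(2) open_ball_recenter[of a b r] by simp
  qed
  then show ?thesis by (rule that[OF r(1)])
qed

text \<open>Every point of an ultrametric disk is a centre, so membership is decided by the distance
  to \<open>u\<close>.\<close>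

lemma disk_sep:
  assumes "is_disk D" "u \<in> D" "v \<in> D" "w \<notin> D"
  shows "av (u - v) < av (u - w)"
proof -
  obtain r where "D = {x. av (x - u) \<le> r} \<or> D = {x. av (x - u) < r}" using disk_recenter[OF assms(1,2)] by metis
  then show ?thesis using assms(3,4) by (auto simp: av_diff_commute)
qed

text \<open>The predicate \<open>Q\<close> lets one argument serve open and closed balls.\<close>

lemma galois_image_balls:
  assumes "\<sigma> \<in> galois_group Qp"
  shows "\<sigma> ` {x. Q (av (x - a))} = {x. Q (av (x - \<sigma> a))}"
proof (intro equalityI subsetI)
  fix x assume "x \<in> {x. Q (av (x - \<sigma> a))}"
  then have "Q (av (inv_into UNIV \<sigma> x - a))"
    using av_galois_diff[OF assms, of "inv_into UNIV \<sigma> x" a] galois_group_inv_apply(2)[OF assms] by simp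
  then show "x \<in> \<sigma> ` {x. Q (av (x - a))}"
    using galois_group_inv_apply(2)[OF assms] by (metis image_eqI mem_Collect_eq)
qed (auto simp: av_galois_diff[OF assms])

lemma galois_disk:
  assumes "\<sigma> \<in> galois_group Qp" "is_disk D"
  shows "is_disk (\<sigma> ` D)"
proof -
  obtain a r where "0 < r" "D = {x. av (x - a) \<le> r} \<or> D = {x. av (x - a) < r}"
    using assms(2) is_disk_def by auto
  then show ?thesis
    unfolding is_disk_def
    using galois_image_balls[OF assms(1), of "\<lambda>t. t \<le> r"] galois_image_balls[OF assms(1), of "\<lambda>t. t < r"] by metis
qed

text \<open>Conjugates of \<open>D\<close> share radius and type, so they coincide once they have a
  common point.\<close>

lemma disk_galois_eqI:
  assumes "\<sigma> \<in> galois_group Qp" "\<tau> \<in> galois_group Qp" "is_disk D" "a \<in> D" "\<sigma> a \<in> \<tau> ` D"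
  shows "\<sigma> ` D = \<tau> ` D"
proof -
  obtain r where "D = {x. av (x - a) \<le> r} \<or> D = {x. av (x - a) < r}" using disk_recenter[OF assms(3,4)] .
  then show ?thesis
  proof
    assume D: "D = {x. av (x - a) \<le> r}"
    have im: "\<rho> ` D = {x. av (x - \<rho> a) \<le> r}" if "\<rho> \<in> galois_group Qp" for \<rho>
      unfolding D by (rule galois_image_balls[OF that])
    then show ?thesis using assms(1,2,5) ball_recenter[of "\<sigma> a" "\<tau> a" r] by simp
  next
    assume D: "D = {x. av (x - a) < r}"
    have im: "\<rho> ` D = {x. av (x - \<rho> a) < r}" if "\<rho> \<in> galois_group Qp" for \<rho>
      unfolding D by (rule galois_image_balls[OF that])
    then show ?thesis using assms(1,2,5) open_ball_recenter[of "\<sigma> a" "\<tau> a" r] by simp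
  qed
qed

lemma is_disk_nonempty:
  assumes "is_disk D"
  shows "\<exists>a. a \<in> D"
proof -
  obtain a r where "0 < r" "D = {x. av (x - a) \<le> r} \<or> D = {x. av (x - a) < r}"
    using assms is_disk_def by auto
  then have "a \<in> D" by auto
  then show ?thesis by blast
qed

lemma finite_disk_orbit:
  assumes "is_disk D" "H \<subseteq> galois_group Qp"
  shows "finite ((\<lambda>\<sigma>. \<sigma> ` D) ` H)"
proof -
  obtain a where a: "a \<in> D" using is_disk_nonempty[OF assms(1)] by blast
  have "(\<lambda>\<sigma>. \<sigma> a) ` H \<subseteq> orb a" using assms(2) orb_galois by blast
  then have "finite ((\<lambda>\<sigma>. \<sigma> a) ` H)" using finite_orb finite_subset by blast
  then show ?thesis
  proof (rule image_factor(1))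
    fix \<sigma> \<tau> assume "\<sigma> \<in> H" "\<tau> \<in> H" "\<sigma> a = \<tau> a"
    then show "\<sigma> ` D = \<tau> ` D" using assms a by (intro disk_galois_eqI) auto
  qed
qed


text \<open>Rounds a radius to a value of \<open>Qp\<close>, so that rescaling can be done inside
  \<open>Qp\<close>.\<close>

lemma p_power_between:
  assumes "0 < R"
  shows "\<exists>j :: int. R \<le> real p powi j \<and> real p powi j < real p * R"
proof -
  let ?j = "\<lceil>log (real p) R\<rceil>"
  have powi: "real p powi ?j = real p powr real_of_int ?j"
    using p_gt_1 by (subst powr_real_of_int') auto
  have "R = real p powr log (real p) R" using assms p_gt_1 by simp
  also have "\<dots> \<le> real p powr real_of_int ?j" using p_gt_1 by (intro powr_mono) auto
  finally have "R \<le> real p powi ?j" using powi by simp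
  moreover have "real p powr real_of_int ?j < real p powr (log (real p) R + 1)"
    using p_gt_1 by (intro powr_less_mono) linarith+
  then have "real p powi ?j < real p * R"
    using powi assms p_gt_1 by (simp add: powr_add mult.commute)
  ultimately show ?thesis by blast
qed

text \<open>Division by the number \<open>m\<close> of conjugates may enlarge absolute values; this
  bounds the loss uniformly in \<open>m\<close>.\<close>

lemma av_fact_le:
  assumes "1 \<le> m" "m \<le> n"
  shows "av (fact n) \<le> av (of_nat m)"
proof -
  have "m dvd fact n" using assms by (intro dvd_fact) auto
  then obtain k where "fact n = m * k" by blast
  then have "(fact n :: 'a) = of_nat m * of_nat k" by (metis of_nat_fact of_nat_mult)
  then have "av (fact n) = av (of_nat m) * av (of_nat k)" by (simp add: av_mult)
  also have "\<dots> \<le> av (of_nat m)" using av_of_nat_le[of k] av_nonneg by (intro mult_left_le)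
  finally show ?thesis .
qed

text \<open>
  Averaging the conjugates of \<open>a\<close> gives a fixed element at distance at most \<open>R / |n!|\<close>.
  After rescaling, \<open>a\<close> minus this average is integral of bounded degree, so finitely many \<open>\<alpha>\<close> suffice.
\<close>

lemma approx_in_fixed_field:
  assumes "finite A"
  shows "\<exists>Z. finite Z \<and> (\<forall>a R. card (orb a) \<le> n \<longrightarrow> 0 < R \<longrightarrow>
     (\<forall>\<sigma>\<in>galois_group (Qp \<union> A). av (\<sigma> a - a) \<le> R) \<longrightarrow>
     (\<exists>\<alpha>\<in>Z. \<exists>z\<in>fixed_field (galois_group (Qp \<union> insert \<alpha> A)). av (a - z) < R))"
proof -
  \<comment> \<open>\<open>N\<close> bounds the degree of the rescaled error, which is determined by
    \<open>a\<close> and \<open>A\<close>. The \<open>\<delta>\<close> below makes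
    \<open>av c * \<delta>\<close> equal to \<open>p powi j / p\<close>, which is less than
    \<open>R\<close>.\<close>
  define N where "N = n * (\<Prod>b\<in>A. card (orb b))"
  define \<delta> where "\<delta> = av (fact n) / real p"
  have fact0: "0 < av (fact n)" by (simp add: av_pos_iff)
  have \<delta>: "0 < \<delta>" using fact0 p_gt_1 by (simp add: \<delta>_def)
  obtain Z where Z: "finite Z" "\<And>x. av x \<le> 1 \<Longrightarrow> card (orb x) \<le> N \<Longrightarrow> \<exists>\<alpha>\<in>Z. av (x - \<alpha>) < \<delta>"
    using totally_bounded_integral[OF \<delta>, of N] by blast
  have main: "\<exists>\<alpha>\<in>Z. \<exists>z\<in>fixed_field (galois_group (Qp \<union> insert \<alpha> A)). av (a - z) < R"
    if deg: "card (orb a) \<le> n" and R: "0 < R" and near: "\<And>\<sigma>. \<sigma> \<in> galois_group (Qp \<union> A) \<Longrightarrow> av (\<sigma> a - a) \<le> R"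
    for a R
  proof -
    let ?H = "galois_group (Qp \<union> A)"
    have HG: "?H \<subseteq> galois_group Qp" by (rule galois_group_antimono) simp
    define C where "C = (\<lambda>\<sigma>. \<sigma> a) ` ?H"
    have "C \<subseteq> orb a" using HG by (auto simp: C_def orb_def)
    then have finC: "finite C" and cardC: "card C \<le> n"
      using finite_orb[of a] finite_subset card_mono deg by (blast, meson card_mono finite_orb order_trans)
    have "a \<in> C" unfolding C_def using galois_group_id by (metis id_apply image_eqI)
    then have C0: "1 \<le> card C" using finC by (metis One_nat_def Suc_leI card_gt_0_iff empty_iff)
    \<comment> \<open>The average runs over the conjugates of \<open>a\<close> under automorphisms
      fixing \<open>A\<close>; only these are known to be within \<open>R\<close> of
      \<open>a\<close>.\<close>
    define e where "e = \<Sum> C / of_nat (card C)"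
    have e_fix: "e \<in> fixed_field ?H"
      unfolding fixed_field_def
    proof (intro CollectI ballI)
      fix \<sigma> assume s: "\<sigma> \<in> ?H"
      interpret field_auto \<sigma> using s by (rule galois_group_field_auto)
      have inj: "inj_on \<sigma> C" using bij by (auto simp: bij_def intro: inj_on_subset)
      have "\<sigma> ` C \<subseteq> C"
      proof
        fix y assume "y \<in> \<sigma> ` C"
        then obtain \<tau> where "\<tau> \<in> ?H" "y = (\<sigma> \<circ> \<tau>) a" by (auto simp: C_def)
        then show "y \<in> C" unfolding C_def using galois_group_comp[OF s] by blast
      qed
      then have "\<sigma> ` C = C" using endo_inj_surj[OF finC _ inj] by blast
      then have "\<sigma> (\<Sum> C) = \<Sum> C" using sum.reindex[OF inj, of "\<lambda>x. x"] hom_sum[of "\<lambda>x. x" C] by simp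
      then show "\<sigma> e = e" by (simp add: e_def hom_divide hom_of_nat)
    qed
    have "av (a - e) \<le> R / av (fact n)"
    proof -
      have "a - e = (\<Sum>y\<in>C. a - y) / of_nat (card C)"
        using C0 by (simp add: e_def sum_subtractf field_simps)
      then have "av (a - e) = av (\<Sum>y\<in>C. a - y) / av (of_nat (card C))" by (simp add: av_divide)
      also have "\<dots> \<le> R / av (fact n)"
      proof (rule frac_le)
        show "av (\<Sum>y\<in>C. a - y) \<le> R"
          using near R by (intro av_sum_le) (auto simp: C_def av_diff_commute)
      qed (use R fact0 av_fact_le[OF C0 cardC] in auto)
      finally show ?thesis .
    qed
    obtain j :: int where j: "R \<le> real p powi j" "real p powi j < real p * R" using p_power_between[OF R] by blast
    \<comment> \<open>Its absolute value dominates the bound for \<open>a - e\<close>, and it lies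
      in \<open>Qp\<close>, so that dividing by it does not raise the degree.\<close>
    define c where "c = (of_nat p powi (- j) / fact n :: 'a)"
    have av_c: "av c = real p powi j / av (fact n)"
      unfolding c_def av_divide av_powi av_p by (simp add: power_int_minus power_int_divide_distrib)
    have "of_nat p \<noteq> (0 :: 'a)" using p_gt_1 by simp
    then have c0: "c \<noteq> 0" by (simp add: c_def)
    have "c \<in> Qp"
      unfolding c_def using Qp.of_nat_mem[of "fact n"]
      by (auto intro!: Qp.divide_mem Qp.inverse_mem Qp.power_mem Qp.of_nat_mem simp: power_int_def)
    have "av ((a - e) / c) \<le> 1"
    proof -
      have "av (a - e) \<le> av c"
        using \<open>av (a - e) \<le> R / av (fact n)\<close> divide_right_mono[OF j(1), of "av (fact n)"] fact0 av_c by simp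
      then show ?thesis using c0 av_pos_iff[of c] by (simp add: av_divide)
    qed
    moreover have "card (orb ((a - e) / c)) \<le> N"
    proof -
      have "card (orb ((a - e) / c)) \<le> (\<Prod>b\<in>insert a A. card (orb b))"
      proof (rule card_orb_determined)
        fix \<sigma> \<tau> assume st: "\<sigma> \<in> galois_group Qp" "\<tau> \<in> galois_group Qp" "\<And>b. b \<in> insert a A \<Longrightarrow> \<sigma> b = \<tau> b"
        have "\<sigma> e = \<tau> e" using galois_agree_fixed_field[OF st(1,2) _ e_fix] st(3) by blast
        moreover have "\<sigma> c = c" "\<tau> c = c" using \<open>c \<in> Qp\<close> st(1,2) galois_group_fix by blast+
        ultimately show "\<sigma> ((a - e) / c) = \<tau> ((a - e) / c)"
          using st(3)[of a] field_auto.hom_divide[OF galois_group_field_auto] field_auto.hom_diff[OF galois_group_field_auto] st(1,2)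
          by (metis insertI1)
      qed (use assms in simp)
      also have "\<dots> \<le> N"
      proof (cases "a \<in> A")
        case True
        have "n \<ge> 1" using deg card_orb_pos[of a] by linarith
        then show ?thesis using True by (simp add: N_def insert_absorb)
      next
        case False
        then show ?thesis using deg assms by (simp add: N_def)
      qed
      finally show ?thesis .
    qed
    ultimately obtain \<alpha> where \<alpha>: "\<alpha> \<in> Z" "av ((a - e) / c - \<alpha>) < \<delta>" using Z(2) by blast
    define z where "z = e + c * \<alpha>"
    have "a - z = c * ((a - e) / c - \<alpha>)" using c0 by (simp add: z_def field_simps)
    then have "av (a - z) < av c * \<delta>" using \<alpha>(2) c0 av_pos_iff[of c] by (simp add: av_mult)
    also have "\<dots> = real p powi j / real p" using fact0 by (simp add: av_c \<delta>_def)
    also have "\<dots> < R" using j(2) p_gt_1 by (simp add: field_simps)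
    finally have "av (a - z) < R" .
    moreover have "z \<in> fixed_field (galois_group (Qp \<union> insert \<alpha> A))"
    proof -
      interpret F: type_subfield "fixed_field (galois_group (Qp \<union> insert \<alpha> A))"
        by (rule fixed_field_type_subfield[OF galois_group_antimono[OF Un_upper1]])
      have "e \<in> fixed_field (galois_group (Qp \<union> insert \<alpha> A))"
        using e_fix fixed_field_mono[of A "insert \<alpha> A"] by blast
      then show ?thesis unfolding z_def
        using \<open>c \<in> Qp\<close> by (intro F.add_mem F.mult_mem) (auto intro: fixed_field_mem)
    qed
    ultimately show ?thesis using \<alpha>(1) by blast
  qed
  show ?thesis by (intro exI[of _ Z] conjI Z(1) allI impI main) auto
qed

text \<open>
  If the disk is not fixed, take for \<open>R\<close> the largest distance from \<open>a\<close> to a conjugate: after adjoining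
  the approximation \<open>z\<close>, the farthest conjugate disk is no longer reached, so the orbit shrinks.
\<close>

lemma disks_meet_fixed_field:
  assumes "finite A"
  shows "\<exists>B. finite B \<and> (\<forall>D a. is_disk D \<longrightarrow> a \<in> D \<longrightarrow> card (orb a) \<le> n \<longrightarrow>
     card ((\<lambda>\<sigma>. \<sigma> ` D) ` galois_group (Qp \<union> A)) \<le> k \<longrightarrow> D \<inter> fixed_field (galois_group (Qp \<union> B)) \<noteq> {})"
  using assms
proof (induction k arbitrary: A)
  case 0
  \<comment> \<open>The claim is vacuous for \<open>k = 0\<close>: the orbit contains
    \<open>D\<close> itself.\<close>
  have "card ((\<lambda>\<sigma>. \<sigma> ` D) ` galois_group (Qp \<union> A)) > 0" if "is_disk D" for D
  proof -
    have "finite ((\<lambda>\<sigma>. \<sigma> ` D) ` galois_group (Qp \<union> A))"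
      by (rule finite_disk_orbit[OF that galois_group_antimono]) simp
    then show ?thesis using galois_group_id by (auto simp: card_gt_0_iff)
  qed
  then show ?case by (intro exI[of _ "{}"]) (metis finite.emptyI le_zero_eq less_irrefl)
next
  case (Suc k)
  obtain Z where Z: "finite Z" "\<forall>a R. card (orb a) \<le> n \<longrightarrow> 0 < R \<longrightarrow>
     (\<forall>\<sigma>\<in>galois_group (Qp \<union> A). av (\<sigma> a - a) \<le> R) \<longrightarrow>
     (\<exists>\<alpha>\<in>Z. \<exists>z\<in>fixed_field (galois_group (Qp \<union> insert \<alpha> A)). av (a - z) < R)"
    using approx_in_fixed_field[OF Suc.prems, of n] by auto
  have "\<forall>\<alpha>. \<exists>B. finite B \<and> (\<forall>D a. is_disk D \<longrightarrow> a \<in> D \<longrightarrow> card (orb a) \<le> n \<longrightarrow>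
     card ((\<lambda>\<sigma>. \<sigma> ` D) ` galois_group (Qp \<union> insert \<alpha> A)) \<le> k \<longrightarrow> D \<inter> fixed_field (galois_group (Qp \<union> B)) \<noteq> {})"
    by (intro allI Suc.IH finite.insertI Suc.prems)
  then obtain B where B: "\<And>\<alpha>. finite (B \<alpha>)"
    "\<And>\<alpha> D a. is_disk D \<Longrightarrow> a \<in> D \<Longrightarrow> card (orb a) \<le> n \<Longrightarrow>
     card ((\<lambda>\<sigma>. \<sigma> ` D) ` galois_group (Qp \<union> insert \<alpha> A)) \<le> k \<Longrightarrow> D \<inter> fixed_field (galois_group (Qp \<union> B \<alpha>)) \<noteq> {}"
    by metis
  define BB where "BB = A \<union> Z \<union> (\<Union>\<alpha>\<in>Z. B \<alpha>)"
  have "finite BB" unfolding BB_def using Suc.prems Z(1) B(1) by simp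
  moreover have main: "D \<inter> fixed_field (galois_group (Qp \<union> BB)) \<noteq> {}"
    if D: "is_disk D" and a: "a \<in> D" and deg: "card (orb a) \<le> n"
      and k: "card ((\<lambda>\<sigma>. \<sigma> ` D) ` galois_group (Qp \<union> A)) \<le> Suc k" for D a
  proof -
    let ?H = "galois_group (Qp \<union> A)"
    have HG: "?H \<subseteq> galois_group Qp" by (rule galois_group_antimono) simp
    show ?thesis
    \<comment> \<open>If no conjugate of \<open>a\<close> leaves \<open>D\<close>, the radius of
      \<open>D\<close> can serve as \<open>R\<close>, and the strict bound puts \<open>z\<close>
      into \<open>D\<close> even if \<open>D\<close> is open.\<close>
    proof (cases "\<forall>\<sigma>\<in>?H. \<sigma> a \<in> D")
      case True
      obtain r where r: "0 < r" "D = {x. av (x - a) \<le> r} \<or> D = {x. av (x - a) < r}" using disk_recenter[OF D a] .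
      then have "\<forall>\<sigma>\<in>?H. av (\<sigma> a - a) \<le> r" using True by force
      from Z(2)[THEN spec, THEN spec, THEN mp, THEN mp, THEN mp, OF deg r(1) this] obtain \<alpha> z where
        z: "\<alpha> \<in> Z" "z \<in> fixed_field (galois_group (Qp \<union> insert \<alpha> A))" "av (a - z) < r" by blast
      have "z \<in> D" using r(2) z(3) by (auto simp: av_diff_commute)
      moreover have "z \<in> fixed_field (galois_group (Qp \<union> BB))"
        using z(1,2) fixed_field_mono[of "insert \<alpha> A" BB] by (auto simp: BB_def)
      ultimately show ?thesis by blast
    next
      case False
      then obtain \<sigma>0 where s0: "\<sigma>0 \<in> ?H" "\<sigma>0 a \<notin> D" by blast
      define C where "C = (\<lambda>\<sigma>. av (\<sigma> a - a)) ` ?H"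
      have "C \<subseteq> (\<lambda>y. av (y - a)) ` orb a" using HG by (auto simp: C_def orb_def)
      then have finC: "finite C" using finite_orb by (meson finite_imageI finite_subset)
      have "Max C \<in> C" by (rule Max_in[OF finC]) (use s0(1) in \<open>auto simp: C_def\<close>)
      then obtain \<sigma>1 where s1: "\<sigma>1 \<in> ?H" "av (\<sigma>1 a - a) = Max C" by (auto simp: C_def)
      define R where "R = av (\<sigma>1 a - a)"
      have max: "av (\<sigma> a - a) \<le> R" if "\<sigma> \<in> ?H" for \<sigma>
        unfolding R_def s1(2) using finC that by (intro Max_ge) (auto simp: C_def)
      \<comment> \<open>The conjugate \<open>\<sigma>0 a\<close> lies outside \<open>D\<close>,
        hence farther from \<open>a\<close> than every point of \<open>D\<close>.\<close>
      have lt: "av (v - a) < R" if "v \<in> D" for v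
        using disk_sep[OF D a that s0(2)] max[OF s0(1)] by (simp add: av_diff_commute)
      have R: "0 < R" using lt[OF a] by simp
      have "\<forall>\<sigma>\<in>?H. av (\<sigma> a - a) \<le> R" using max by blast
      from Z(2)[THEN spec, THEN spec, THEN mp, THEN mp, THEN mp, OF deg R this] obtain \<alpha> z where
        z: "\<alpha> \<in> Z" "z \<in> fixed_field (galois_group (Qp \<union> insert \<alpha> A))" "av (a - z) < R" by blast
      let ?H' = "galois_group (Qp \<union> insert \<alpha> A)"
      have HH': "?H' \<subseteq> ?H" by (rule galois_group_antimono) auto
      \<comment> \<open>If some \<open>\<tau>\<close> fixing \<open>z\<close> moved \<open>D\<close>
        to the same disk, the chain \<open>\<sigma>1 a\<close>, \<open>\<tau> a\<close>,
        \<open>z\<close>, \<open>a\<close> would have all its steps shorter than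
        \<open>R\<close>.\<close>
      have "\<sigma>1 ` D \<notin> (\<lambda>\<sigma>. \<sigma> ` D) ` ?H'"
      proof
        assume "\<sigma>1 ` D \<in> (\<lambda>\<sigma>. \<sigma> ` D) ` ?H'"
        then obtain \<tau> where t: "\<tau> \<in> ?H'" "\<sigma>1 ` D = \<tau> ` D" by blast
        then have "\<tau> a \<in> \<sigma>1 ` D" using a by blast
        then obtain v where v: "v \<in> D" "\<tau> a = \<sigma>1 v" by auto
        have tG: "\<tau> \<in> galois_group Qp" and sG: "\<sigma>1 \<in> galois_group Qp" using t(1) HH' HG s1(1) by auto
        have "av (\<sigma>1 a - \<tau> a) < R"
          using lt[OF v(1)] av_galois_diff[OF sG, of a v] v(2) by (simp add: av_diff_commute)
        moreover have "av (\<tau> a - z) < R"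
        proof -
          have "\<tau> z = z" using z(2) t(1) by (auto simp: fixed_field_def)
          then show ?thesis using av_galois_diff[OF tG, of a z] z(3) by simp
        qed
        moreover have "av (z - a) < R" using z(3) by (simp add: av_diff_commute)
        ultimately have "av (\<sigma>1 a - a) < R" by (meson av_triangle_less)
        then show False by (simp add: R_def)
      qed
      moreover have "(\<lambda>\<sigma>. \<sigma> ` D) ` ?H' \<subseteq> (\<lambda>\<sigma>. \<sigma> ` D) ` ?H" using HH' by blast
      moreover have "\<sigma>1 ` D \<in> (\<lambda>\<sigma>. \<sigma> ` D) ` ?H" using s1(1) by blast
      ultimately have "(\<lambda>\<sigma>. \<sigma> ` D) ` ?H' \<subset> (\<lambda>\<sigma>. \<sigma> ` D) ` ?H" by blast
      then have "card ((\<lambda>\<sigma>. \<sigma> ` D) ` ?H') < card ((\<lambda>\<sigma>. \<sigma> ` D) ` ?H)"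
        by (rule psubset_card_mono[OF finite_disk_orbit[OF D HG]])
      then have "D \<inter> fixed_field (galois_group (Qp \<union> B \<alpha>)) \<noteq> {}" using k by (intro B(2)[OF D a deg]) simp
      then show ?thesis using z(1) fixed_field_mono[of "B \<alpha>" BB] by (auto simp: BB_def)
    qed
  qed
  ultimately show ?case by (intro exI[of _ BB] conjI allI impI main) auto
qed

end

section \<open>Points of bounded degree from bounded ramification\<close>

context padic_closure
begin

section \<open>Frobenius on residues\<close>

lemma av_power_diff_le:
  assumes "av x \<le> 1" "av y \<le> 1"
  shows "av (x ^ n - y ^ n) \<le> av (x - y)"
proof (induction n)
  case (Suc n)
  have "x ^ Suc n - y ^ Suc n = (x - y) * x ^ n + y * (x ^ n - y ^ n)" by (simp add: algebra_simps)
  moreover have "av ((x - y) * x ^ n) \<le> av (x - y)"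
    unfolding av_mult av_power using assms(1) av_nonneg by (intro mult_left_le) (auto simp: power_le_one)
  moreover have "av (y * (x ^ n - y ^ n)) \<le> av (x - y)"
  proof -
    have "av y * av (x ^ n - y ^ n) \<le> av (x ^ n - y ^ n)"
      using assms(2) av_nonneg by (simp add: mult_left_le_one_le)
    then show ?thesis using Suc by (simp add: av_mult)
  qed
  ultimately show ?case using av_ultrametric[of "(x - y) * x ^ n" "y * (x ^ n - y ^ n)"] by simp
qed (simp add: av_nonneg)

text \<open>The inner binomial coefficients are divisible by \<open>p\<close>.\<close>

lemma av_frobenius_add:
  assumes "av x \<le> 1" "av y \<le> 1"
  shows "av ((x + y) ^ p - (x ^ p + y ^ p)) < 1"
proof -
  have p0: "0 < p" using p_gt_1 by simp
  have "(x + y) ^ p = (\<Sum>i\<le>p. of_nat (p choose i) * x ^ i * y ^ (p - i))" by (rule binomial_ring)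
  also have "{..p} = insert 0 (insert p {0<..<p})" using p0 by auto
  also have "(\<Sum>i\<in>insert 0 (insert p {0<..<p}). of_nat (p choose i) * x ^ i * y ^ (p - i))
      = y ^ p + (x ^ p + (\<Sum>i\<in>{0<..<p}. of_nat (p choose i) * x ^ i * y ^ (p - i)))"
    using p0 by (subst sum.insert; simp)
  finally have "(x + y) ^ p - (x ^ p + y ^ p) = (\<Sum>i\<in>{0<..<p}. of_nat (p choose i) * x ^ i * y ^ (p - i))"
    by simp
  also have "av \<dots> < 1"
  proof (rule av_sum_less)
    fix i assume i: "i \<in> {0<..<p}"
    then have "p dvd (p choose i)" using prime_p by (intro dvd_choose_prime) auto
    then obtain k where k: "(p choose i) = p * k" by blast
    have "av (of_nat k * x ^ i * y ^ (p - i)) \<le> 1"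
      unfolding av_mult av_power
      using assms av_of_nat_le[of k] by (intro mult_le_one) (auto simp: power_le_one av_nonneg)
    then have "(1 / real p) * av (of_nat k * x ^ i * y ^ (p - i)) \<le> (1 / real p) * 1"
      by (intro mult_left_mono) auto
    also have "\<dots> < 1" using p_gt_1 by simp
    finally show "av (of_nat (p choose i) * x ^ i * y ^ (p - i)) < 1"
      unfolding k by (simp add: av_mult av_p mult.assoc)
  qed simp
  finally show ?thesis .
qed

lemma av_frobenius_sum:
  assumes "finite I" "\<And>i. i \<in> I \<Longrightarrow> av (f i) \<le> 1"
  shows "av ((\<Sum>i\<in>I. f i) ^ p - (\<Sum>i\<in>I. f i ^ p)) < 1"
  using assms
proof (induction I rule: finite_induct)
  case empty
  then show ?case using p_gt_1 by (simp add: zero_power)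
next
  case (insert i I)
  have "av (\<Sum>i\<in>I. f i) \<le> 1" using insert.prems by (intro av_sum_le) auto
  then have "av ((f i + (\<Sum>i\<in>I. f i)) ^ p - (f i ^ p + (\<Sum>i\<in>I. f i) ^ p)) < 1"
    using insert.prems by (intro av_frobenius_add) auto
  moreover have "av ((f i ^ p + (\<Sum>i\<in>I. f i) ^ p) - (f i ^ p + (\<Sum>i\<in>I. f i ^ p))) < 1"
    using insert by simp
  ultimately have "av ((f i + (\<Sum>i\<in>I. f i)) ^ p - (f i ^ p + (\<Sum>i\<in>I. f i ^ p))) < 1"
    by (rule av_triangle_less)
  then show ?case using insert.hyps by simp
qed

text \<open>Fermat's little theorem for natural numbers, carried over to \<open>Qp\<close> by
  approximation.\<close>

lemma av_frobenius_Qp: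
  assumes "c \<in> Qp" "av c \<le> 1"
  shows "av (c ^ p - c) < 1"
proof -
  have nat: "av (of_nat j ^ p - of_nat j) < 1" for j
  proof (induction j)
    case 0
    then show ?case using p_gt_1 by (simp add: zero_power)
  next
    case (Suc j)
    have "av ((1 + of_nat j) ^ p - (1 ^ p + of_nat j ^ p)) < 1"
      by (rule av_frobenius_add) (use av_of_nat_le in auto)
    moreover have "av ((1 ^ p + of_nat j ^ p) - (1 + of_nat j)) < 1" using Suc by simp
    ultimately show ?case unfolding of_nat_Suc by (rule av_triangle_less)
  qed
  obtain j where "av (c - of_nat j) \<le> (1 / real p) ^ 1"
    using Qp_integer_approx[OF assms, of 1] by blast
  moreover have "(1 / real p) ^ 1 < 1" using p_gt_1 by simp
  ultimately have j: "av (c - of_nat j) < 1" by linarith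
  have "av (c ^ p - of_nat j ^ p) < 1"
    using av_power_diff_le[OF assms(2) av_of_nat_le[of j], of p] j by simp
  from av_triangle_less[OF this nat[of j]] have "av (c ^ p - of_nat j) < 1" .
  moreover have "av (of_nat j - c) < 1" using j by (simp add: av_diff_commute)
  ultimately show ?thesis by (rule av_triangle_less)
qed

text \<open>Modulo the maximal ideal, the coefficients of \<open>conj_poly u\<close> are fixed by Frobenius.\<close>

lemma frobenius_conj:
  assumes u: "av u \<le> 1"
  shows "\<exists>\<sigma>\<in>galois_group Qp. av (u ^ p - \<sigma> u) < 1"
proof (rule ccontr)
  assume neg: "\<not> ?thesis"
  let ?f = "conj_poly u"
  have ci: "av (coeff ?f i) \<le> 1" "coeff ?f i \<in> Qp" for i
    using av_coeff_conj_poly_le[OF u] conj_poly_in[of u] by (auto simp: polys_in_def)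
  have ui: "av (u ^ i) \<le> 1" for i using u av_nonneg by (simp add: av_power power_le_one)
  have "av ((\<Sum>i\<le>degree ?f. coeff ?f i * u ^ i) ^ p - (\<Sum>i\<le>degree ?f. (coeff ?f i * u ^ i) ^ p)) < 1"
    by (rule av_frobenius_sum) (use ci ui av_nonneg in \<open>auto simp: av_mult intro: mult_le_one\<close>)
  then have "av (\<Sum>i\<le>degree ?f. (coeff ?f i * u ^ i) ^ p) < 1"
    using poly_conj_poly_self[of u] p_gt_1 unfolding poly_altdef by (simp add: zero_power)
  moreover have "av ((\<Sum>i\<le>degree ?f. coeff ?f i * (u ^ p) ^ i) - (\<Sum>i\<le>degree ?f. (coeff ?f i * u ^ i) ^ p)) < 1"
  proof -
    have "(\<Sum>i\<le>degree ?f. coeff ?f i * (u ^ p) ^ i) - (\<Sum>i\<le>degree ?f. (coeff ?f i * u ^ i) ^ p)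
        = (\<Sum>i\<le>degree ?f. (coeff ?f i - coeff ?f i ^ p) * (u ^ p) ^ i)"
      unfolding sum_subtractf[symmetric]
      by (rule sum.cong) (simp_all add: algebra_simps power_mult_distrib flip: power_mult)
    also have "av \<dots> < 1"
    proof (rule av_sum_less)
      fix i
      have "av (coeff ?f i - coeff ?f i ^ p) < 1"
        using av_frobenius_Qp[OF ci(2,1)] by (simp add: av_diff_commute)
      moreover have "av ((u ^ p) ^ i) \<le> 1" using ui by (simp flip: power_mult)
      ultimately show "av ((coeff ?f i - coeff ?f i ^ p) * (u ^ p) ^ i) < 1"
        unfolding av_mult using av_nonneg by (meson le_less_trans mult_left_le)
    qed simp
    finally show ?thesis .
  qed
  ultimately have "av (\<Sum>i\<le>degree ?f. coeff ?f i * (u ^ p) ^ i) < 1"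
    using av_triangle_less[of "\<Sum>i\<le>degree ?f. coeff ?f i * (u ^ p) ^ i" "\<Sum>i\<le>degree ?f. (coeff ?f i * u ^ i) ^ p" 1 0]
    by simp
  then have "av (poly ?f (u ^ p)) < 1" unfolding poly_altdef .
  \<comment> \<open>By \<open>neg\<close>, the point \<open>u ^ p\<close> is at distance at least 1
    from every conjugate of \<open>u\<close>.\<close>
  moreover have "1 \<le> av (poly ?f (u ^ p))"
    unfolding poly_conj_poly av_prod
    by (rule prod_ge_1) (use neg in \<open>auto simp: orb_def not_less\<close>)
  ultimately show False by simp
qed

lemma frobenius_power_conj:
  assumes u: "av u \<le> 1"
  shows "\<exists>\<sigma>\<in>galois_group Qp. av (u ^ (p ^ j) - \<sigma> u) < 1"
proof (induction j)
  case 0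
  show ?case by (rule bexI[OF _ galois_group_id]) simp
next
  case (Suc j)
  then obtain \<sigma> where s: "\<sigma> \<in> galois_group Qp" "av (u ^ (p ^ j) - \<sigma> u) < 1" by blast
  interpret field_auto \<sigma> using s(1) by (rule galois_group_field_auto)
  obtain \<tau> where t: "\<tau> \<in> galois_group Qp" "av (u ^ p - \<tau> u) < 1" using frobenius_conj[OF u] by blast
  have "av (u ^ (p ^ Suc j) - \<sigma> (u ^ p)) < 1"
  proof -
    have "av ((u ^ (p ^ j)) ^ p - (\<sigma> u) ^ p) \<le> av (u ^ (p ^ j) - \<sigma> u)"
      using u av_nonneg av_galois[OF s(1)] by (intro av_power_diff_le) (simp_all add: av_power power_le_one)
    then show ?thesis using s(2) by (simp add: hom_power mult.commute flip: power_mult)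
  qed
  moreover have "av (\<sigma> (u ^ p) - (\<sigma> \<circ> \<tau>) u) < 1" using av_galois_diff[OF s(1)] t(2) by simp
  ultimately show ?case using galois_group_comp[OF s(1) t(1)] av_triangle_less by blast
qed

text \<open>Frobenius is additive on residues, so \<open>(x - y) ^ p\<close> is small together with
  \<open>x ^ p - y ^ p\<close>.\<close>

lemma av_frobenius_injective:
  assumes "av x \<le> 1" "av y \<le> 1" "av (x ^ (p ^ i) - y ^ (p ^ i)) < 1"
  shows "av (x - y) < 1"
  using assms
proof (induction i arbitrary: x y)
  case (Suc i)
  have xy: "av (x ^ p) \<le> 1" "av (y ^ p) \<le> 1" using Suc.prems av_nonneg by (auto simp: av_power power_le_one)
  have "av (x ^ p - y ^ p) < 1"
    by (rule Suc.IH[OF xy]) (use Suc.prems(3) in \<open>simp flip: power_mult\<close>)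
  moreover have "av ((x - y) ^ p - (x ^ p - y ^ p)) < 1"
  proof -
    have "av (x - y) \<le> 1" using av_diff_le[of x y] Suc.prems by simp
    from av_frobenius_add[OF this Suc.prems(2)]
    have "av (x ^ p - ((x - y) ^ p + y ^ p)) < 1" by simp
    then show ?thesis using av_diff_commute[of "(x - y) ^ p" "x ^ p - y ^ p"] by (simp add: algebra_simps)
  qed
  ultimately have "av ((x - y) ^ p) < 1"
    using av_triangle_less[of "(x - y) ^ p" "x ^ p - y ^ p" 1 0] by simp
  then show ?case using av_nonneg[of "x - y"] by (simp add: av_power power_less_one_iff)
qed simp

text \<open>Zero and the roots of unity of order dividing \<open>p ^ l - 1\<close>; for
  \<open>l \<ge> 1\<close> they represent the residue field with \<open>p ^ l\<close>
  elements.\<close>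

definition roots_of_frobenius :: "nat \<Rightarrow> 'a set" where
  "roots_of_frobenius l = {z. z ^ (p ^ l) = z}"

lemma roots_of_frobenius_poly:
  assumes "1 \<le> l"
  defines "g \<equiv> Polynomial.monom 1 (p ^ l) - [:0, 1:]"
  shows "degree g = p ^ l" "lead_coeff g = 1" "roots_of_frobenius l = {z. poly g z = 0}"
proof -
  have "1 < p ^ l" using assms(1) p_gt_1 one_less_power[of p l] by simp
  then have d: "degree [:0, 1 :: 'a:] < degree (Polynomial.monom (1 :: 'a) (p ^ l))" by (simp add: degree_monom_eq)
  have "degree (- [:0, 1 :: 'a:]) < degree (Polynomial.monom (1 :: 'a) (p ^ l))"
    unfolding degree_minus by (rule d)
  from degree_add_eq_left[OF this] show deg: "degree g = p ^ l"
    unfolding g_def diff_conv_add_uminus by (simp add: degree_monom_eq)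
  show "lead_coeff g = 1" unfolding deg using \<open>1 < p ^ l\<close> assms(1) p_gt_1 by (simp add: g_def coeff_pCons split: nat.split)
  show "roots_of_frobenius l = {z. poly g z = 0}" by (auto simp: roots_of_frobenius_def g_def poly_monom)
qed

lemma finite_roots_of_frobenius: "1 \<le> l \<Longrightarrow> finite (roots_of_frobenius l)"
  using roots_of_frobenius_poly[of l] poly_roots_finite by (metis leading_coeff_0_iff zero_neq_one)

lemma near_root_of_frobenius:
  assumes "1 \<le> l" "av (u ^ (p ^ l) - u) < 1"
  shows "\<exists>z\<in>roots_of_frobenius l. av (u - z) < 1"
  using close_root[OF roots_of_frobenius_poly(2)[OF assms(1)], of 1 u] assms
  by (auto simp: roots_of_frobenius_poly(3)[OF assms(1)] poly_monom)

text \<open>Pigeonhole: each \<open>u ^ (p ^ j)\<close> with \<open>j \<le> k\<close> is near a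
  conjugate of \<open>u\<close>, and two of these \<open>k + 1\<close> choices share their value of
  \<open>f\<close>. Injectivity of Frobenius cancels the smaller exponent, so the residue of
  \<open>u\<close> lies in a field with \<open>p ^ l\<close> elements.\<close>

lemma residue_near_root_of_frobenius:
  assumes u: "av u \<le> 1" and fin: "finite (f ` galois_group Qp)" and k: "card (f ` galois_group Qp) \<le> k"
    and f: "\<And>\<sigma> \<tau>. \<sigma> \<in> galois_group Qp \<Longrightarrow> \<tau> \<in> galois_group Qp \<Longrightarrow> f \<sigma> = f \<tau> \<Longrightarrow> av (\<sigma> u - \<tau> u) < 1"
  shows "\<exists>z\<in>(\<Union>l\<in>{1..k}. roots_of_frobenius l). av (u - z) < 1"
proof -
  obtain s where s: "\<And>j. s j \<in> galois_group Qp" "\<And>j. av (u ^ (p ^ j) - s j u) < 1"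
    using frobenius_power_conj[OF u] by metis
  have sub: "(\<lambda>j. f (s j)) ` {..k} \<subseteq> f ` galois_group Qp" using s(1) by auto
  have "\<not> inj_on (\<lambda>j. f (s j)) {..k}"
  proof
    assume "inj_on (\<lambda>j. f (s j)) {..k}"
    from card_inj_on_le[OF this sub fin] show False using k by simp
  qed
  then obtain i j where ij: "i < j" "j \<le> k" "f (s i) = f (s j)"
    unfolding inj_on_def by (metis atMost_iff linorder_neqE_nat)
  have "av (u ^ (p ^ i) - u ^ (p ^ j)) < 1"
    using s(2)[of i] f[OF s(1) s(1) ij(3)] s(2)[of j] av_triangle_less av_diff_commute by metis
  moreover have "u ^ (p ^ j) = (u ^ (p ^ (j - i))) ^ (p ^ i)"
    using ij(1) by (simp flip: power_mult power_add)
  ultimately have close: "av (u ^ (p ^ i) - (u ^ (p ^ (j - i))) ^ (p ^ i)) < 1" by simp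
  have "av (u ^ (p ^ (j - i))) \<le> 1" using u av_nonneg by (simp add: av_power power_le_one)
  from av_frobenius_injective[OF u this close] have "av (u - u ^ (p ^ (j - i))) < 1" .
  then have "av (u ^ (p ^ (j - i)) - u) < 1" by (simp only: av_diff_commute)
  moreover have "1 \<le> j - i" using ij(1) by linarith
  ultimately obtain z where z: "z \<in> roots_of_frobenius (j - i)" "av (u - z) < 1"
    using near_root_of_frobenius by blast
  have "j - i \<in> {1..k}" using ij by auto
  then show ?thesis using z by blast
qed

section \<open>Linear systems and digit expansions over \<open>Qp\<close>\<close>

lemma homogeneous_system_solution:
  assumes "type_subfield K" "finite W" "finite I" "card W < card I" "\<And>w i. M w i \<in> K"
  shows "\<exists>c :: 'i \<Rightarrow> 'a. (\<forall>i. c i \<in> K) \<and> (\<exists>i\<in>I. c i \<noteq> 0) \<and> (\<forall>w\<in>W. (\<Sum>i\<in>I. c i * M w i) = 0)"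
  using assms(2-5)
proof (induction W arbitrary: I M rule: finite_induct)
  case empty
  interpret type_subfield K by fact
  have "I \<noteq> {}" using empty by auto
  then show ?case by (intro exI[of _ "\<lambda>_. 1"]) (auto simp: one_mem)
next
  case (insert w W)
  interpret type_subfield K by fact
  show ?case
  proof (cases "\<forall>i\<in>I. M w i = 0")
    case True
    have "card W < card I" using insert by simp
    from insert.IH[OF insert.prems(1) this insert.prems(3)] show ?thesis
      using True by auto
  next
    case False
    then obtain i0 where i0: "i0 \<in> I" "M w i0 \<noteq> 0" by blast
    define J where "J = I - {i0}"
    have J: "finite J" "i0 \<notin> J" "I = insert i0 J" using i0(1) insert.prems(1) by (auto simp: J_def)
    \<comment> \<open>Gaussian elimination: equation \<open>w\<close> expresses the unknown at
      \<open>i0\<close> through the others, and \<open>M'\<close> is the system that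
      remains.\<close>
    define M' where "M' v i = M v i - M v i0 * (M w i / M w i0)" for v i
    have "M' v i \<in> K" for v i unfolding M'_def by (intro diff_mem mult_mem divide_mem insert.prems)
    moreover have "card W < card J" using insert J by simp
    ultimately obtain c where c: "\<And>i. c i \<in> K" "\<exists>i\<in>J. c i \<noteq> 0" "\<And>v. v \<in> W \<Longrightarrow> (\<Sum>i\<in>J. c i * M' v i) = 0"
      using insert.IH[OF J(1), of M'] by blast
    define s where "s = (\<Sum>i\<in>J. c i * (M w i / M w i0))"
    define c' where "c' = c(i0 := - s)"
    have "s \<in> K" unfolding s_def by (intro sum_mem mult_mem divide_mem c insert.prems)
    then have "c' i \<in> K" for i using c(1) by (simp add: c'_def uminus_mem)
    moreover have "\<exists>i\<in>I. c' i \<noteq> 0" using c(2) J by (auto simp: c'_def)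
    moreover have "(\<Sum>i\<in>I. c' i * M v i) = 0" if "v \<in> insert w W" for v
    proof -
      have "(\<Sum>i\<in>I. c' i * M v i) = - s * M v i0 + (\<Sum>i\<in>J. c' i * M v i)"
        unfolding J(3) using J(1,2) by (simp add: c'_def)
      also have "(\<Sum>i\<in>J. c' i * M v i) = (\<Sum>i\<in>J. c i * M v i)"
        using J(2) by (intro sum.cong) (auto simp: c'_def)
      also have "- s * M v i0 + (\<Sum>i\<in>J. c i * M v i) = (\<Sum>i\<in>J. c i * M' v i)"
        by (simp add: s_def M'_def sum_distrib_right sum_distrib_left right_diff_distrib sum_subtractf mult_ac)
      also have "\<dots> = 0"
      proof (cases "v = w")
        case True
        then show ?thesis using i0(2) by (simp add: M'_def)
      next
        case False
        then show ?thesis using c(3) that by blast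
      qed
      finally show ?thesis .
    qed
    ultimately show ?thesis by blast
  qed
qed

text \<open>The coefficients are the limits of partial sums of \<open>p\<close>-adic digits.\<close>

lemma span_of_representatives:
  assumes W: "finite W" "W \<subseteq> Ol"
    and step: "\<And>x. x \<in> Ol \<Longrightarrow> \<exists>v\<in>W. (x - v) / of_nat p \<in> Ol"
    and bound: "\<And>x. x \<in> Ol \<Longrightarrow> av x \<le> 1" and x: "x \<in> Ol"
  shows "\<exists>c. (\<forall>v. c v \<in> Qp) \<and> x = (\<Sum>v\<in>W. c v * v)"
proof -
  have p0: "of_nat p \<noteq> (0 :: 'a)" using p_gt_1 by simp
  obtain pick where pick: "\<And>x. x \<in> Ol \<Longrightarrow> pick x \<in> W" "\<And>x. x \<in> Ol \<Longrightarrow> (x - pick x) / of_nat p \<in> Ol"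
    using step by metis
  \<comment> \<open>\<open>X k\<close> is the remainder after \<open>k\<close> digits;
    \<open>C m v\<close> below collects the powers of \<open>p\<close> at those positions whose
    digit is \<open>v\<close>.\<close>
  define X where "X k = ((\<lambda>x. (x - pick x) / of_nat p) ^^ k) x" for k
  have X: "X k \<in> Ol" for k by (induction k) (simp_all add: X_def x pick)
  define C where "C m v = (\<Sum>k<m. if pick (X k) = v then of_nat p ^ k else 0 :: 'a)" for m v
  have CQ: "C m v \<in> Qp" for m v
    unfolding C_def by (intro Qp.sum_mem) (auto intro: Qp.power_mem Qp.of_nat_mem Qp.zero_mem)
  have eq: "x = (\<Sum>v\<in>W. C m v * v) + of_nat p ^ m * X m" for m
  proof (induction m)
    case 0
    then show ?case by (simp add: C_def X_def)
  next
    case (Suc m)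
    have "(\<Sum>v\<in>W. C (Suc m) v * v) = (\<Sum>v\<in>W. C m v * v + (if pick (X m) = v then of_nat p ^ m * v else 0))"
      by (intro sum.cong) (auto simp: C_def algebra_simps)
    also have "\<dots> = (\<Sum>v\<in>W. C m v * v) + of_nat p ^ m * pick (X m)"
      using W(1) pick(1)[OF X[of m]] by (simp add: sum.distrib)
    finally have "(\<Sum>v\<in>W. C (Suc m) v * v) = (\<Sum>v\<in>W. C m v * v) + of_nat p ^ m * pick (X m)" .
    moreover have "of_nat p ^ Suc m * X (Suc m) = of_nat p ^ m * (X m - pick (X m))"
      using p0 by (simp add: X_def)
    ultimately show ?case using Suc by (simp add: algebra_simps)
  qed
  have small: "(\<lambda>m. (1 / real p) ^ m) \<longlonglongrightarrow> 0" using p_gt_1 by (intro LIMSEQ_realpow_zero) auto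
  have diff: "av (C m v - C n v) \<le> (1 / real p) ^ n" if "n \<le> m" for m n v
  proof -
    have "C m v - C n v = (\<Sum>k\<in>{n..<m}. if pick (X k) = v then of_nat p ^ k else 0)"
      unfolding C_def lessThan_atLeast0 using that by (subst sum_diff_nat_ivl) auto
    also have "av \<dots> \<le> (1 / real p) ^ n"
    proof (rule av_sum_le)
      fix k assume "k \<in> {n..<m}"
      then have "(1 / real p) ^ k \<le> (1 / real p) ^ n" using p_gt_1 by (intro power_decreasing) auto
      then show "av (if pick (X k) = v then of_nat p ^ k else 0) \<le> (1 / real p) ^ n" by (simp add: av_p_power)
    qed simp
    finally show ?thesis .
  qed
  have "\<exists>l\<in>Qp. (\<lambda>m. av (C m v - l)) \<longlonglongrightarrow> 0" for v
  proof (rule Qp_complete[OF CQ])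
    fix e :: real assume "0 < e"
    then obtain N where N: "(1 / real p) ^ N < e"
      using real_arch_pow_inv[of e "1 / real p"] p_gt_1 by auto
    show "\<exists>N. \<forall>m\<ge>N. \<forall>n\<ge>N. av (C m v - C n v) < e"
    proof (intro exI[of _ N] allI impI)
      fix m n assume "N \<le> m" "N \<le> n"
      then have "av (C m v - C N v) < e" "av (C N v - C n v) < e"
        using diff[of N m v] diff[of N n v] N by (auto simp: av_diff_commute)
      then show "av (C m v - C n v) < e" by (rule av_triangle_less)
    qed
  qed
  then obtain c where c: "\<And>v. c v \<in> Qp" "\<And>v. (\<lambda>m. av (C m v - c v)) \<longlonglongrightarrow> 0" by metis
  have "x = (\<Sum>v\<in>W. c v * v)"
  proof (rule combination_limit[OF c(2) small _ W(1)])
    fix m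
    have "x - (\<Sum>v\<in>W. C m v * v) = of_nat p ^ m * X m" using eq[of m] by (simp add: algebra_simps)
    then have "av (x - (\<Sum>v\<in>W. C m v * v)) = (1 / real p) ^ m * av (X m)" by (simp only: av_mult av_p_power)
    also have "\<dots> \<le> (1 / real p) ^ m" using bound[OF X] by (intro mult_left_le) auto
    finally show "av (x - (\<Sum>v\<in>W. C m v * v)) \<le> (1 / real p) ^ m" .
  qed
  then show ?thesis using c(1) by blast
qed


section \<open>Polynomials of small degree on a disk\<close>

lemma av_prod_list_close:
  assumes "\<And>b. b \<in> set bs \<Longrightarrow> av (x - y) < av (y - b)"
  shows "av ((\<Prod>b\<leftarrow>bs. x - b) - (\<Prod>b\<leftarrow>bs. y - b)) < av (\<Prod>b\<leftarrow>bs. y - b)"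
  using assms
proof (induction bs)
  case (Cons b bs)
  let ?A = "\<Prod>b\<leftarrow>bs. x - b" and ?B = "\<Prod>b\<leftarrow>bs. y - b"
  have IH: "av (?A - ?B) < av ?B" and xy: "av (x - y) < av (y - b)" using Cons by auto
  have b: "av (x - b) = av (y - b)" using av_isosceles[of "x - b" "y - b"] xy by simp
  have y0: "0 < av (y - b)" using xy av_nonneg[of "x - y"] by linarith
  have B0: "0 < av ?B" using IH av_nonneg[of "?A - ?B"] by linarith
  \<comment> \<open>Corresponding factors have equal absolute value and differ by the smaller
    \<open>x - y\<close>, so both terms on the right are smaller than the product.\<close>
  have "(x - b) * ?A - (y - b) * ?B = (x - b) * (?A - ?B) + (x - y) * ?B" by (simp add: algebra_simps)
  moreover have "av ((x - b) * (?A - ?B)) < av (y - b) * av ?B"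
    unfolding av_mult b using IH y0 by simp
  moreover have "av ((x - y) * ?B) < av (y - b) * av ?B" unfolding av_mult using xy B0 by simp
  ultimately have "av ((x - b) * ?A - (y - b) * ?B) < av (y - b) * av ?B"
    using av_ultrametric[of "(x - b) * (?A - ?B)" "(x - y) * ?B"] by simp
  then show ?case by (simp add: av_mult)
qed simp

lemma orb_galois_eq:
  assumes "\<sigma> \<in> galois_group Qp"
  shows "orb (\<sigma> x) = orb x"
proof
  show "orb (\<sigma> x) \<subseteq> orb x"
    using orb_galois[OF galois_group_comp[OF _ assms]] by (auto simp: orb_def)
  show "orb x \<subseteq> orb (\<sigma> x)"
  proof
    fix y assume "y \<in> orb x"
    then obtain \<tau> where t: "\<tau> \<in> galois_group Qp" "y = \<tau> x" by (auto simp: orb_def)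
    then have "y = (\<tau> \<circ> inv_into UNIV \<sigma>) (\<sigma> x)" using galois_group_inv_apply(1)[OF assms] by simp
    then show "y \<in> orb (\<sigma> x)"
      using orb_galois[OF galois_group_comp[OF t(1) galois_group_inv[OF assms]]] by metis
  qed
qed

text \<open>
  Throughout, \<open>a\<close> is a point of lowest degree of the disk \<open>D\<close>.  A polynomial over \<open>Qp\<close> of smaller degree
  has no root in a conjugate of \<open>D\<close>, so it is constant there up to factors close to 1.
\<close>

context
  fixes D :: "'a set" and a :: 'a
  assumes D: "is_disk D" and a: "a \<in> D" and min: "\<And>x. x \<in> D \<Longrightarrow> card (orb a) \<le> card (orb x)"
begin

lemma poly_close_on_disk:
  assumes g: "g \<in> polys_in Qp" "g \<noteq> 0" "degree g < card (orb a)" and t: "\<tau> \<in> galois_group Qp"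
    and x: "x \<in> \<tau> ` D" and y: "y \<in> \<tau> ` D"
  shows "av (poly g x - poly g y) < av (poly g y)"
proof -
  obtain bs where bs: "g = smult (lead_coeff g) (\<Prod>b\<leftarrow>bs. [:- b, 1:])"
    using splitting_list[OF poly_root g(2)] by blast
  have ev: "poly (\<Prod>x\<leftarrow>ys. [:- x, 1:]) z = (\<Prod>y\<leftarrow>ys. z - y)" for ys and z :: 'a
    by (induction ys) (auto simp: algebra_simps)
  have gz: "poly g z = lead_coeff g * (\<Prod>b\<leftarrow>bs. z - b)" for z
    by (subst bs) (simp add: ev)
  have "av (x - y) < av (y - b)" if "b \<in> set bs" for b
  proof -
    have "(\<Prod>c\<leftarrow>bs. b - c) = 0" using that by (induction bs) auto
    then have gb: "poly g b = 0" by (simp add: gz)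
    have "b \<notin> \<tau> ` D"
    proof
      assume "b \<in> \<tau> ` D"
      then obtain d where d: "d \<in> D" "b = \<tau> d" by blast
      have "card (orb a) \<le> card (orb b)" using min[OF d(1)] orb_galois_eq[OF t] d(2) by simp
      then show False using card_orb_le_degree(2)[OF g(1,2) gb] g(3) by simp
    qed
    from disk_sep[OF galois_disk[OF t D] y x this] show ?thesis by (simp add: av_diff_commute)
  qed
  then have "av ((\<Prod>b\<leftarrow>bs. x - b) - (\<Prod>b\<leftarrow>bs. y - b)) < av (\<Prod>b\<leftarrow>bs. y - b)"
    by (rule av_prod_list_close)
  moreover have "0 < av (lead_coeff g)" using g(2) by (simp add: av_pos_iff)
  ultimately have "av (lead_coeff g) * av ((\<Prod>b\<leftarrow>bs. x - b) - (\<Prod>b\<leftarrow>bs. y - b))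
      < av (lead_coeff g) * av (\<Prod>b\<leftarrow>bs. y - b)" by simp
  then show ?thesis by (simp only: gz right_diff_distrib[symmetric] av_mult)
qed

lemma av_poly_eq_on_disk:
  assumes "g \<in> polys_in Qp" "g \<noteq> 0" "degree g < card (orb a)" "\<tau> \<in> galois_group Qp" "x \<in> \<tau> ` D" "y \<in> \<tau> ` D"
  shows "av (poly g x) = av (poly g y)"
  using av_isosceles[OF poly_close_on_disk[OF assms]] .

lemma poly_nonzero_on_disk:
  assumes "g \<in> polys_in Qp" "g \<noteq> 0" "degree g < card (orb a)" "\<tau> \<in> galois_group Qp" "x \<in> \<tau> ` D"
  shows "0 < av (poly g x)"
  using poly_close_on_disk[OF assms assms(5)] by simp

text \<open>Both \<open>\<sigma> a\<close> and \<open>\<tau> a\<close> lie in the common image disk,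
  where \<open>g\<close> and \<open>h\<close> vary only by factors close to 1. So the residue of the
  quotient depends on the image disk alone.\<close>

lemma quotient_close:
  assumes g: "g \<in> polys_in Qp" "degree g < card (orb a)"
    and h: "h \<in> polys_in Qp" "h \<noteq> 0" "degree h < card (orb a)"
    and le: "av (poly g a) \<le> av (poly h a)"
    and st: "\<sigma> \<in> galois_group Qp" "\<tau> \<in> galois_group Qp" "\<sigma> ` D = \<tau> ` D"
  shows "av (\<sigma> (poly g a / poly h a) - \<tau> (poly g a / poly h a)) < 1"
proof (cases "g = 0")
  case True
  then show ?thesis
    using field_auto.hom_zero[OF galois_group_field_auto[OF st(1)]] field_auto.hom_zero[OF galois_group_field_auto[OF st(2)]] by simp
next
  case False
  have hom: "\<rho> (poly q a) = poly q (\<rho> a)" if "\<rho> \<in> galois_group Qp" "q \<in> polys_in Qp" for \<rho> q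
  proof -
    interpret field_auto \<rho> using that(1) by (rule galois_group_field_auto)
    have "map_poly \<rho> q = q"
      using that(2) galois_group_fix[OF that(1)] by (intro poly_eqI) (simp add: coeff_map_poly hom_zero polys_in_def)
    then show ?thesis using hom_poly[of q a] by simp
  qed
  have s: "\<sigma> a \<in> \<tau> ` D" "\<tau> a \<in> \<tau> ` D" using a st(3) by blast+
  define X X' Y Y' where "X = poly g (\<sigma> a)" "X' = poly g (\<tau> a)" "Y = poly h (\<sigma> a)" "Y' = poly h (\<tau> a)"
  note XY = this
  have X: "av (X - X') < av X'" unfolding XY by (rule poly_close_on_disk[OF g(1) False g(2) st(2) s])
  have Y: "av (Y - Y') < av Y'" unfolding XY by (rule poly_close_on_disk[OF h st(2) s])
  have YY: "av Y = av Y'" using av_isosceles[OF Y] .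
  have Y0: "0 < av Y'" using Y av_nonneg[of "Y - Y'"] by linarith
  then have nz: "Y \<noteq> 0" "Y' \<noteq> 0" using YY by (auto simp: av_pos_iff[symmetric] simp del: av_0)
  have XY': "av X' \<le> av Y'"
    unfolding XY using le hom[OF st(2) g(1)] hom[OF st(2) h(1)] av_galois[OF st(2)] by metis
  have "X / Y - X' / Y' = (X - X') / Y + X' / Y' * ((Y' - Y) / Y)" using nz by (simp add: field_simps)
  moreover have "av ((X - X') / Y) < 1" using X XY' Y0 by (simp add: av_divide YY)
  moreover have "av (X' / Y' * ((Y' - Y) / Y)) < 1"
  proof -
    have "av ((Y' - Y) / Y) < 1" using Y Y0 by (simp add: av_divide YY av_diff_commute)
    moreover have "av (X' / Y') \<le> 1" using XY' Y0 by (simp add: av_divide)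
    ultimately show ?thesis unfolding av_mult using av_nonneg
      by (meson le_less_trans mult_left_le_one_le)
  qed
  ultimately have "av (X / Y - X' / Y') < 1"
    using av_ultrametric[of "(X - X') / Y" "X' / Y' * ((Y' - Y) / Y)"] by simp
  then show ?thesis
    using field_auto.hom_divide[OF galois_group_field_auto[OF st(1)]] field_auto.hom_divide[OF galois_group_field_auto[OF st(2)]]
      hom[OF st(1)] hom[OF st(2)] g(1) h(1) unfolding XY by simp
qed

text \<open>The field generated by \<open>a\<close> over \<open>Qp\<close>, treated as a vector
  space over \<open>Qp\<close>. Its elements are written with low-degree polynomials because those
  are under control on the disk.\<close>

definition low_values :: "'a set" where
  "low_values = (\<lambda>g. poly g a) ` {g \<in> polys_in Qp. degree g < card (orb a)}"

lemma low_values_diff: "x \<in> low_values \<Longrightarrow> y \<in> low_values \<Longrightarrow> x - y \<in> low_values"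
proof -
  assume "x \<in> low_values" "y \<in> low_values"
  then obtain g h where "g \<in> polys_in Qp" "degree g < card (orb a)" "x = poly g a"
    "h \<in> polys_in Qp" "degree h < card (orb a)" "y = poly h a" by (auto simp: low_values_def)
  then have "g - h \<in> polys_in Qp \<and> degree (g - h) < card (orb a) \<and> x - y = poly (g - h) a"
    using degree_diff_le_max[of g h] Qp.polys_in_diff by auto
  then show "x - y \<in> low_values" unfolding low_values_def by blast
qed

lemma low_values_scale: "c \<in> Qp \<Longrightarrow> x \<in> low_values \<Longrightarrow> c * x \<in> low_values"
proof -
  assume c: "c \<in> Qp" and "x \<in> low_values"
  then obtain g where "g \<in> polys_in Qp" "degree g < card (orb a)" "x = poly g a" by (auto simp: low_values_def)
  then have "smult c g \<in> polys_in Qp \<and> degree (smult c g) < card (orb a) \<and> c * x = poly (smult c g) a"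
    using degree_smult_le[of c g] Qp.polys_in_smult[OF c] by auto
  then show "c * x \<in> low_values" unfolding low_values_def by blast
qed

lemma low_values_power: "i < card (orb a) \<Longrightarrow> a ^ i \<in> low_values"
proof -
  assume "i < card (orb a)"
  then have "Polynomial.monom 1 i \<in> polys_in Qp \<and> degree (Polynomial.monom 1 i :: 'a poly) < card (orb a)
    \<and> a ^ i = poly (Polynomial.monom 1 i) a"
    using Qp.polys_in_monom[OF Qp.one_mem] by (simp add: degree_monom_eq poly_monom)
  then show ?thesis unfolding low_values_def by blast
qed

lemma low_values_zero: "0 \<in> low_values"
  unfolding low_values_def using Qp.polys_in_0 card_orb_pos[of a] by (intro image_eqI[of _ _ 0]) auto

text \<open>By \<open>quotient_close\<close>, the map from \<open>\<sigma>\<close> to the image of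
  \<open>D\<close> under \<open>\<sigma>\<close> can be used as \<open>f\<close> in the residue
  count; it takes at most \<open>k\<close> values.\<close>

lemma low_values_quotient_residue:
  assumes k: "card ((\<lambda>\<sigma>. \<sigma> ` D) ` galois_group Qp) \<le> k"
    and "x \<in> low_values" "y \<in> low_values" "y \<noteq> 0" "av x \<le> av y"
  shows "\<exists>z\<in>(\<Union>l\<in>{1..k}. roots_of_frobenius l). av (x / y - z) < 1"
proof -
  obtain g h where gh: "g \<in> polys_in Qp" "degree g < card (orb a)" "x = poly g a"
    "h \<in> polys_in Qp" "degree h < card (orb a)" "y = poly h a" using assms(2,3) by (auto simp: low_values_def)
  have h0: "h \<noteq> 0" using gh assms(4) by auto
  have "av (x / y) \<le> 1" using assms(4,5) av_pos_iff[of y] by (simp add: av_divide)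
  then show ?thesis
    using finite_disk_orbit[OF D order.refl] k
  proof (rule residue_near_root_of_frobenius)
    fix \<sigma> \<tau> assume "\<sigma> \<in> galois_group Qp" "\<tau> \<in> galois_group Qp" "\<sigma> ` D = \<tau> ` D"
    then show "av (\<sigma> (x / y) - \<tau> (x / y)) < 1"
      using quotient_close[OF gh(1,2,4) h0 gh(5)] assms(5) gh(3,6) by simp
  qed
qed

text \<open>A low-degree polynomial has the same absolute value at \<open>a\<close> and at
  \<open>b\<close>, and at \<open>b\<close> this is a value of \<open>K\<close>. So only the values
  of \<open>K\<close> enter, whatever its degree.\<close>

lemma low_values_av:
  assumes b: "b \<in> D" "b \<in> K" and K: "type_subfield K" "Qp \<subseteq> K"
    and vals: "\<And>x. x \<in> K \<Longrightarrow> x \<noteq> 0 \<Longrightarrow> \<exists>z :: int. av x ^ N = real p powi z"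
    and x: "x \<in> low_values" "x \<noteq> 0"
  shows "\<exists>z :: int. av x ^ N = real p powi z"
proof -
  interpret K: type_subfield K by fact
  obtain g where g: "g \<in> polys_in Qp" "degree g < card (orb a)" "x = poly g a" using x by (auto simp: low_values_def)
  have g0: "g \<noteq> 0" using g x by auto
  have iD: "id ` D = D" by simp
  have "av (poly g a) = av (poly g b)"
    using av_poly_eq_on_disk[OF g(1) g0 g(2) galois_group_id, of a b] a b(1) by simp
  moreover have "poly g b \<in> K" using g(1) K(2) b(2) by (intro K.polys_in_poly_mem) (auto simp: polys_in_def)
  moreover have "poly g b \<noteq> 0"
    using poly_nonzero_on_disk[OF g(1) g0 g(2) galois_group_id, of b] b(1) by (auto simp: av_pos_iff)
  ultimately show ?thesis using vals g(3) by metis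
qed

text \<open>
  Refining representatives of \<open>low_values\<close> from precision \<open>w ^ i\<close> to \<open>w ^ Suc i\<close> multiplies their number by at
  most the number of residues.
\<close>

lemma low_values_representatives:
  assumes k: "card ((\<lambda>\<sigma>. \<sigma> ` D) ` galois_group Qp) \<le> k" "1 \<le> k"
    and w: "0 < w" "\<And>x i. x \<in> low_values \<Longrightarrow> av x < w ^ i \<Longrightarrow> av x \<le> w ^ Suc i"
  shows "\<exists>W. finite W \<and> W \<subseteq> {x \<in> low_values. av x \<le> 1} \<and>
     card W \<le> card (\<Union>l\<in>{1..k}. roots_of_frobenius l) ^ i \<and>
     (\<forall>x\<in>low_values. av x \<le> 1 \<longrightarrow> (\<exists>v\<in>W. av (x - v) \<le> w ^ i))"
proof (induction i)
  case 0
  show ?case using low_values_zero by (intro exI[of _ "{0}"]) simp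
next
  case (Suc i)
  define Ol where "Ol = {x \<in> low_values. av x \<le> 1}"
  define R where "R = (\<Union>l\<in>{1..k}. roots_of_frobenius l)"
  have finR: "finite R" unfolding R_def by (intro finite_UN_I finite_roots_of_frobenius) auto
  have "0 \<in> R" unfolding R_def roots_of_frobenius_def using k(2) p_gt_1 by (auto simp: zero_power intro!: bexI[of _ 1])
  then have R1: "1 \<le> card R" using finR by (metis One_nat_def Suc_leI card_gt_0_iff empty_iff)
  obtain W where W: "finite W" "W \<subseteq> Ol" "card W \<le> card R ^ i"
    "\<And>x. x \<in> Ol \<Longrightarrow> \<exists>v\<in>W. av (x - v) \<le> w ^ i" using Suc unfolding Ol_def R_def by blast
  have "\<exists>T. finite T \<and> T \<subseteq> Ol \<and> card T \<le> card R \<and> (\<forall>x\<in>Ol. av (x - v) \<le> w ^ i \<longrightarrow> (\<exists>t\<in>T. av (x - t) \<le> w ^ Suc i))"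
    if v: "v \<in> W" for v
  \<comment> \<open>A difference of exact size \<open>w ^ i\<close> serves as a denominator:
    dividing by it turns the points near \<open>v\<close> into integral quotients, which are sorted
    by residue.\<close>
  proof (cases "\<exists>y\<in>Ol. av (y - v) = w ^ i")
    case True
    then obtain y where y: "y \<in> Ol" "av (y - v) = w ^ i" by blast
    have vO: "v \<in> Ol" using v W(2) by blast
    define P where "P z x \<longleftrightarrow> x \<in> Ol \<and> av ((x - v) / (y - v) - z) < 1" for z x
    \<comment> \<open>A residue attained by no point gets the default \<open>v\<close>, which keeps
      \<open>t\<close> inside \<open>Ol\<close>.\<close>
    define t where "t z = (if \<exists>x. P z x then SOME x. P z x else v)" for z
    have t: "P z (t z)" if "P z x" for z x unfolding t_def using that by (auto intro: someI)
    have tO: "t z \<in> Ol" for z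
    proof (cases "\<exists>x. P z x")
      case True
      then show ?thesis using t P_def by blast
    qed (simp add: t_def vO)
    have yv: "y - v \<noteq> 0" using y(2) w(1) by (metis av_0 less_irrefl zero_less_power)
    have "\<exists>t'\<in>t ` R. av (x - t') \<le> w ^ Suc i" if x: "x \<in> Ol" "av (x - v) \<le> w ^ i" for x
    proof -
      have "\<exists>z\<in>R. av ((x - v) / (y - v) - z) < 1"
        unfolding R_def using x y vO yv
        by (intro low_values_quotient_residue[OF k(1)]) (auto simp: Ol_def intro: low_values_diff)
      then obtain z where z: "z \<in> R" "P z x" using x(1) by (auto simp: P_def)
      have "av ((t z - v) / (y - v) - z) < 1" using t[OF z(2)] by (simp add: P_def)
      then have "av ((x - v) / (y - v) - (t z - v) / (y - v)) < 1"
        using z(2) av_triangle_less[of "(x - v) / (y - v)" z 1 "(t z - v) / (y - v)"] by (simp add: P_def av_diff_commute)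
      moreover have "(x - v) / (y - v) - (t z - v) / (y - v) = (x - t z) / (y - v)"
        by (simp add: diff_divide_distrib[symmetric])
      ultimately have "av (x - t z) < w ^ i" using y(2) w(1) by (simp add: av_divide)
      then have "av (x - t z) \<le> w ^ Suc i" using x(1) tO[of z] by (intro w(2) low_values_diff) (auto simp: Ol_def)
      then show ?thesis using z(1) by blast
    qed
    then show ?thesis using finR tO card_image_le[OF finR, of t] by (intro exI[of _ "t ` R"]) auto
  next
    case False
    \<comment> \<open>Without such a difference, the gap in the values makes \<open>v\<close> itself
      good to the next precision.\<close>
    have "av (x - v) \<le> w ^ Suc i" if "x \<in> Ol" "av (x - v) \<le> w ^ i" for x
    proof -
      have "av (x - v) < w ^ i" using False that by force
      then show ?thesis using that(1) v W(2) by (intro w(2) low_values_diff) (auto simp: Ol_def)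
    qed
    then show ?thesis using v W(2) R1 by (intro exI[of _ "{v}"]) auto
  qed
  then obtain T where T: "\<And>v. v \<in> W \<Longrightarrow> finite (T v) \<and> T v \<subseteq> Ol \<and> card (T v) \<le> card R \<and>
      (\<forall>x\<in>Ol. av (x - v) \<le> w ^ i \<longrightarrow> (\<exists>t\<in>T v. av (x - t) \<le> w ^ Suc i))" by metis
  have "card (\<Union>v\<in>W. T v) \<le> (\<Sum>v\<in>W. card (T v))" by (rule card_UN_le[OF W(1)])
  also have "\<dots> \<le> (\<Sum>v\<in>W. card R)" by (rule sum_mono) (use T in blast)
  also have "\<dots> \<le> card R ^ Suc i" using W(3) by (simp add: mult.commute)
  finally have "card (\<Union>v\<in>W. T v) \<le> card R ^ Suc i" .
  moreover have "\<exists>t\<in>(\<Union>v\<in>W. T v). av (x - t) \<le> w ^ Suc i" if "x \<in> Ol" for x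
    using W(4)[OF that] T that by blast
  moreover have "finite (\<Union>v\<in>W. T v)" "(\<Union>v\<in>W. T v) \<subseteq> Ol" using W(1) T by auto
  ultimately show ?case unfolding Ol_def R_def by (intro exI[of _ "\<Union>v\<in>W. T v"]) auto
qed

text \<open>Representatives to precision \<open>w ^ N = 1 / p\<close> are representatives modulo
  \<open>p\<close>. By digit expansion they span the integral part of \<open>low_values\<close>,
  which contains \<open>card (orb a)\<close> independent elements, the scaled powers of
  \<open>a\<close>.\<close>

lemma card_orb_min_le:
  assumes k: "card ((\<lambda>\<sigma>. \<sigma> ` D) ` galois_group Qp) \<le> k" "1 \<le> k" and N: "0 < N"
    and b: "b \<in> D" "b \<in> K" and K: "type_subfield K" "Qp \<subseteq> K"
    and vals: "\<And>x. x \<in> K \<Longrightarrow> x \<noteq> 0 \<Longrightarrow> \<exists>z :: int. av x ^ N = real p powi z"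
  shows "card (orb a) \<le> card (\<Union>l\<in>{1..k}. roots_of_frobenius l) ^ N"
proof -
  let ?n = "card (orb a)"
  \<comment> \<open>All nonzero elements of \<open>low_values\<close> have integral powers of this
    \<open>w\<close> as absolute values, so nothing lies strictly between \<open>w ^ Suc i\<close>
    and \<open>w ^ i\<close>.\<close>
  define w where "w = root N (1 / real p)"
  have wN: "w ^ N = 1 / real p" unfolding w_def using N p_gt_1 by (intro real_root_pow_pos2) auto
  have w0: "0 < w" unfolding w_def using N p_gt_1 by simp
  have gap: "av x \<le> w ^ Suc i" if x: "x \<in> low_values" "av x < w ^ i" for x i
  proof (cases "x = 0")
    case True
    then show ?thesis using w0 by simp
  next
    case False
    obtain z :: int where z: "av x ^ N = real p powi z" using low_values_av[OF b K vals x(1) False] by blast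
    have wi: "(w ^ j) ^ N = real p powi (- int j)" for j
      unfolding power_mult[symmetric] mult.commute[of j] power_mult wN
      by (simp add: power_int_minus power_one_over inverse_eq_divide)
    have "av x ^ N < (w ^ i) ^ N" using x(2) N by (intro power_strict_mono) (auto simp: av_nonneg)
    then have "real p powi z < real p powi (- int i)" unfolding z wi .
    then have "z < - int i" using power_int_increasing[of "- int i" z "real p"] p_gt_1 by linarith
    then have "real p powi z \<le> real p powi (- int (Suc i))" using p_gt_1 by (intro power_int_increasing) auto
    then have "av x ^ N \<le> (w ^ Suc i) ^ N" unfolding z wi .
    then show ?thesis using N w0 power_mono_iff[of "av x" "w ^ Suc i" N] av_nonneg[of x] by simp
  qed
  define Ol where "Ol = {x \<in> low_values. av x \<le> 1}"
  obtain W where W: "finite W" "W \<subseteq> Ol" "card W \<le> card (\<Union>l\<in>{1..k}. roots_of_frobenius l) ^ N"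
    "\<And>x. x \<in> Ol \<Longrightarrow> \<exists>v\<in>W. av (x - v) \<le> w ^ N"
    using low_values_representatives[OF k w0 gap, of N] unfolding Ol_def by blast
  have p0: "of_nat p \<noteq> (0 :: 'a)" using p_gt_1 by simp
  have step: "\<exists>v\<in>W. (x - v) / of_nat p \<in> Ol" if xO: "x \<in> Ol" for x
  proof -
    obtain v where v: "v \<in> W" "av (x - v) \<le> 1 / real p" using W(4)[OF xO] wN by auto
    have "(x - v) / of_nat p = inverse (of_nat p) * (x - v)" by (simp add: divide_inverse mult.commute)
    also have "\<dots> \<in> low_values"
      using xO v(1) W(2) by (intro low_values_scale low_values_diff Qp.inverse_mem Qp.of_nat_mem) (auto simp: Ol_def)
    finally have "(x - v) / of_nat p \<in> Ol"
      using v(2) p_gt_1 by (simp add: Ol_def av_divide av_p field_simps)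
    then show ?thesis using v(1) by blast
  qed
  have span: "\<exists>c. (\<forall>v. c v \<in> Qp) \<and> x = (\<Sum>v\<in>W. c v * v)" if "x \<in> Ol" for x
    by (rule span_of_representatives[OF W(1,2) step _ that]) (auto simp: Ol_def)
  \<comment> \<open>The powers of \<open>a\<close> need not be integral; a common power of
    \<open>p\<close> makes them so and preserves independence.\<close>
  have "\<exists>J. \<forall>i<?n. av (of_nat p ^ J * a ^ i) \<le> 1"
  proof -
    define m where "m = 1 + (\<Sum>i<?n. av (a ^ i))"
    have "0 < m" unfolding m_def by (intro add_pos_nonneg sum_nonneg) (auto simp: av_nonneg)
    then obtain J where J: "(1 / real p) ^ J < 1 / m"
      using real_arch_pow_inv[of "1 / m" "1 / real p"] p_gt_1 by auto
    have "av (of_nat p ^ J * a ^ i) \<le> 1" if "i < ?n" for i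
    proof -
      have "av (a ^ i) \<le> (\<Sum>i<?n. av (a ^ i))" using that by (intro member_le_sum) (auto simp: av_nonneg)
      then have "av (a ^ i) \<le> m" by (simp add: m_def)
      then have "(1 / real p) ^ J * av (a ^ i) \<le> 1 / m * m"
        using J \<open>0 < m\<close> av_nonneg by (intro mult_mono) auto
      then show ?thesis using \<open>0 < m\<close> by (simp add: av_mult av_p_power)
    qed
    then show ?thesis by blast
  qed
  then obtain J where J: "\<And>i. i < ?n \<Longrightarrow> av (of_nat p ^ J * a ^ i) \<le> 1" by blast
  have inOl: "of_nat p ^ J * a ^ i \<in> Ol" if "i < ?n" for i
    unfolding Ol_def using J[OF that] low_values_scale[OF _ low_values_power[OF that]]
    by (auto intro: Qp.power_mem Qp.of_nat_mem)
  have "\<forall>i. \<exists>c. (\<forall>v. c v \<in> Qp) \<and> (i < ?n \<longrightarrow> of_nat p ^ J * a ^ i = (\<Sum>v\<in>W. c v * v))"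
  proof
    fix i
    show "\<exists>c. (\<forall>v. c v \<in> Qp) \<and> (i < ?n \<longrightarrow> of_nat p ^ J * a ^ i = (\<Sum>v\<in>W. c v * v))"
    proof (cases "i < ?n")
      case True
      from span[OF inOl[OF this]] show ?thesis by blast
    next
      case False
      then show ?thesis by (intro exI[of _ "\<lambda>_. 0"]) (simp add: Qp.zero_mem)
    qed
  qed
  then obtain M where M: "\<And>i v. M i v \<in> Qp" "\<And>i. i < ?n \<Longrightarrow> of_nat p ^ J * a ^ i = (\<Sum>v\<in>W. M i v * v)" by metis
  \<comment> \<open>Otherwise the coefficients \<open>M\<close> satisfy a linear relation, giving a
    nonzero polynomial of degree below \<open>card (orb a)\<close> that vanishes at
    \<open>a\<close>.\<close>
  have "?n \<le> card W"
  proof (rule ccontr)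
    assume "\<not> ?n \<le> card W"
    then have "card W < card {..<?n}" by simp
    from homogeneous_system_solution[OF Qp_subfield W(1) _ this, of "\<lambda>v i. M i v"] M(1)
    obtain c where c0: "(\<forall>i. c i \<in> Qp) \<and> (\<exists>i\<in>{..<?n}. c i \<noteq> 0) \<and> (\<forall>v\<in>W. (\<Sum>i<?n. c i * M i v) = 0)"
      by blast
    then have c: "\<And>i. c i \<in> Qp" "\<exists>i<?n. c i \<noteq> 0" "\<And>v. v \<in> W \<Longrightarrow> (\<Sum>i<?n. c i * M i v) = 0" by auto
    define g where "g = (\<Sum>i<?n. Polynomial.monom (c i) i)"
    have co: "coeff g i = (if i < ?n then c i else 0)" for i unfolding g_def coeff_sum by simp
    have g: "g \<in> polys_in Qp" using c(1) Qp.zero_mem by (simp add: polys_in_def co)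
    have g0: "g \<noteq> 0" using c(2) co by (metis coeff_0)
    then have "lead_coeff g \<noteq> 0" by simp
    then have "degree g < ?n" using co[of "degree g"] by (metis)
    then have "poly g a \<noteq> 0" using card_orb_le_degree(2)[OF g g0] by force
    have "of_nat p ^ J * poly g a = (\<Sum>i<?n. c i * (of_nat p ^ J * a ^ i))"
      by (simp add: g_def poly_sum poly_monom sum_distrib_left mult_ac)
    also have "\<dots> = (\<Sum>i<?n. c i * (\<Sum>v\<in>W. M i v * v))" using M(2) by simp
    also have "\<dots> = (\<Sum>i<?n. \<Sum>v\<in>W. c i * M i v * v)" by (simp add: sum_distrib_left mult.assoc)
    also have "\<dots> = (\<Sum>v\<in>W. \<Sum>i<?n. c i * M i v * v)" by (rule sum.swap)
    also have "\<dots> = (\<Sum>v\<in>W. (\<Sum>i<?n. c i * M i v) * v)" by (simp add: sum_distrib_right)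
    also have "\<dots> = 0" using c(3) by simp
    finally show False using p0 \<open>poly g a \<noteq> 0\<close> by simp
  qed
  then show ?thesis using W(3) by simp
qed

end

text \<open>The bound involves only \<open>k\<close> and \<open>N\<close>: the field
  \<open>K\<close> controls the values, while its degree over \<open>Qp\<close>, possibly large,
  disappears.\<close>

theorem bounded_degree_point:
  assumes "is_disk D" "card ((\<lambda>\<sigma>. \<sigma> ` D) ` galois_group Qp) \<le> k" "0 < N"
    and b: "b \<in> D" "b \<in> K" and K: "type_subfield K" "Qp \<subseteq> K"
    and vals: "\<And>x. x \<in> K \<Longrightarrow> x \<noteq> 0 \<Longrightarrow> \<exists>z :: int. av x ^ N = real p powi z"
  shows "\<exists>a\<in>D. card (orb a) \<le> card (\<Union>l\<in>{1..k}. roots_of_frobenius l) ^ N"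
proof -
  from ex_has_least_nat[of "\<lambda>x. x \<in> D" b "\<lambda>x. card (orb x)"] b(1)
  obtain a where a: "a \<in> D" "\<And>x. x \<in> D \<Longrightarrow> card (orb a) \<le> card (orb x)" by blast
  have "0 < card ((\<lambda>\<sigma>. \<sigma> ` D) ` galois_group Qp)"
    using finite_disk_orbit[OF assms(1) order.refl] galois_group_id by (auto simp: card_gt_0_iff)
  then have "1 \<le> k" using assms(2) by linarith
  from card_orb_min_le[OF assms(1) a assms(2) this assms(3) b K vals] show ?thesis using a(1) by blast
qed

end

section \<open>Generic points of disks\<close>

context padic_closure
begin

text \<open>The residue field is infinite. A root \<open>z\<close> of the product of all
  \<open>X - s\<close>, minus 1, makes the product of all \<open>av (z - s)\<close> equal to 1; this
  forces \<open>av z \<le> 1\<close> and then each factor to be 1, so \<open>z\<close> is a new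
  residue.\<close>

lemma residue_system:
  "\<exists>S. finite S \<and> card S = Suc n \<and> 0 \<in> S \<and> (\<forall>x\<in>S. av x \<le> 1) \<and> (\<forall>x\<in>S. \<forall>y\<in>S. x \<noteq> y \<longrightarrow> av (x - y) = 1)"
proof (induction n)
  case 0
  show ?case by (intro exI[of _ "{0}"]) simp
next
  case (Suc n)
  then obtain S where S0: "finite S \<and> card S = Suc n \<and> 0 \<in> S \<and> (\<forall>x\<in>S. av x \<le> 1) \<and>
    (\<forall>x\<in>S. \<forall>y\<in>S. x \<noteq> y \<longrightarrow> av (x - y) = 1)" ..
  then have S: "finite S" "card S = Suc n" "0 \<in> S" "\<And>x. x \<in> S \<Longrightarrow> av x \<le> 1" by auto
  define g where "g = (\<Prod>s\<in>S. [:- s, 1:]) + [:- 1:]"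
  have "degree (\<Prod>s\<in>S. [:- s, 1:]) = Suc n" using S(2) by (subst degree_prod_sum_eq) auto
  then have "degree g = Suc n" unfolding g_def by (subst degree_add_eq_left) auto
  then obtain z where "poly g z = 0" using poly_root[of g] by auto
  then have prod: "(\<Prod>s\<in>S. z - s) = 1" by (simp add: g_def poly_prod)
  then have avp: "(\<Prod>s\<in>S. av (z - s)) = 1" by (simp flip: av_prod)
  have z1: "av z \<le> 1"
  proof (rule ccontr)
    assume "\<not> av z \<le> 1"
    then have gt: "1 < av z" by simp
    have big: "1 < av (z - s)" if "s \<in> S" for s
    proof -
      have "av (- s) < av (- z)" using S(4)[OF that] gt by simp
      then have "av (z - s - z) < av z" by simp
      then show ?thesis using av_isosceles[of "z - s" z] gt by simp
    qed
    have "1 \<le> (\<Prod>s\<in>S - {0}. av (z - s))" by (rule prod_ge_1) (use big in force)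
    then have "av z * 1 \<le> av z * (\<Prod>s\<in>S - {0}. av (z - s))" using gt by (intro mult_left_mono) auto
    also have "\<dots> = 1" using avp prod.remove[OF S(1,3), of "\<lambda>s. av (z - s)"] by simp
    finally show False using gt by simp
  qed
  have le: "av (z - s) \<le> 1" if "s \<in> S" for s using av_diff_le[of z s] z1 S(4)[OF that] by simp
  have eq: "av (z - s) = 1" if "s \<in> S" for s
  proof -
    have "1 = av (z - s) * (\<Prod>t\<in>S - {s}. av (z - t))" using avp S(1) that by (simp add: prod.remove)
    also have "\<dots> \<le> av (z - s) * 1" by (intro mult_left_mono prod_le_1) (auto simp: av_nonneg le)
    finally show ?thesis using le[OF that] by simp
  qed
  then have "z \<notin> S" by (metis av_0 cancel_comm_monoid_add_class.diff_cancel zero_neq_one)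
  then show ?case using S0 z1 eq
    by (intro exI[of _ "insert z S"]) (auto simp: av_diff_commute[of _ z])
qed

lemma avoid_finite_family:
  assumes "finite \<B>" "finite S" "card \<B> < card S"
    and once: "\<And>B s t. B \<in> \<B> \<Longrightarrow> s \<in> S \<Longrightarrow> t \<in> S \<Longrightarrow> bad B s \<Longrightarrow> bad B t \<Longrightarrow> s = t"
  shows "\<exists>s\<in>S. \<forall>B\<in>\<B>. \<not> bad B s"
proof (rule ccontr)
  assume "\<not> ?thesis"
  then obtain f where f: "\<And>s. s \<in> S \<Longrightarrow> f s \<in> \<B> \<and> bad (f s) s" by metis
  have "inj_on f S" by (rule inj_onI) (metis f once)
  then have "card S \<le> card \<B>" using f assms(1) by (intro card_inj_on_le) auto
  then show False using assms(3) by simp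
qed

text \<open>
  Closed disks of radius \<open>w ^ j\<close> with \<open>j\<close> even and open disks of radius \<open>w ^ (j - 1)\<close> with \<open>j\<close> odd, in a common chain
  indexed by \<open>j\<close>: around a given centre, the disk number \<open>j\<close> lies between \<open>|x - a| \<le> w ^ j\<close> and \<open>|x - a| < w ^ (j - 1)\<close>.
\<close>

definition level_disk :: "real \<Rightarrow> int \<Rightarrow> 'a \<Rightarrow> 'a set" where
  "level_disk w j a = (if even j then {x. av (x - a) \<le> w powi j} else {x. av (x - a) < w powi (j - 1)})"

lemma level_disk_center: "0 < w \<Longrightarrow> a \<in> level_disk w j a"
  by (simp add: level_disk_def less_imp_le)

lemma level_disk_recenter:
  assumes "b \<in> level_disk w j a"
  shows "level_disk w j b = level_disk w j a"
  using assms ball_recenter[of b a "w powi j"] open_ball_recenter[of b a "w powi (j - 1)"]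
  by (simp add: level_disk_def split: if_splits)

context
  fixes w :: real
  assumes w: "0 < w" "w < 1"
begin

lemma w_powi_less_iff: "w powi i < w powi j \<longleftrightarrow> j < i"
proof -
  have "w powi i < w powi j" if "j < i" for i j :: int
    using that w by (intro power_int_strict_decreasing) auto
  then show ?thesis by (metis less_asym linorder_neqE)
qed

lemma w_powi_le_iff: "w powi i \<le> w powi j \<longleftrightarrow> j \<le> i"
  using w_powi_less_iff[of j i] by linarith

lemma level_disk_lower: "av (x - a) \<le> w powi j \<Longrightarrow> x \<in> level_disk w j a"
  using w_powi_less_iff[of j "j - 1"] by (auto simp: level_disk_def)

lemma level_disk_upper:
  assumes "x \<in> level_disk w j a" "y \<in> level_disk w j a"
  shows "av (x - y) < w powi (j - 1)"
proof -
  have "x \<in> level_disk w j y" using assms level_disk_recenter by blast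
  then show ?thesis using w_powi_less_iff[of j "j - 1"] by (auto simp: level_disk_def split: if_splits)
qed

lemma level_disk_index_le:
  assumes "x \<in> level_disk w j a" "y \<in> level_disk w j a" "av (x - y) = w powi i"
  shows "j \<le> i"
  using level_disk_upper[OF assms(1,2)] assms(3) by (simp add: w_powi_less_iff)

lemma level_disk_mono:
  assumes "j \<le> i"
  shows "level_disk w i a \<subseteq> level_disk w j a"
proof (cases "i = j")
  case False
  show ?thesis
  proof
    fix x assume "x \<in> level_disk w i a"
    then have "av (x - a) < w powi (i - 1)" using level_disk_upper level_disk_center[OF w(1)] by blast
    also have "\<dots> \<le> w powi j" using assms False by (simp add: w_powi_le_iff)
    finally show "x \<in> level_disk w j a" by (intro level_disk_lower) simp
  qed
qed simp

context
  fixes c :: 'a and S :: "'a set" and \<B> :: "'a set set"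
  assumes c: "av c = w" and S: "finite S" "0 \<in> S" "\<And>x. x \<in> S \<Longrightarrow> av x \<le> 1"
    "\<And>x y. x \<in> S \<Longrightarrow> y \<in> S \<Longrightarrow> x \<noteq> y \<Longrightarrow> av (x - y) = 1"
    and \<B>: "finite \<B>" "Suc (card \<B>) < card S" "\<And>B. B \<in> \<B> \<Longrightarrow> \<exists>i b. B = level_disk w i b"
begin

lemma av_shift: "av ((a + c powi j * s) - (a + c powi j * t)) = w powi j * av (s - t)"
proof -
  have "(a + c powi j * s) - (a + c powi j * t) = c powi j * (s - t)" by (simp add: algebra_simps)
  then show ?thesis by (simp add: av_mult av_powi c)
qed

text \<open>The candidates \<open>a + c powi j * s\<close> are at mutual distance exactly
  \<open>w powi j\<close>. A disk of the family with two of them has level at most \<open>j\<close>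
  and so contains the whole disk; every other one excludes at most one candidate.\<close>

lemma generic_inside:
  "\<exists>s\<in>S. a + c powi j * s \<in> level_disk w j a \<and> (\<forall>B\<in>\<B>. a + c powi j * s \<in> B \<longleftrightarrow> level_disk w j a \<subseteq> B)"
proof -
  let ?x = "\<lambda>s. a + c powi j * s"
  have mem: "?x s \<in> level_disk w j a" if "s \<in> S" for s
  proof (rule level_disk_lower)
    have "av (?x s - a) = w powi j * av s" using av_shift[of a j s 0] by simp
    also have "\<dots> \<le> w powi j" using S(3)[OF that] w by (intro mult_left_le) (auto simp: less_imp_le)
    finally show "av (?x s - a) \<le> w powi j" .
  qed
  have "\<exists>s\<in>S. \<forall>B\<in>\<B>. \<not> (?x s \<in> B \<and> \<not> level_disk w j a \<subseteq> B)"
  proof (rule avoid_finite_family[OF \<B>(1) S(1)])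
    show "card \<B> < card S" using \<B>(2) by simp
    fix B s t
    assume st: "B \<in> \<B>" "s \<in> S" "t \<in> S" "?x s \<in> B \<and> \<not> level_disk w j a \<subseteq> B" "?x t \<in> B \<and> \<not> level_disk w j a \<subseteq> B"
    show "s = t"
    proof (rule ccontr)
      assume "s \<noteq> t"
      from S(4)[OF st(2,3) this] have "av (?x s - ?x t) = w powi j" by (simp only: av_shift mult_1_right)
      moreover obtain i b where B: "B = level_disk w i b" using \<B>(3) st(1) by blast
      ultimately have "i \<le> j" using level_disk_index_le st(4,5) by blast
      then have "level_disk w j (?x s) \<subseteq> level_disk w i (?x s)" by (rule level_disk_mono)
      moreover have "level_disk w i (?x s) = B" using st(4) B level_disk_recenter by blast
      moreover have "level_disk w j (?x s) = level_disk w j a" using mem[OF st(2)] by (rule level_disk_recenter)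
      ultimately show False using st(4) by simp
    qed
  qed
  then show ?thesis using mem by blast
qed

text \<open>The candidates lie on the circle of radius \<open>w powi (j - 1)\<close> just outside
  the disk. Removing the centre, given by the residue 0, costs one element of \<open>S\<close>;
  hence the \<open>Suc\<close> in the assumption on \<open>card S\<close>.\<close>

lemma generic_outside:
  "\<exists>x. x \<notin> level_disk w j a \<and> (\<forall>B\<in>\<B>. x \<in> B \<longleftrightarrow> level_disk w j a \<subset> B)"
proof -
  let ?x = "\<lambda>s. a + c powi (j - 1) * s" and ?D = "level_disk w j a"
  have dist: "av (?x s - a) = w powi (j - 1)" if "s \<in> S - {0}" for s
    using av_shift[of a "j - 1" s 0] S(4)[of s 0] S(2) that by simp
  have out: "?x s \<notin> ?D" if "s \<in> S - {0}" for s
    using level_disk_upper[of "?x s" j a a] level_disk_center[OF w(1), of a j] dist[OF that] by auto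
  have "\<exists>s\<in>S - {0}. \<forall>B\<in>\<B>. \<not> (?x s \<in> B \<and> \<not> ?D \<subset> B)"
  proof (rule avoid_finite_family[OF \<B>(1)])
    show "finite (S - {0})" using S(1) by simp
    show "card \<B> < card (S - {0})" using \<B>(2) S(1,2) by simp
    fix B s t
    assume st: "B \<in> \<B>" "s \<in> S - {0}" "t \<in> S - {0}" "?x s \<in> B \<and> \<not> ?D \<subset> B" "?x t \<in> B \<and> \<not> ?D \<subset> B"
    show "s = t"
    proof (rule ccontr)
      assume "s \<noteq> t"
      then have "av (?x s - ?x t) = w powi (j - 1)" using S(4)[of s t] st(2,3) by (simp only: av_shift) simp
      moreover obtain i b where B: "B = level_disk w i b" using \<B>(3) st(1) by blast
      ultimately have ij: "i \<le> j - 1" using level_disk_index_le st(4,5) by blast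
      have "a \<in> level_disk w (j - 1) (?x s)"
      proof (rule level_disk_lower)
        show "av (a - ?x s) \<le> w powi (j - 1)" unfolding av_diff_commute[of a] dist[OF st(2)] by simp
      qed
      also have "\<dots> \<subseteq> level_disk w i (?x s)" by (rule level_disk_mono[OF ij])
      also have "\<dots> = B" using st(4) B level_disk_recenter by blast
      finally have "level_disk w i a = B" using B level_disk_recenter by blast
      then have "?D \<subseteq> B" using level_disk_mono[of i j a] ij by simp
      then show False using st(2,4) out by blast
    qed
  qed
  then obtain s where s: "s \<in> S - {0}" "\<And>B. B \<in> \<B> \<Longrightarrow> ?x s \<in> B \<Longrightarrow> ?D \<subset> B" by blast
  \<comment> \<open>Conversely, a disk of the family strictly larger than \<open>?D\<close> has
    level at most \<open>j - 1\<close>, so it contains the whole circle.\<close>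
  have "?x s \<in> B" if BB: "B \<in> \<B>" "?D \<subset> B" for B
  proof -
    obtain i b where B: "B = level_disk w i b" using \<B>(3) BB(1) by blast
    have "a \<in> B" using BB(2) level_disk_center[OF w(1)] by blast
    then have B': "B = level_disk w i a" using B level_disk_recenter by blast
    have "i \<le> j - 1"
    proof (rule ccontr)
      assume "\<not> i \<le> j - 1"
      then have "B \<subseteq> ?D" unfolding B' by (intro level_disk_mono) simp
      then show False using that(2) by blast
    qed
    moreover have "?x s \<in> level_disk w (j - 1) a"
      by (rule level_disk_lower) (unfold dist[OF s(1)], simp)
    ultimately show ?thesis unfolding B' using level_disk_mono[of i "j - 1" a] by blast
  qed
  then show ?thesis using s out by blast
qed

text \<open>For \<open>i < j\<close>, the point \<open>a + c powi (j - 1)\<close> lies in the disk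
  of level \<open>i\<close> around \<open>a\<close> but not in that of level
  \<open>j\<close>.\<close>

lemma level_disk_inj:
  assumes "level_disk w i a = level_disk w j b"
  shows "i = j"
proof -
  have *: False if lt: "i < j" and eq: "level_disk w i a = level_disk w j b" for i j a b
  proof -
    have "a \<in> level_disk w j b" using eq level_disk_center[OF w(1)] by blast
    then have eq': "level_disk w i a = level_disk w j a" using eq level_disk_recenter by blast
    have "a + c powi (j - 1) \<in> level_disk w i a"
      by (rule subsetD[OF level_disk_mono[of i "j - 1"] level_disk_lower]) (use lt in \<open>auto simp: av_powi c\<close>)
    then show False
      using eq' level_disk_upper[of "a + c powi (j - 1)" j a a] level_disk_center[OF w(1), of a j] by (simp add: av_powi c)
  qed
  show ?thesis using *[OF _ assms] *[OF _ assms[symmetric]] by (metis linorder_neqE)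
qed

end

end

text \<open>The factor 2 turns every radius \<open>r\<close> whose \<open>N\<close>-th power is a
  power of \<open>p\<close> into an even power of \<open>av c\<close>, which leaves the odd levels
  to open disks.\<close>

lemma uniformizer_root:
  assumes "0 < N"
  obtains c where "av c ^ (2 * N) = 1 / real p" "0 < av c" "av c < 1"
proof -
  have "degree (Polynomial.monom 1 (2 * N) + [:- of_nat p :: 'a:]) = 2 * N"
    using assms by (subst degree_add_eq_left) (simp_all add: degree_monom_eq)
  then obtain c where "poly (Polynomial.monom 1 (2 * N) + [:- of_nat p :: 'a:]) c = 0"
    using poly_root assms by (metis mult_pos_pos zero_less_numeral)
  then have "c ^ (2 * N) = of_nat p" by (simp add: poly_monom)
  then have *: "av c ^ (2 * N) = 1 / real p" by (simp flip: av_power add: av_p)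
  have "0 < av c"
  proof (rule ccontr)
    assume "\<not> 0 < av c"
    then have "av c = 0" using av_nonneg[of c] by simp
    then show False using * assms p_gt_1 by (simp add: zero_power)
  qed
  moreover have "av c < 1"
  proof (rule ccontr)
    assume "\<not> av c < 1"
    then have "1 \<le> av c ^ (2 * N)" by (intro one_le_power) simp
    then show False using * p_gt_1 by simp
  qed
  ultimately show ?thesis using * that by blast
qed

text \<open>For \<open>r > 0\<close>: the logarithm of \<open>r\<close> to base \<open>p\<close> is
  rational with denominator dividing \<open>N\<close>.\<close>

definition p_power_exp :: "nat \<Rightarrow> real \<Rightarrow> bool" where
  "p_power_exp N r \<longleftrightarrow> (\<exists>z :: int. r ^ N = real p powi z)"

lemma p_power_exp_mult: "p_power_exp N r \<Longrightarrow> p_power_exp (N * k) r"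
  unfolding p_power_exp_def power_mult by (metis power_int_mult power_int_of_nat)

lemma level_disk_of_radius:
  assumes w: "0 < w" "w ^ (2 * N) = 1 / real p" "0 < N" and r: "0 < r" "p_power_exp N r"
  shows "\<exists>j. even j \<and> {x. av (x - a) \<le> r} = level_disk w j a"
    and "\<exists>j. odd j \<and> {x. av (x - a) < r} = level_disk w j a"
proof -
  obtain z :: int where z: "r ^ N = real p powi z" using r(2) by (auto simp: p_power_exp_def)
  have "(w powi (- 2 * z)) ^ N = (w ^ (2 * N)) powi (- z)"
    by (simp add: power_int_power power_int_power' mult_ac flip: power_int_mult)
  also have "\<dots> = r ^ N" unfolding w(2) z by (simp add: power_int_minus power_int_divide_distrib)
  finally have "w powi (- 2 * z) = r"
    using power_eq_iff_eq_base[of N "w powi (- 2 * z)" r] w r by simp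
  then have "{x. av (x - a) \<le> r} = level_disk w (- 2 * z) a" "{x. av (x - a) < r} = level_disk w (1 - 2 * z) a"
    by (simp_all add: level_disk_def)
  moreover have "even (- 2 * z)" "odd (1 - 2 * z)" by simp_all
  ultimately show "\<exists>j. even j \<and> {x. av (x - a) \<le> r} = level_disk w j a"
    "\<exists>j. odd j \<and> {x. av (x - a) < r} = level_disk w j a" by blast+
qed

definition open_disk :: "'a set \<Rightarrow> bool" where
  "open_disk D \<longleftrightarrow> (\<exists>a. \<exists>r\<in>av ` (UNIV - {0}). D = {x. av (x - a) < r})"

definition closed_disk :: "'a set \<Rightarrow> bool" where
  "closed_disk D \<longleftrightarrow> (\<exists>a. \<exists>r\<in>av ` (UNIV - {0}). D = {x. av (x - a) \<le> r})"

lemma av_p_power_exp: "x \<noteq> 0 \<Longrightarrow> \<exists>N>0. p_power_exp N (av x)"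
  unfolding p_power_exp_def using av_value_power_orb[of x] card_orb_pos[of x] by blast

lemma common_p_power_exp:
  assumes "finite R" "R \<subseteq> av ` (UNIV - {0})"
  shows "\<exists>N>0. \<forall>r\<in>R. p_power_exp N r"
  using assms
proof (induction R rule: finite_induct)
  case (insert r R)
  then obtain N where N: "N > 0" "\<forall>r\<in>R. p_power_exp N r" by auto
  obtain M where M: "M > 0" "p_power_exp M r" using insert.prems av_p_power_exp by auto
  have "p_power_exp (N * M) s" if "s \<in> insert r R" for s
    using that N(2) M(2) p_power_exp_mult[of M r N] p_power_exp_mult[of N s M] by (auto simp: mult.commute)
  then show ?case using N(1) M(1) by (intro exI[of _ "N * M"]) simp
qed auto

text \<open>Finitely many radii have a common denominator, hence a common \<open>w\<close>; the
  parity of the level records the type of the disk. Radii for closed and open descriptions are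
  chosen separately, since a set with both is not yet excluded.\<close>

lemma disk_family_levels:
  assumes "finite \<B>" "\<And>B. B \<in> \<B> \<Longrightarrow> open_disk B \<or> closed_disk B"
  obtains w c S where "0 < w" "w < 1" "av c = w" "finite S" "0 \<in> S" "\<And>x. x \<in> S \<Longrightarrow> av x \<le> 1"
    "\<And>x y. x \<in> S \<Longrightarrow> y \<in> S \<Longrightarrow> x \<noteq> y \<Longrightarrow> av (x - y) = 1" "Suc (card \<B>) < card S"
    "\<And>B. B \<in> \<B> \<Longrightarrow> closed_disk B \<Longrightarrow> \<exists>i b. even i \<and> B = level_disk w i b"
    "\<And>B. B \<in> \<B> \<Longrightarrow> open_disk B \<Longrightarrow> \<exists>i b. odd i \<and> B = level_disk w i b"
proof -
  have one: "(1::real) \<in> av ` (UNIV - {0})" by (rule image_eqI[of _ _ 1]) auto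
  have "\<forall>B. \<exists>r. r \<in> av ` (UNIV - {0}) \<and> (closed_disk B \<longrightarrow> (\<exists>a. B = {x. av (x - a) \<le> r}))"
  proof
    fix B
    show "\<exists>r. r \<in> av ` (UNIV - {0}) \<and> (closed_disk B \<longrightarrow> (\<exists>a. B = {x. av (x - a) \<le> r}))"
    proof (cases "closed_disk B")
      case True
      then obtain a r where "r \<in> av ` (UNIV - {0})" "B = {x. av (x - a) \<le> r}" unfolding closed_disk_def by metis
      then show ?thesis by (intro exI[of _ r] conjI impI exI[of _ a])
    qed (use one in \<open>intro exI[of _ 1]; simp\<close>)
  qed
  then obtain rc where rc: "\<And>B. rc B \<in> av ` (UNIV - {0})"
    and cl: "\<And>B. closed_disk B \<Longrightarrow> \<exists>a. B = {x. av (x - a) \<le> rc B}" by metis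
  have "\<forall>B. \<exists>r. r \<in> av ` (UNIV - {0}) \<and> (open_disk B \<longrightarrow> (\<exists>a. B = {x. av (x - a) < r}))"
  proof
    fix B
    show "\<exists>r. r \<in> av ` (UNIV - {0}) \<and> (open_disk B \<longrightarrow> (\<exists>a. B = {x. av (x - a) < r}))"
    proof (cases "open_disk B")
      case True
      then obtain a r where "r \<in> av ` (UNIV - {0})" "B = {x. av (x - a) < r}" unfolding open_disk_def by metis
      then show ?thesis by (intro exI[of _ r] conjI impI exI[of _ a])
    qed (use one in \<open>intro exI[of _ 1]; simp\<close>)
  qed
  then obtain ro where ro: "\<And>B. ro B \<in> av ` (UNIV - {0})"
    and op: "\<And>B. open_disk B \<Longrightarrow> \<exists>a. B = {x. av (x - a) < ro B}" by metis
  have "finite (rc ` \<B> \<union> ro ` \<B>)" "rc ` \<B> \<union> ro ` \<B> \<subseteq> av ` (UNIV - {0})" using assms(1) rc ro by auto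
  from common_p_power_exp[OF this] obtain N where N: "N > 0" "\<And>r. r \<in> rc ` \<B> \<union> ro ` \<B> \<Longrightarrow> p_power_exp N r" by blast
  obtain c where c: "av c ^ (2 * N) = 1 / real p" "0 < av c" "av c < 1" using uniformizer_root[OF N(1)] .
  obtain S where S: "finite S" "card S = Suc (Suc (card \<B>))" "0 \<in> S" "\<forall>x\<in>S. av x \<le> 1"
    "\<forall>x\<in>S. \<forall>y\<in>S. x \<noteq> y \<longrightarrow> av (x - y) = 1"
    using residue_system[of "Suc (card \<B>)"] by (elim exE conjE) (rule that)
  have pos: "0 < r" if "r \<in> av ` (UNIV - {0})" for r using that av_pos_iff by auto
  show ?thesis
  proof (rule that[OF c(2,3) refl S(1,3)])
    fix B assume B: "B \<in> \<B>" "closed_disk B"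
    from cl[OF B(2)] obtain a where a: "B = {x. av (x - a) \<le> rc B}" ..
    have "\<exists>j. even j \<and> {x. av (x - a) \<le> rc B} = level_disk (av c) j a"
      by (rule level_disk_of_radius(1)[OF c(2,1) N(1) pos[OF rc] N(2)]) (use B(1) in simp)
    then obtain j where "even j \<and> B = level_disk (av c) j a" unfolding a[symmetric] ..
    then show "\<exists>i b. even i \<and> B = level_disk (av c) i b" by (intro exI)
  next
    fix B assume B: "B \<in> \<B>" "open_disk B"
    from op[OF B(2)] obtain a where a: "B = {x. av (x - a) < ro B}" ..
    have "\<exists>j. odd j \<and> {x. av (x - a) < ro B} = level_disk (av c) j a"
      by (rule level_disk_of_radius(2)[OF c(2,1) N(1) pos[OF ro] N(2)]) (use B(1) in simp)
    then obtain j where "odd j \<and> B = level_disk (av c) j a" unfolding a[symmetric] ..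
    then show "\<exists>i b. odd i \<and> B = level_disk (av c) i b" by (intro exI)
  qed (use S in auto)
qed

lemma generic_points:
  assumes "finite \<B>" "\<And>B. B \<in> \<B> \<Longrightarrow> open_disk B \<or> closed_disk B" "D \<in> \<B>"
  shows "\<exists>x\<in>D. \<forall>B\<in>\<B>. x \<in> B \<longleftrightarrow> D \<subseteq> B" and "\<exists>x. x \<notin> D \<and> (\<forall>B\<in>\<B>. x \<in> B \<longleftrightarrow> D \<subset> B)"
proof -
  obtain w c S where w: "0 < w" "w < 1" "av c = w" "finite S" "0 \<in> S" "\<And>x. x \<in> S \<Longrightarrow> av x \<le> 1"
    "\<And>x y. x \<in> S \<Longrightarrow> y \<in> S \<Longrightarrow> x \<noteq> y \<Longrightarrow> av (x - y) = 1" "Suc (card \<B>) < card S"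
    "\<And>B. B \<in> \<B> \<Longrightarrow> closed_disk B \<Longrightarrow> \<exists>i b. even i \<and> B = level_disk w i b"
    "\<And>B. B \<in> \<B> \<Longrightarrow> open_disk B \<Longrightarrow> \<exists>i b. odd i \<and> B = level_disk w i b"
    by (rule disk_family_levels[of \<B>]) (use assms in auto)
  have lev: "\<exists>i b. B = level_disk w i b" if "B \<in> \<B>" for B
    using assms(2)[OF that] w(9,10)[OF that] by blast
  then obtain j a where D: "D = level_disk w j a" using assms(3) by blast
  show "\<exists>x\<in>D. \<forall>B\<in>\<B>. x \<in> B \<longleftrightarrow> D \<subseteq> B"
    using generic_inside[OF w(1-7) assms(1) w(8) lev, of a j] unfolding D by blast
  show "\<exists>x. x \<notin> D \<and> (\<forall>B\<in>\<B>. x \<in> B \<longleftrightarrow> D \<subset> B)"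
    using generic_outside[OF w(1-7) assms(1) w(8) lev, of j a] unfolding D by blast
qed

text \<open>The level is unique and its parity gives the type away. This depends on radii in the
  value group: for other radii the open and the closed disk coincide.\<close>

lemma closed_disk_not_open: "closed_disk D \<Longrightarrow> \<not> open_disk D"
proof
  assume D: "closed_disk D" "open_disk D"
  obtain w c S where w: "0 < w" "w < 1" "av c = w" "finite S" "0 \<in> S" "\<And>x. x \<in> S \<Longrightarrow> av x \<le> 1"
    "\<And>x y. x \<in> S \<Longrightarrow> y \<in> S \<Longrightarrow> x \<noteq> y \<Longrightarrow> av (x - y) = 1" "Suc (card {D}) < card S"
    "\<And>B. B \<in> {D} \<Longrightarrow> closed_disk B \<Longrightarrow> \<exists>i b. even i \<and> B = level_disk w i b"
    "\<And>B. B \<in> {D} \<Longrightarrow> open_disk B \<Longrightarrow> \<exists>i b. odd i \<and> B = level_disk w i b"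
    by (rule disk_family_levels[of "{D}"]) (use D in auto)
  obtain i b where i: "even i" "D = level_disk w i b" using w(9) D by blast
  obtain j a where j: "odd j" "D = level_disk w j a" using w(10) D by blast
  have "i = j"
    by (rule level_disk_inj[OF w(1-7) finite.emptyI, of i b j a]) (use i j w(8) in auto)
  then show False using i j by simp
qed

lemma open_disk_is_disk:
  assumes "open_disk D"
  shows "is_disk D"
proof -
  obtain a c where "c \<noteq> 0" "D = {x. av (x - a) < av c}" using assms by (auto simp: open_disk_def)
  then show ?thesis unfolding is_disk_def by (intro exI[of _ a] exI[of _ "av c"]) (simp add: av_pos_iff)
qed

lemma closed_disk_is_disk:
  assumes "closed_disk D"
  shows "is_disk D"
proof -
  obtain a c where "c \<noteq> 0" "D = {x. av (x - a) \<le> av c}" using assms by (auto simp: closed_disk_def)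
  then show ?thesis unfolding is_disk_def by (intro exI[of _ a] exI[of _ "av c"]) (simp add: av_pos_iff)
qed

end

section \<open>Decompositions into disks with holes\<close>

definition holed_disk :: "'a set \<times> 'a set set \<Rightarrow> 'a set" where
  "holed_disk c = fst c - \<Union> (snd c)"

definition disks_of :: "('a set \<times> 'a set set) set \<Rightarrow> 'a set set" where
  "disks_of P = (\<Union>c\<in>P. insert (fst c) (snd c))"

lemma holed_disk_agree:
  assumes "\<And>B. B \<in> disks_of P \<Longrightarrow> x \<in> B \<longleftrightarrow> y \<in> B" "c \<in> P"
  shows "x \<in> holed_disk c \<longleftrightarrow> y \<in> holed_disk c"
proof -
  have "x \<in> B \<longleftrightarrow> y \<in> B" if "B \<in> insert (fst c) (snd c)" for B
    using assms(1)[of B] assms(2) that unfolding disks_of_def by blast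
  then show ?thesis unfolding holed_disk_def by blast
qed

context padic_closure
begin

text \<open>Outer disks and holes are carried explicitly, so that the family of all disks can be
  compared and transported. Outer parts are open disks only, since an affine set omits
  \<open>Pt_infinity\<close>.\<close>

definition disk_decomp :: "'a set \<Rightarrow> ('a set \<times> 'a set set) set \<Rightarrow> bool" where
  "disk_decomp X P \<longleftrightarrow> finite P \<and>
     (\<forall>c\<in>P. open_disk (fst c) \<and> finite (snd c) \<and> disjoint (snd c) \<and> (\<forall>D\<in>snd c. closed_disk D \<and> D \<subset> fst c)) \<and>
     (\<forall>c\<in>P. \<forall>c'\<in>P. c \<noteq> c' \<longrightarrow> holed_disk c \<inter> holed_disk c' = {}) \<and> X = (\<Union>c\<in>P. holed_disk c)"

lemma disk_decompD:
  assumes "disk_decomp X P"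
  shows "finite P" "X = (\<Union>c\<in>P. holed_disk c)"
    and "c \<in> P \<Longrightarrow> open_disk (fst c)" "c \<in> P \<Longrightarrow> finite (snd c)"
    and "c \<in> P \<Longrightarrow> disjoint (snd c)" "c \<in> P \<Longrightarrow> D \<in> snd c \<Longrightarrow> closed_disk D"
    and "c \<in> P \<Longrightarrow> D \<in> snd c \<Longrightarrow> D \<subset> fst c"
    and "c \<in> P \<Longrightarrow> c' \<in> P \<Longrightarrow> x \<in> holed_disk c \<Longrightarrow> x \<in> holed_disk c' \<Longrightarrow> c = c'"
proof -
  have P: "finite P" "X = (\<Union>c\<in>P. holed_disk c)"
    and Q: "\<forall>c\<in>P. open_disk (fst c) \<and> finite (snd c) \<and> disjoint (snd c) \<and> (\<forall>D\<in>snd c. closed_disk D \<and> D \<subset> fst c)"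
    and R: "\<forall>c\<in>P. \<forall>c'\<in>P. c \<noteq> c' \<longrightarrow> holed_disk c \<inter> holed_disk c' = {}"
    using assms unfolding disk_decomp_def by simp_all
  show "finite P" "X = (\<Union>c\<in>P. holed_disk c)" by (rule P)+
  {
    assume "c \<in> P"
    from bspec[OF Q this] show "open_disk (fst c)" "finite (snd c)" "disjoint (snd c)"
      "D \<in> snd c \<Longrightarrow> closed_disk D" "D \<in> snd c \<Longrightarrow> D \<subset> fst c" by simp_all
  }
  assume "c \<in> P" "c' \<in> P" "x \<in> holed_disk c" "x \<in> holed_disk c'"
  moreover from bspec[OF bspec[OF R \<open>c \<in> P\<close>] \<open>c' \<in> P\<close>] have "c \<noteq> c' \<longrightarrow> holed_disk c \<inter> holed_disk c' = {}" .
  ultimately show "c = c'" by (metis IntI empty_iff)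
qed

lemma disks_of_finite: "disk_decomp X P \<Longrightarrow> finite (disks_of P)"
  unfolding disks_of_def using disk_decompD(1,4) by (intro finite_UN_I) auto

lemma disks_of_open_or_closed: "disk_decomp X P \<Longrightarrow> B \<in> disks_of P \<Longrightarrow> open_disk B \<or> closed_disk B"
  unfolding disks_of_def using disk_decompD(3,6) by blast

lemma disk_decomp_agree:
  assumes "disk_decomp X P" "\<And>B. B \<in> disks_of P \<Longrightarrow> x \<in> B \<longleftrightarrow> y \<in> B"
  shows "x \<in> X \<longleftrightarrow> y \<in> X"
  unfolding disk_decompD(2)[OF assms(1)] using holed_disk_agree[of P x y, OF assms(2)] by blast

text \<open>Here \<open>x\<close> and \<open>y\<close> are generic points just inside and just outside the boundary of \<open>D\<close>.\<close>

lemma disk_decomp_boundary: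
  assumes dec: "disk_decomp X P" and D: "D \<in> disks_of P"
    and x: "x \<in> D" "\<And>B. B \<in> disks_of P \<Longrightarrow> x \<in> B \<longleftrightarrow> D \<subseteq> B"
    and y: "y \<notin> D" "\<And>B. B \<in> disks_of P \<Longrightarrow> y \<in> B \<longleftrightarrow> D \<subset> B"
  shows "x \<in> X \<longleftrightarrow> y \<notin> X"
proof -
  note dd = disk_decompD[OF dec]
  have mem: "fst c \<in> disks_of P" "H \<in> snd c \<Longrightarrow> H \<in> disks_of P" if "c \<in> P" for c H
    using that unfolding disks_of_def by blast+
  obtain c where c: "c \<in> P" "D = fst c \<or> D \<in> snd c" using D unfolding disks_of_def by blast
  show ?thesis
  proof (cases "D = fst c")
    case True
    have xc: "x \<in> holed_disk c"
    proof -
      have "x \<notin> H" if "H \<in> snd c" for H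
        using dd(7)[OF c(1) that] x(2)[OF mem(2)[OF c(1) that]] True by blast
      then show ?thesis using x(1) True by (auto simp: holed_disk_def)
    qed
    \<comment> \<open>A component with \<open>y\<close> would contain \<open>x\<close> as well: its
      hole through \<open>x\<close> but not \<open>y\<close> would be \<open>D\<close>, which is
      open. Disjointness makes it \<open>c\<close>, but \<open>y\<close> lies outside
      \<open>D\<close>.\<close>
    have "y \<notin> X"
    proof
      assume "y \<in> X"
      then obtain c' where c': "c' \<in> P" "y \<in> holed_disk c'" unfolding dd(2) by blast
      have "D \<subset> fst c'" using c' y(2)[OF mem(1)[OF c'(1)]] by (simp add: holed_disk_def)
      moreover have "x \<notin> H" if H: "H \<in> snd c'" for H
      proof
        assume "x \<in> H"
        then have "D \<subseteq> H" using x(2)[OF mem(2)[OF c'(1) H]] by blast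
        moreover have "\<not> D \<subset> H" using c'(2) H y(2)[OF mem(2)[OF c'(1) H]] by (auto simp: holed_disk_def)
        ultimately have "D = H" by blast
        then show False using dd(6)[OF c'(1) H] dd(3)[OF c(1)] True closed_disk_not_open by blast
      qed
      ultimately have "x \<in> holed_disk c'" using x(1) by (auto simp: holed_disk_def)
      then have "c = c'" using dd(8)[OF c(1) c'(1) xc] by blast
      then show False using c'(2) y(1) True by (simp add: holed_disk_def)
    qed
    then show ?thesis using xc c(1) dd(2) by blast
  next
    case False
    then have H: "D \<in> snd c" using c(2) by blast
    have yc: "y \<in> holed_disk c"
    proof -
      have "y \<in> fst c" using dd(7)[OF c(1) H] y(2)[OF mem(1)[OF c(1)]] by blast
      moreover have "y \<notin> H'" if "H' \<in> snd c" for H'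
      proof
        assume "y \<in> H'"
        then have "D \<subset> H'" using y(2)[OF mem(2)[OF c(1) that]] by blast
        then show False using dd(5)[OF c(1)] H that x(1) unfolding disjoint_def by blast
      qed
      ultimately show ?thesis by (auto simp: holed_disk_def)
    qed
    \<comment> \<open>Dually, a component with \<open>x\<close> has an open outer disk around the
      closed \<open>D\<close>, hence a strictly larger one, and so contains \<open>y\<close>. It is
      then \<open>c\<close>, where \<open>x\<close> lies in a hole.\<close>
    have "x \<notin> X"
    proof
      assume "x \<in> X"
      then obtain c' where c': "c' \<in> P" "x \<in> holed_disk c'" unfolding dd(2) by blast
      have "D \<subseteq> fst c'" using c' x(2)[OF mem(1)[OF c'(1)]] by (simp add: holed_disk_def)
      moreover have "D \<noteq> fst c'" using dd(6)[OF c(1) H] dd(3)[OF c'(1)] closed_disk_not_open by blast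
      ultimately have "y \<in> fst c'" using y(2)[OF mem(1)[OF c'(1)]] by blast
      moreover have "y \<notin> H'" if H': "H' \<in> snd c'" for H'
      proof
        assume "y \<in> H'"
        then have "D \<subset> H'" using y(2)[OF mem(2)[OF c'(1) H']] by blast
        then show False using x(1) c'(2) H' by (auto simp: holed_disk_def)
      qed
      ultimately have "y \<in> holed_disk c'" by (auto simp: holed_disk_def)
      then have "c = c'" using dd(8)[OF c(1) c'(1) yc] by blast
      then show False using c'(2) x(1) H by (auto simp: holed_disk_def)
    qed
    then show ?thesis using yc c(1) dd(2) by blast
  qed
qed

text \<open>A disk missing from \<open>disks_of P'\<close> would yield points on either side of its
  boundary that no disk of \<open>P'\<close> separates, whereas exactly one of them belongs to
  \<open>X\<close>.\<close>

lemma disks_of_unique: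
  assumes P: "disk_decomp X P" and P': "disk_decomp X P'"
  shows "disks_of P \<subseteq> disks_of P'"
proof
  fix D assume D: "D \<in> disks_of P"
  let ?B = "disks_of P \<union> disks_of P'"
  have fin: "finite ?B" using disks_of_finite P P' by blast
  have oc: "open_disk B \<or> closed_disk B" if "B \<in> ?B" for B
    using that disks_of_open_or_closed[OF P] disks_of_open_or_closed[OF P'] by blast
  have DB: "D \<in> ?B" using D by blast
  obtain x where x: "x \<in> D" "\<And>B. B \<in> ?B \<Longrightarrow> x \<in> B \<longleftrightarrow> D \<subseteq> B" using generic_points(1)[OF fin oc DB] by auto
  obtain y where y: "y \<notin> D" "\<And>B. B \<in> ?B \<Longrightarrow> y \<in> B \<longleftrightarrow> D \<subset> B" using generic_points(2)[OF fin oc DB] by auto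
  show "D \<in> disks_of P'"
  proof (rule ccontr)
    assume n: "D \<notin> disks_of P'"
    have "x \<in> B \<longleftrightarrow> y \<in> B" if "B \<in> disks_of P'" for B
    proof -
      have "B \<noteq> D" "B \<in> ?B" using n that by blast+
      then show ?thesis using x(2) y(2) by blast
    qed
    then have "x \<in> X \<longleftrightarrow> y \<in> X" by (rule disk_decomp_agree[OF P'])
    moreover have "x \<in> X \<longleftrightarrow> y \<notin> X"
      by (rule disk_decomp_boundary[OF P D x(1) _ y(1)]) (use x(2) y(2) in blast)+
    ultimately show False by blast
  qed
qed

lemma open_disk_galois:
  assumes "\<sigma> \<in> galois_group Qp" "open_disk D"
  shows "open_disk (\<sigma> ` D)"
proof -
  obtain a r where r: "r \<in> av ` (UNIV - {0})" "D = {x. av (x - a) < r}" using assms(2) unfolding open_disk_def by metis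
  have "\<sigma> ` D = {x. av (x - \<sigma> a) < r}" unfolding r(2) by (rule galois_image_balls[OF assms(1)])
  then show ?thesis using r(1) unfolding open_disk_def by metis
qed

lemma closed_disk_galois:
  assumes "\<sigma> \<in> galois_group Qp" "closed_disk D"
  shows "closed_disk (\<sigma> ` D)"
proof -
  obtain a r where r: "r \<in> av ` (UNIV - {0})" "D = {x. av (x - a) \<le> r}" using assms(2) unfolding closed_disk_def by metis
  have "\<sigma> ` D = {x. av (x - \<sigma> a) \<le> r}" unfolding r(2) by (rule galois_image_balls[OF assms(1)])
  then show ?thesis using r(1) unfolding closed_disk_def by metis
qed

lemma disk_decomp_galois:
  assumes s: "\<sigma> \<in> galois_group Qp" and dec: "disk_decomp X P"
  defines "P' \<equiv> (\<lambda>c. (\<sigma> ` fst c, (`) \<sigma> ` snd c)) ` P"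
  shows "disk_decomp (\<sigma> ` X) P'" and "disks_of P' = (`) \<sigma> ` disks_of P"
proof -
  note dd = disk_decompD[OF dec]
  have inj: "inj \<sigma>" using s by (auto simp: galois_group_iff bij_def)
  have hd: "holed_disk (\<sigma> ` fst c, (`) \<sigma> ` snd c) = \<sigma> ` holed_disk c" for c
    unfolding holed_disk_def by (simp add: image_set_diff[OF inj] image_Union)
  show "disks_of P' = (`) \<sigma> ` disks_of P"
    unfolding disks_of_def P'_def by (simp add: image_UN)
  show "disk_decomp (\<sigma> ` X) P'"
    unfolding disk_decomp_def
  proof (intro conjI ballI impI)
    show "finite P'" unfolding P'_def using dd(1) by simp
    show "\<sigma> ` X = (\<Union>c\<in>P'. holed_disk c)" unfolding P'_def dd(2) by (simp add: hd image_UN)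
  next
    fix c assume "c \<in> P'"
    then obtain c0 where c0: "c0 \<in> P" "c = (\<sigma> ` fst c0, (`) \<sigma> ` snd c0)" unfolding P'_def by blast
    show "open_disk (fst c)" using open_disk_galois[OF s dd(3)[OF c0(1)]] c0(2) by simp
    show "finite (snd c)" using dd(4)[OF c0(1)] c0(2) by simp
    show "disjoint (snd c)"
      using dd(5)[OF c0(1)] unfolding c0(2) disjoint_def by (auto simp: image_Int[OF inj, symmetric])
    fix D assume "D \<in> snd c"
    then obtain D0 where D0: "D0 \<in> snd c0" "D = \<sigma> ` D0" using c0(2) by auto
    show "closed_disk D" using closed_disk_galois[OF s dd(6)[OF c0(1) D0(1)]] D0(2) by simp
    show "D \<subset> fst c" using dd(7)[OF c0(1) D0(1)] inj unfolding D0(2) c0(2) by (simp add: psubset_eq inj_image_subset_iff inj_image_eq_iff)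
  next
    fix c c' assume "c \<in> P'" "c' \<in> P'" and ne: "c \<noteq> c'"
    then obtain c0 c0' where c0: "c0 \<in> P" "c = (\<sigma> ` fst c0, (`) \<sigma> ` snd c0)"
      and c0': "c0' \<in> P" "c' = (\<sigma> ` fst c0', (`) \<sigma> ` snd c0')" unfolding P'_def by blast
    have "c0 \<noteq> c0'" using ne c0 c0' by blast
    then have "holed_disk c0 \<inter> holed_disk c0' = {}" using dd(8)[OF c0(1) c0'(1)] by blast
    then show "holed_disk c \<inter> holed_disk c' = {}"
      unfolding c0(2) c0'(2) hd by (simp add: image_Int[OF inj, symmetric])
  qed
qed

text \<open>The transported family decomposes the same set \<open>X\<close>, so
  \<open>disks_of_unique\<close> applies.\<close>

lemma disks_of_galois_stable:
  assumes "\<sigma> \<in> galois_group Qp" "disk_decomp X P" "\<sigma> ` X = X" "D \<in> disks_of P"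
  shows "\<sigma> ` D \<in> disks_of P"
proof -
  let ?P' = "(\<lambda>c. (\<sigma> ` fst c, (`) \<sigma> ` snd c)) ` P"
  have "disk_decomp X ?P'" using disk_decomp_galois(1)[OF assms(1,2)] assms(3) by simp
  from disks_of_unique[OF this assms(2)] show ?thesis
    using disk_decomp_galois(2)[OF assms(1,2)] assms(4) by blast
qed

section \<open>Standard subsets of the affine line\<close>

lemma rational_open_disk_iff: "rational_open_disk av B \<longleftrightarrow> (\<exists>D. open_disk D \<and> B = Affine ` D)"
  unfolding rational_open_disk_def open_disk_def by blast

lemma rational_closed_disk_iff: "rational_closed_disk av B \<longleftrightarrow> (\<exists>D. closed_disk D \<and> B = Affine ` D)"
  unfolding rational_closed_disk_def closed_disk_def by blast

lemma Affine_vimage_image [simp]: "Affine -` (Affine ` D) = D"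
  by auto

text \<open>\<open>complexity\<close> rests on choices made with \<open>SOME\<close>. Building
  \<open>P\<close> from these very choices makes the complexity a sum over its disks without an
  appeal to uniqueness. The count is conditional because positivity is proved later, in terms of a
  bound on the orbit of the disk.\<close>

lemma standard_disk_decomp:
  assumes "standard av (Affine ` X)"
  shows "\<exists>P. disk_decomp X P \<and>
     (\<forall>D\<in>disks_of P. disk_complexity av E (Affine ` D) \<le> complexity av E (Affine ` X)) \<and>
     ((\<forall>D\<in>disks_of P. 1 \<le> disk_complexity av E (Affine ` D)) \<longrightarrow> card (disks_of P) \<le> complexity av E (Affine ` X))"
proof -
  define \<C> where "\<C> = std_components av (Affine ` X)"
  have "standard_decomp av (Affine ` X) \<C>"
    unfolding \<C>_def std_components_def using assms unfolding standard_def by (rule someI_ex)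
  then have \<C>: "finite \<C>" "disjoint \<C>" "\<And>C. C \<in> \<C> \<Longrightarrow> conn_standard av C" "Affine ` X = \<Union>\<C>"
    unfolding standard_decomp_def by auto
  define ch where "ch C = (SOME (D0, \<D>). conn_decomp av C D0 \<D>)" for C
  have ch: "conn_decomp av C (fst (ch C)) (snd (ch C))" if C: "C \<in> \<C>" for C
  proof -
    obtain D0 \<D> where "conn_decomp av C D0 \<D>" using \<C>(3)[OF C] unfolding conn_standard_def by blast
    then have "case (D0, \<D>) of (D0, \<D>) \<Rightarrow> conn_decomp av C D0 \<D>" by simp
    then have "case ch C of (D0, \<D>) \<Rightarrow> conn_decomp av C D0 \<D>" unfolding ch_def by (rule someI)
    then show ?thesis by (simp add: case_prod_unfold)
  qed
  have outer: "\<exists>D. open_disk D \<and> fst (ch C) = Affine ` D" if C: "C \<in> \<C>" for C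
  proof -
    \<comment> \<open>Holes are affine, so an outer part equal to \<open>UNIV\<close> would put
      \<open>Pt_infinity\<close> into an affine set.\<close>
    have "fst (ch C) \<noteq> UNIV"
    proof
      assume "fst (ch C) = UNIV"
      moreover have "Pt_infinity \<notin> \<Union> (snd (ch C))"
        using ch[OF C] unfolding conn_decomp_def rational_closed_disk_iff by auto
      ultimately have "Pt_infinity \<in> C" using ch[OF C] unfolding conn_decomp_def by blast
      then have "Pt_infinity \<in> Affine ` X" using C \<C>(4) by blast
      then show False by blast
    qed
    then show ?thesis using ch[OF C] unfolding conn_decomp_def rational_open_disk_iff by blast
  qed
  have holes: "\<exists>D. closed_disk D \<and> B = Affine ` D" if "C \<in> \<C>" "B \<in> snd (ch C)" for C B
    using ch[OF that(1)] that(2) unfolding conn_decomp_def rational_closed_disk_iff by blast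
  define f where "f C = (Affine -` fst (ch C), (-`) Affine ` snd (ch C))" for C
  define P where "P = f ` \<C>"
  have fst_f: "Affine ` fst (f C) = fst (ch C)" if "C \<in> \<C>" for C
    using outer[OF that] by (auto simp: f_def)
  have im: "Affine ` (Affine -` B) = B" if "C \<in> \<C>" "B \<in> snd (ch C)" for C B
    using holes[OF that] by auto
  have hd: "holed_disk (f C) = Affine -` C" if "C \<in> \<C>" for C
  proof -
    have "C = fst (ch C) - \<Union> (snd (ch C))" using ch[OF that] unfolding conn_decomp_def by blast
    then show ?thesis unfolding holed_disk_def f_def by auto
  qed
  have dis: "c = c'" if cc: "c \<in> P" "c' \<in> P" "holed_disk c \<inter> holed_disk c' \<noteq> {}" for c c'
  proof -
    obtain C C' where C: "C \<in> \<C>" "C' \<in> \<C>" "c = f C" "c' = f C'" using cc(1,2) unfolding P_def by blast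
    have "C \<inter> C' \<noteq> {}" using cc(3) hd C by auto
    then have "C = C'" using \<C>(2) C(1,2) unfolding disjoint_def by blast
    then show ?thesis using C by simp
  qed
  have dec: "disk_decomp X P"
    unfolding disk_decomp_def
  proof (intro conjI ballI impI)
    show "finite P" unfolding P_def using \<C>(1) by simp
    have "X = Affine -` (Affine ` X)" by simp
    also have "\<dots> = (\<Union>C\<in>\<C>. Affine -` C)" unfolding \<C>(4) by auto
    also have "\<dots> = (\<Union>C\<in>\<C>. holed_disk (f C))" using hd by simp
    finally show "X = (\<Union>c\<in>P. holed_disk c)" unfolding P_def by simp
  next
    fix c assume "c \<in> P"
    then obtain C where C: "C \<in> \<C>" "c = f C" unfolding P_def by blast
    show "open_disk (fst c)" using outer[OF C(1)] C(2) by (auto simp: f_def)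
    show "finite (snd c)" using ch[OF C(1)] C(2) by (simp add: f_def conn_decomp_def)
    show "disjoint (snd c)"
      unfolding disjoint_def
    proof (intro ballI impI)
      fix A' B' assume "A' \<in> snd c" "B' \<in> snd c" and ne: "A' \<noteq> B'"
      then obtain A B where AB: "A \<in> snd (ch C)" "A' = Affine -` A" "B \<in> snd (ch C)" "B' = Affine -` B"
        using C(2) by (auto simp: f_def)
      have "disjoint (snd (ch C))" using ch[OF C(1)] by (simp add: conn_decomp_def)
      moreover have "A \<noteq> B" using ne AB by blast
      ultimately have "A \<inter> B = {}" using AB(1,3) unfolding disjoint_def by blast
      then show "A' \<inter> B' = {}" unfolding AB(2,4) vimage_Int[symmetric] by simp
    qed
    fix D assume "D \<in> snd c"
    then obtain B where B: "B \<in> snd (ch C)" "D = Affine -` B" using C(2) by (auto simp: f_def)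
    show "closed_disk D" using holes[OF C(1) B(1)] B(2) by auto
    have "B \<subset> fst (ch C)" using ch[OF C(1)] B(1) unfolding conn_decomp_def by blast
    then have "Affine ` D \<subset> Affine ` fst c" using im[OF C(1) B(1)] fst_f[OF C(1)] B(2) C(2) by simp
    then show "D \<subset> fst c" by blast
  next
    fix c c' assume "c \<in> P" "c' \<in> P" "c \<noteq> c'"
    then show "holed_disk c \<inter> holed_disk c' = {}" using dis by blast
  qed
  define g where "g B = disk_complexity av E B" for B
  have cC: "conn_complexity av E C = g (fst (ch C)) + (\<Sum>B\<in>snd (ch C). g B)" for C
    unfolding conn_complexity_def ch_def g_def by (simp add: Let_def case_prod_unfold)
  have compl: "complexity av E (Affine ` X) = (\<Sum>C\<in>\<C>. g (fst (ch C)) + (\<Sum>B\<in>snd (ch C). g B))"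
    unfolding complexity_def \<C>_def[symmetric] by (simp add: cC)
  have finh: "finite (snd (ch C))" if "C \<in> \<C>" for C using ch[OF that] by (simp add: conn_decomp_def)
  have disks: "disks_of P = (\<Union>C\<in>\<C>. (-`) Affine ` insert (fst (ch C)) (snd (ch C)))"
    unfolding disks_of_def P_def f_def by simp
  have each: "g (Affine ` D) \<le> complexity av E (Affine ` X)" if D: "D \<in> disks_of P" for D
  proof -
    obtain C B where C: "C \<in> \<C>" "B \<in> insert (fst (ch C)) (snd (ch C))" "D = Affine -` B"
      using D unfolding disks by blast
    have "Affine ` D = B" using C im[OF C(1)] outer[OF C(1)] by auto
    moreover have "g B \<le> g (fst (ch C)) + (\<Sum>B\<in>snd (ch C). g B)"
    proof (cases "B = fst (ch C)")
      case False
      then have "g B \<le> (\<Sum>B\<in>snd (ch C). g B)" using C(2) finh[OF C(1)] by (intro member_le_sum) auto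
      then show ?thesis by simp
    qed simp
    moreover have "\<dots> \<le> complexity av E (Affine ` X)"
      unfolding compl by (rule member_le_sum[OF C(1), of "\<lambda>C. g (fst (ch C)) + (\<Sum>B\<in>snd (ch C). g B)"]) (use \<C>(1) in auto)
    ultimately show ?thesis by simp
  qed
  have count: "card (disks_of P) \<le> complexity av E (Affine ` X)" if one: "\<And>D. D \<in> disks_of P \<Longrightarrow> 1 \<le> g (Affine ` D)"
  proof -
    have g1: "1 \<le> g B" if "C \<in> \<C>" "B \<in> insert (fst (ch C)) (snd (ch C))" for C B
    proof -
      have "Affine ` (Affine -` B) = B" using that im[OF that(1)] outer[OF that(1)] by auto
      moreover have "Affine -` B \<in> disks_of P" unfolding disks using that by blast
      ultimately show ?thesis using one by metis
    qed
    have "card (disks_of P) \<le> (\<Sum>C\<in>\<C>. card ((-`) Affine ` insert (fst (ch C)) (snd (ch C))))"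
      unfolding disks by (rule card_UN_le[OF \<C>(1)])
    also have "\<dots> \<le> (\<Sum>C\<in>\<C>. g (fst (ch C)) + (\<Sum>B\<in>snd (ch C). g B))"
    proof (rule sum_mono)
      fix C assume C: "C \<in> \<C>"
      have "card ((-`) Affine ` insert (fst (ch C)) (snd (ch C))) \<le> card (insert (fst (ch C)) (snd (ch C)))"
        using finh[OF C] by (intro card_image_le) simp
      also have "\<dots> \<le> 1 + card (snd (ch C))" using card_insert_le_m1[of "Suc (card (snd (ch C)))" "snd (ch C)"] by simp
      also have "\<dots> \<le> g (fst (ch C)) + (\<Sum>B\<in>snd (ch C). g B)"
      proof -
        have "card (snd (ch C)) = (\<Sum>B\<in>snd (ch C). 1)" by simp
        also have "\<dots> \<le> (\<Sum>B\<in>snd (ch C). g B)" using g1[OF C] by (intro sum_mono) blast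
        finally show ?thesis using g1[OF C, of "fst (ch C)"] by simp
      qed
      finally show "card ((-`) Affine ` insert (fst (ch C)) (snd (ch C))) \<le> g (fst (ch C)) + (\<Sum>B\<in>snd (ch C). g B)" .
    qed
    finally show ?thesis unfolding compl .
  qed
  show ?thesis using dec each count unfolding g_def by blast
qed

end

section \<open>Finite extensions, ramification and complexity\<close>

context padic_closure
begin

lemma p_power_exp_dvd: "p_power_exp N r \<Longrightarrow> N dvd M \<Longrightarrow> p_power_exp M r"
  using p_power_exp_mult by (auto elim!: dvdE)

lemma p_power_exp_power: "p_power_exp N (r ^ i) \<Longrightarrow> p_power_exp (i * N) r"
  by (simp add: p_power_exp_def power_mult)

text \<open>The factorial serves as a common denominator for all degrees up to
  \<open>\<nu>\<close>.\<close>

lemma p_power_exp_of_card_orb: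
  assumes "x \<noteq> 0" "card (orb x) \<le> \<nu>"
  shows "p_power_exp (fact \<nu>) (av x)"
proof (rule p_power_exp_dvd)
  show "p_power_exp (card (orb x)) (av x)" unfolding p_power_exp_def by (rule av_value_power_orb[OF assms(1)])
  show "card (orb x) dvd fact \<nu>" using assms(2) card_orb_pos[of x] by (intro dvd_fact) auto
qed

lemma fin_ext_spanning_list:
  assumes "fin_ext F K"
  obtains us where "set us \<subseteq> K"
    and "\<And>x. x \<in> K \<Longrightarrow> \<exists>c. (\<forall>i. c i \<in> F) \<and> x = (\<Sum>i<length us. c i * us ! i)"
  using finite_dimension_spanning_list[of F K] assms fin_ext_type_subfield[OF assms] unfolding fin_ext_def by blast

lemma fin_ext_galois_determined:
  assumes "fin_ext Qp E"
  obtains A where "finite A" "A \<subseteq> E" "\<And>\<sigma>. \<sigma> \<in> galois_group Qp \<Longrightarrow> (\<And>a. a \<in> A \<Longrightarrow> \<sigma> a = a) \<Longrightarrow> \<sigma> \<in> galois_group E"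
proof -
  obtain us where us: "set us \<subseteq> E"
    "\<And>x. x \<in> E \<Longrightarrow> \<exists>c. (\<forall>i. c i \<in> Qp) \<and> x = (\<Sum>i<length us. c i * us ! i)"
    using fin_ext_spanning_list[OF assms] by metis
  have "\<sigma> \<in> galois_group E" if s: "\<sigma> \<in> galois_group Qp" and fix_us: "\<And>a. a \<in> set us \<Longrightarrow> \<sigma> a = a" for \<sigma>
  proof -
    interpret field_auto \<sigma> using s by (rule galois_group_field_auto)
    have "\<sigma> x = x" if x: "x \<in> E" for x
    proof -
      obtain c where c: "\<forall>i. c i \<in> Qp" "x = (\<Sum>i<length us. c i * us ! i)" using us(2)[OF x] by metis
      show ?thesis unfolding c(2) hom_sum hom_mult
        using galois_group_fix[OF s] c(1) fix_us by (intro sum.cong) auto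
    qed
    then show ?thesis using s by (simp add: galois_group_iff)
  qed
  then show ?thesis using that[of "set us"] us(1) by blast
qed

section \<open>Normalization of the valuation\<close>

lemma ln_p_pos: "0 < ln (real p)" using p_gt_1 by simp

text \<open>\<open>val_scale\<close> is a definite description, so existence and uniqueness come
  first. The logarithms of the values form a group of integral multiples of \<open>ln p / N\<close>,
  nonzero because of the value of \<open>p\<close>. Its least positive element \<open>e\<close>
  generates it, and the scale is \<open>1 / e\<close>.\<close>

lemma val_scale_pos:
  assumes "type_subfield E" "Qp \<subseteq> E" "0 < N" "\<And>x. x \<in> E \<Longrightarrow> x \<noteq> 0 \<Longrightarrow> p_power_exp N (av x)"
  shows "0 < val_scale av E"
proof -
  interpret E: type_subfield E by fact
  define S where "S = (\<lambda>x. - ln (av x)) ` (E - {0})"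
  define \<epsilon> where "\<epsilon> = ln (real p) / real N"
  have \<epsilon>: "0 < \<epsilon>" using ln_p_pos assms(3) by (simp add: \<epsilon>_def)
  have S_int: "\<exists>z :: int. s = of_int z * \<epsilon>" if s: "s \<in> S" for s
  proof -
    obtain x where x: "x \<in> E" "x \<noteq> 0" "s = - ln (av x)" using s unfolding S_def by blast
    obtain z :: int where z: "av x ^ N = real p powi z" using assms(4)[OF x(1,2)] by (auto simp: p_power_exp_def)
    have "real N * ln (av x) = of_int z * ln (real p)"
    proof -
      have "real p powi z = real p powr of_int z" using p_gt_1 by (subst powr_real_of_int') auto
      then have "ln (real p powi z) = of_int z * ln (real p)" using p_gt_1 by (simp add: ln_powr)
      then show ?thesis using arg_cong[OF z, of ln] x(2) by (simp add: ln_realpow av_pos_iff)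
    qed
    then have "s = of_int (- z) * \<epsilon>" using x(3) assms(3) by (simp add: \<epsilon>_def field_simps)
    then show ?thesis by blast
  qed
  have S_diff: "s - t \<in> S" if st: "s \<in> S" "t \<in> S" for s t
  proof -
    obtain x y where xy: "x \<in> E" "x \<noteq> 0" "s = - ln (av x)" "y \<in> E" "y \<noteq> 0" "t = - ln (av y)"
      using st unfolding S_def by blast
    have "s - t = - ln (av (x / y))" using xy by (simp add: av_divide ln_div av_eq_0_iff)
    moreover have "x / y \<in> E - {0}" using xy E.divide_mem by simp
    ultimately show ?thesis unfolding S_def by blast
  qed
  have S_scale: "of_int z * s \<in> S" if s: "s \<in> S" for s and z :: int
  proof -
    have S0: "0 \<in> S" using S_diff[OF s s] by simp
    have nat: "of_nat n * s \<in> S" for n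
    proof (induction n)
      case (Suc n)
      have "of_nat n * s - (0 - s) \<in> S" by (intro S_diff Suc S0 s)
      then show ?case by (simp add: algebra_simps)
    qed (simp add: S0)
    show ?thesis
    proof (cases z rule: int_cases2)
      case (nonneg n)
      then show ?thesis using nat by simp
    next
      case (nonpos n)
      then show ?thesis using S_diff[OF S0 nat[of n]] by simp
    qed
  qed
  define T where "T n \<longleftrightarrow> 0 < n \<and> real n * \<epsilon> \<in> S" for n
  have "T N"
  proof -
    have "- ln (av (of_nat p)) = real N * \<epsilon>" using assms(3) p_gt_1 by (simp add: av_p ln_div \<epsilon>_def)
    moreover have "of_nat p \<in> E - {0}" using E.of_nat_mem p_gt_1 by simp
    ultimately show ?thesis using assms(3) unfolding T_def S_def by (metis image_eqI)
  qed
  define d where "d = (LEAST n. T n)"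
  have d: "T d" "\<And>n. T n \<Longrightarrow> d \<le> n" unfolding d_def using \<open>T N\<close> by (auto intro: LeastI Least_le)
  define e where "e = real d * \<epsilon>"
  have e: "0 < e" "e \<in> S" using d(1) \<epsilon> by (auto simp: T_def e_def)
  have S_eq: "S = range (\<lambda>z :: int. of_int z * e)"
  proof
    show "range (\<lambda>z :: int. of_int z * e) \<subseteq> S" using S_scale[OF e(2)] by blast
    show "S \<subseteq> range (\<lambda>z :: int. of_int z * e)"
    proof
      fix s assume s: "s \<in> S"
      then obtain z :: int where z: "s = of_int z * \<epsilon>" using S_int by blast
      define q r where "q = z div int d" "r = z mod int d"
      have dpos: "0 < int d" using d(1) by (simp add: T_def)
      have zr: "z = q * int d + r" "0 \<le> r" "r < int d" using dpos by (auto simp: q_r_def)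
      have "s - of_int q * e \<in> S" by (intro S_diff s S_scale e(2))
      also have "s - of_int q * e = of_int r * \<epsilon>" unfolding z zr(1) e_def by (simp add: algebra_simps)
      finally have r: "real (nat r) * \<epsilon> \<in> S" using zr(2) by simp
      have "r = 0"
      proof (rule ccontr)
        assume "r \<noteq> 0"
        then have "T (nat r)" using r zr(2) by (simp add: T_def)
        then show False using d(2)[of "nat r"] zr by simp
      qed
      then have "s = of_int q * e" unfolding z zr(1) e_def by simp
      then show "s \<in> range (\<lambda>z :: int. of_int z * e)" by blast
    qed
  qed
  have im: "(\<lambda>x. - c * ln (av x)) ` (E - {0}) = (\<lambda>s. c * s) ` S" for c :: real
    unfolding S_def by (simp add: image_image)
  have "val_scale av E = 1 / e"
    unfolding val_scale_def im
  proof (rule the_equality)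
    show "0 < 1 / e \<and> (\<lambda>s. 1 / e * s) ` S = \<int>"
      unfolding S_eq image_image Ints_def using e(1) by simp
    \<comment> \<open>Uniqueness: \<open>c * e\<close> is a positive integer dividing 1.\<close>
    fix c :: real assume c: "0 < c \<and> (\<lambda>s. c * s) ` S = \<int>"
    have "c * e \<in> \<int>" using c e(2) by blast
    then obtain k :: int where k: "c * e = of_int k" by (auto elim: Ints_cases)
    have "(1::real) \<in> (\<lambda>s. c * s) ` S" using c by simp
    then obtain z :: int where z: "1 = c * (of_int z * e)" unfolding S_eq by blast
    have "of_int (k * z) = c * e * of_int z" unfolding k by simp
    also have "\<dots> = 1" using z by (simp add: mult_ac)
    finally have "of_int (k * z) = (1 :: real)" .
    then have "k * z = 1" by linarith
    moreover have "0 < k" using c e(1) k by (metis mult_pos_pos of_int_0_less_iff)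
    ultimately have "k = 1" using pos_zmult_eq_1_iff by blast
    then show "c = 1 / e" using k e(1) by (simp add: field_simps)
  qed
  then show ?thesis using e(1) by simp
qed

text \<open>The minus sign in \<open>val\<close> reverses inequalities; \<open>y = 0\<close>, of
  infinite valuation, falls on the side of small absolute values.\<close>

lemma val_ge_iff:
  assumes "0 < val_scale av E" "0 < n" "b \<noteq> 0"
  shows "val av E b \<le> ereal (real n) * val av E y \<longleftrightarrow> av y ^ n \<le> av b"
    and "val av E b < ereal (real n) * val av E y \<longleftrightarrow> av y ^ n < av b"
proof -
  let ?c = "val_scale av E"
  have b: "0 < av b" using assms(3) by (simp add: av_pos_iff)
  have "(val av E b \<le> ereal (real n) * val av E y \<longleftrightarrow> av y ^ n \<le> av b) \<and>
    (val av E b < ereal (real n) * val av E y \<longleftrightarrow> av y ^ n < av b)"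
  proof (cases "y = 0")
    case True
    then show ?thesis using assms b by (simp add: val_def zero_power less_imp_le)
  next
    case False
    then have y: "0 < av y" by (simp add: av_pos_iff)
    have "ereal (real n) * val av E y = ereal (- ?c * ln (av y ^ n))"
      using False y by (simp add: val_def ln_realpow)
    moreover have "val av E b = ereal (- ?c * ln (av b))" using assms(3) by (simp add: val_def)
    ultimately show ?thesis using assms(1) y b by simp
  qed
  then show "val av E b \<le> ereal (real n) * val av E y \<longleftrightarrow> av y ^ n \<le> av b"
    "val av E b < ereal (real n) * val av E y \<longleftrightarrow> av y ^ n < av b" by blast+
qed

section \<open>Ramification indices and denominators of values\<close>

lemma ram_index_eq:
  "ram_index av F K = card ((\<lambda>r. (\<lambda>h. h * r) ` av ` (F - {0})) ` av ` (K - {0}))"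
proof -
  have "rcosets\<^bsub>value_group av K\<^esub> carrier (value_group av F)
      = (\<lambda>r. (\<lambda>h. h * r) ` av ` (F - {0})) ` av ` (K - {0})"
    unfolding RCOSETS_def r_coset_def value_group_def by auto
  then show ?thesis by (simp add: ram_index_def)
qed

lemma value_coset_eq:
  assumes "type_subfield F" "u \<in> av ` (F - {0})"
  shows "(\<lambda>h. h * (u * r)) ` av ` (F - {0}) = (\<lambda>h. h * r) ` av ` (F - {0})"
proof -
  interpret type_subfield F by fact
  obtain y where y: "y \<in> F" "y \<noteq> 0" "u = av y" using assms(2) by blast
  have "(\<lambda>h. h * u) ` av ` (F - {0}) = av ` (F - {0})"
  proof (intro equalityI subsetI)
    fix v assume "v \<in> (\<lambda>h. h * u) ` av ` (F - {0})"
    then obtain x where x: "x \<in> F" "x \<noteq> 0" "v = av x * u" by blast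
    then have "v = av (x * y)" "x * y \<in> F - {0}" using y by (simp_all add: av_mult mult_mem)
    then show "v \<in> av ` (F - {0})" by blast
  next
    fix v assume "v \<in> av ` (F - {0})"
    then obtain x where x: "x \<in> F" "x \<noteq> 0" "v = av x" by blast
    have "v = av (x / y) * u" using x y av_pos_iff[of y] by (simp add: av_divide)
    moreover have "x / y \<in> F - {0}" using x y by (simp add: divide_mem)
    ultimately show "v \<in> (\<lambda>h. h * u) ` av ` (F - {0})" by blast
  qed
  then have "(\<lambda>h. h * r) ` av ` (F - {0}) = (\<lambda>h. h * r) ` (\<lambda>h. h * u) ` av ` (F - {0})" by simp
  also have "\<dots> = (\<lambda>h. h * (u * r)) ` av ` (F - {0})" unfolding image_image by (simp add: mult.assoc)
  finally show ?thesis by simp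
qed

text \<open>Two of the powers of \<open>av x\<close> with exponents from 0 up to the index lie in
  one coset, and their quotient is a value of \<open>F\<close>. The index is finite because its
  \<open>card\<close> is positive.\<close>

lemma ram_index_power:
  assumes "type_subfield F" "type_subfield K" "1 \<le> ram_index av F K" "x \<in> K" "x \<noteq> 0"
  shows "\<exists>i. 1 \<le> i \<and> i \<le> ram_index av F K \<and> av x ^ i \<in> av ` (F - {0})"
proof -
  interpret F: type_subfield F by fact
  interpret K: type_subfield K by fact
  let ?s = "ram_index av F K"
  let ?cos = "\<lambda>r. (\<lambda>h. h * r) ` av ` (F - {0})"
  have card: "card (?cos ` av ` (K - {0})) = ?s" by (simp add: ram_index_eq)
  then have fin: "finite (?cos ` av ` (K - {0}))" using assms(3) by (metis card.infinite not_one_le_zero)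
  have "av x ^ i \<in> av ` (K - {0})" for i
    using K.power_mem[OF assms(4), of i] assms(5) by (intro image_eqI[of _ _ "x ^ i"]) (auto simp: av_power)
  then have sub: "(\<lambda>i. ?cos (av x ^ i)) ` {..?s} \<subseteq> ?cos ` av ` (K - {0})" by blast
  have "\<not> inj_on (\<lambda>i. ?cos (av x ^ i)) {..?s}"
  proof
    assume "inj_on (\<lambda>i. ?cos (av x ^ i)) {..?s}"
    from card_inj_on_le[OF this sub fin] show False using card by simp
  qed
  then obtain i j where ij: "i < j" "j \<le> ?s" "?cos (av x ^ i) = ?cos (av x ^ j)"
    unfolding inj_on_def by (metis atMost_iff linorder_neqE_nat)
  have "av 1 \<in> av ` (F - {0})" by (rule imageI) (simp add: F.one_mem)
  then have "1 \<in> av ` (F - {0})" by simp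
  then have "1 * av x ^ j \<in> ?cos (av x ^ j)" by (rule imageI)
  then have "av x ^ j \<in> ?cos (av x ^ j)" by simp
  then have "av x ^ j \<in> ?cos (av x ^ i)" using ij(3) by simp
  then obtain h where h: "h \<in> av ` (F - {0})" "av x ^ j = h * av x ^ i" by blast
  have "av x ^ j = av x ^ (j - i) * av x ^ i" using ij(1) by (simp flip: power_add)
  then have "av x ^ (j - i) = h" using h(2) assms(5) av_pos_iff[of x] by simp
  then show ?thesis using h(1) ij by (intro exI[of _ "j - i"]) auto
qed

text \<open>\<open>card\<close> of an infinite set is 0, so finiteness is at stake. If the exponents
  of \<open>r ^ N\<close> and \<open>r' ^ N\<close> agree modulo \<open>N\<close>, then
  \<open>r / r'\<close> is a power of \<open>p\<close>, hence a value of \<open>F\<close>; this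
  leaves at most \<open>N\<close> cosets.\<close>

lemma ram_index_pos:
  assumes "type_subfield F" "Qp \<subseteq> F" "type_subfield K" "0 < N"
    and vals: "\<And>x. x \<in> K \<Longrightarrow> x \<noteq> 0 \<Longrightarrow> p_power_exp N (av x)"
  shows "1 \<le> ram_index av F K"
proof -
  interpret K: type_subfield K by fact
  let ?cos = "\<lambda>r. (\<lambda>h. h * r) ` av ` (F - {0})"
  have "\<forall>r\<in>av ` (K - {0}). \<exists>z :: int. r ^ N = real p powi z" using vals by (auto simp: p_power_exp_def)
  then obtain z :: "real \<Rightarrow> int" where z: "\<And>r. r \<in> av ` (K - {0}) \<Longrightarrow> r ^ N = real p powi z r" by metis
  have "finite ((\<lambda>r. z r mod int N) ` av ` (K - {0}))"
    by (rule finite_subset[of _ "{0..<int N}"]) (use assms(4) in auto)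
  then have "finite (?cos ` av ` (K - {0}))"
  proof (rule image_factor(1))
    fix r r' assume r: "r \<in> av ` (K - {0})" "r' \<in> av ` (K - {0})" "z r mod int N = z r' mod int N"
    then obtain q where q: "z r = z r' + int N * q" using mod_eq_dvd_iff by (metis add.commute diff_add_cancel dvdE)
    have pos: "0 < r" "0 < r'" using r av_pos_iff by auto
    have "r ^ N = (real p powi q * r') ^ N"
      using z[OF r(1)] z[OF r(2)] p_gt_1
      by (simp add: q power_mult_distrib power_int_add power_int_mult power_int_power mult.commute)
    then have eq: "r = real p powi q * r'"
      using power_eq_iff_eq_base[of N r "real p powi q * r'"] assms(4) pos p_gt_1 by simp
    have "av (of_nat p powi (- q)) = real p powi q"
      unfolding av_powi av_p by (simp add: power_int_minus power_int_divide_distrib)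
    moreover have "of_nat p powi (- q) \<in> F - {0}"
      using assms(2) p_gt_1 by (auto simp: power_int_def intro!: subsetD[OF assms(2)] Qp.power_mem Qp.inverse_mem Qp.of_nat_mem)
    ultimately have "real p powi q \<in> av ` (F - {0})" by (metis image_eqI)
    then show "?cos r = ?cos r'" unfolding eq by (rule value_coset_eq[OF assms(1)])
  qed
  moreover have "?cos ` av ` (K - {0}) \<noteq> {}" using K.one_mem by (metis DiffI empty_iff image_is_empty singletonD zero_neq_one)
  ultimately have "0 < card (?cos ` av ` (K - {0}))" by (simp add: card_gt_0_iff)
  then show ?thesis by (simp add: ram_index_eq)
qed

text \<open>An element of \<open>K\<close> is determined by its coefficients in \<open>F\<close> and
  the spanning list, so its orbit is bounded and one factorial is a denominator for all
  values.\<close>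

lemma fin_ext_p_power_exp:
  assumes "fin_ext F K" "\<And>x. x \<in> F \<Longrightarrow> card (orb x) \<le> \<nu>"
  shows "\<exists>N>0. \<forall>x\<in>K. x \<noteq> 0 \<longrightarrow> p_power_exp N (av x)"
proof -
  obtain us where us: "set us \<subseteq> K"
    "\<And>x. x \<in> K \<Longrightarrow> \<exists>c. (\<forall>i. c i \<in> F) \<and> x = (\<Sum>i<length us. c i * us ! i)"
    using fin_ext_spanning_list[OF assms(1)] by metis
  have "0 \<in> F" using fin_ext_type_subfield[OF assms(1)] type_subfield.zero_mem by blast
  then have \<nu>: "1 \<le> \<nu>" using assms(2)[of 0] card_orb_pos[of 0] by linarith
  define M where "M = \<nu> ^ length us * (\<Prod>a\<in>set us. card (orb a))"
  have "card (orb x) \<le> M" if x: "x \<in> K" for x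
  proof -
    obtain c where c: "\<forall>i. c i \<in> F" "x = (\<Sum>i<length us. c i * us ! i)" using us(2)[OF x] by metis
    let ?C = "c ` {..<length us}"
    have "card (orb x) \<le> (\<Prod>a\<in>?C \<union> set us. card (orb a))"
    proof (rule card_orb_determined)
      fix \<sigma> \<tau> assume st: "\<sigma> \<in> galois_group Qp" "\<tau> \<in> galois_group Qp" "\<And>a. a \<in> ?C \<union> set us \<Longrightarrow> \<sigma> a = \<tau> a"
      interpret s: field_auto \<sigma> using st(1) by (rule galois_group_field_auto)
      interpret t: field_auto \<tau> using st(2) by (rule galois_group_field_auto)
      show "\<sigma> x = \<tau> x" unfolding c(2) s.hom_sum t.hom_sum s.hom_mult t.hom_mult
        using st(3) by (intro sum.cong) auto
    qed simp
    also have "\<dots> = (\<Prod>a\<in>?C - set us. card (orb a)) * (\<Prod>a\<in>set us. card (orb a))"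
      by (subst prod.union_disjoint[symmetric]) (auto intro!: prod.cong)
    also have "(\<Prod>a\<in>?C - set us. card (orb a)) \<le> \<nu> ^ length us"
    proof -
      have "(\<Prod>a\<in>?C - set us. card (orb a)) \<le> (\<Prod>a\<in>?C - set us. \<nu>)"
        by (intro prod_mono) (use assms(2) c(1) in auto)
      also have "\<dots> = \<nu> ^ card (?C - set us)" by simp
      also have "\<dots> \<le> \<nu> ^ length us"
      proof (rule power_increasing[OF _ \<nu>])
        have "card (?C - set us) \<le> card ?C" by (rule card_mono) auto
        also have "\<dots> \<le> length us" using card_image_le[of "{..<length us}" c] by simp
        finally show "card (?C - set us) \<le> length us" .
      qed
      finally show ?thesis .
    qed
    finally show ?thesis by (simp add: M_def)
  qed
  then have "\<forall>x\<in>K. x \<noteq> 0 \<longrightarrow> p_power_exp (fact M) (av x)" using p_power_exp_of_card_orb by blast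
  then show ?thesis by (intro exI[of _ "fact M"]) simp
qed


lemma open_disk_recenter:
  assumes "open_disk D" "a \<in> D"
  shows "\<exists>c. c \<noteq> 0 \<and> D = {x. av (x - a) < av c}"
proof -
  obtain b c where "c \<noteq> 0" "D = {x. av (x - b) < av c}" using assms(1) by (auto simp: open_disk_def)
  then show ?thesis using open_ball_recenter[of a b "av c"] assms(2) by (intro exI[of _ c]) simp
qed

lemma closed_disk_recenter:
  assumes "closed_disk D" "a \<in> D"
  shows "\<exists>c. c \<noteq> 0 \<and> D = {x. av (x - a) \<le> av c}"
proof -
  obtain b c where "c \<noteq> 0" "D = {x. av (x - b) \<le> av c}" using assms(1) by (auto simp: closed_disk_def)
  then show ?thesis using ball_recenter[of a b "av c"] assms(2) by (intro exI[of _ c]) simp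
qed

text \<open>Serves to exclude \<open>b = 0\<close> from the description of a disk by
  valuations.\<close>

lemma is_disk_not_singleton:
  assumes "is_disk D"
  shows "D \<noteq> {a}"
proof
  assume D: "D = {a}"
  then obtain r where r: "0 < r" "D = {x. av (x - a) \<le> r} \<or> D = {x. av (x - a) < r}"
    using disk_recenter[OF assms, of a] by blast
  obtain k where k: "(1 / real p) ^ k < r" using real_arch_pow_inv[of r "1 / real p"] r(1) p_gt_1 by auto
  have "a + of_nat p ^ k \<in> D" using r(2) k by (auto simp: av_p_power)
  moreover have "of_nat p ^ k \<noteq> (0 :: 'a)" using p_gt_1 by simp
  ultimately show False using D by simp
qed

lemma map_proj_line_Affine_image: "map_proj_line \<sigma> ` Affine ` D = Affine ` \<sigma> ` D"
  by (auto simp: image_image)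

lemma Affine_image_eq_iff: "Affine ` C = Affine ` D \<longleftrightarrow> C = D"
  by (rule inj_image_eq_iff) (simp add: inj_on_def)

lemma field_of_def_Affine:
  "field_of_def E (Affine ` D) = fixed_field {\<sigma> \<in> galois_group E. \<sigma> ` D = D}"
  unfolding field_of_def_def set_stabilizer_def fixed_field_def
  by (simp add: map_proj_line_Affine_image Affine_image_eq_iff)

section \<open>A single disk with few conjugates over \<open>E\<close>\<close>

context
  fixes E :: "'a set" and A :: "'a set" and D :: "'a set" and k :: nat
  assumes E: "fin_ext Qp E" and A: "finite A" "\<forall>\<sigma>\<in>galois_group Qp. (\<forall>a\<in>A. \<sigma> a = a) \<longrightarrow> \<sigma> \<in> galois_group E"
    and D: "open_disk D \<or> closed_disk D" and k: "card ((\<lambda>\<sigma>. \<sigma> ` D) ` galois_group E) \<le> k"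
begin

private abbreviation "disk_field \<equiv> field_of_def E (Affine ` D)"

private abbreviation "deg_bound \<equiv> (\<Prod>a\<in>A. card (orb a)) * k"

private lemma QpE: "Qp \<subseteq> E" "type_subfield E" using fin_ext_type_subfield[OF E] by blast+

private lemma galois_E_Qp: "galois_group E \<subseteq> galois_group Qp" by (rule galois_group_antimono[OF QpE(1)])

private lemma disk_D: "is_disk D" using D open_disk_is_disk closed_disk_is_disk by blast

private lemma finite_orbit_E: "finite ((\<lambda>\<sigma>. \<sigma> ` D) ` galois_group E)"
  by (rule finite_disk_orbit[OF disk_D galois_E_Qp])

lemma card_disk_orbit_Qp: "card ((\<lambda>\<sigma>. \<sigma> ` D) ` galois_group Qp) \<le> deg_bound"
proof -
  have "card ((\<lambda>\<sigma>. \<sigma> ` D) ` galois_group Qp) \<le> (\<Prod>a\<in>A. card (orb a)) * card ((\<lambda>\<sigma>. \<sigma> ` D) ` galois_group E)"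
  proof (rule card_galois_image_le[OF A(1)])
    show "(\<sigma> \<circ> \<tau>) ` D = \<sigma> ` \<tau> ` D" for \<sigma> \<tau> by (rule image_comp[symmetric])
  qed (use A(2) finite_orbit_E in auto)
  also have "\<dots> \<le> deg_bound" by (rule mult_left_mono[OF k]) simp
  finally show ?thesis .
qed

lemma disk_field_subfield: "type_subfield disk_field" "E \<subseteq> disk_field" "Qp \<subseteq> disk_field"
proof -
  show "type_subfield disk_field" unfolding field_of_def_Affine by (rule fixed_field_type_subfield[of _ E]) blast
  show "E \<subseteq> disk_field" unfolding field_of_def_Affine by (auto simp: fixed_field_def galois_group_fix)
  then show "Qp \<subseteq> disk_field" using QpE(1) by blast
qed

text \<open>The stabilizer of \<open>D\<close> fixes \<open>x\<close>, so the conjugates of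
  \<open>x\<close> over \<open>E\<close> are determined by those of \<open>D\<close>; the passage
  from \<open>E\<close> to \<open>Qp\<close> costs the factor from \<open>A\<close>.\<close>

lemma card_orb_disk_field:
  assumes "x \<in> disk_field"
  shows "card (orb x) \<le> deg_bound"
proof -
  have fac: "\<sigma> x = \<tau> x" if st: "\<sigma> \<in> galois_group E" "\<tau> \<in> galois_group E" "\<sigma> ` D = \<tau> ` D" for \<sigma> \<tau>
  proof -
    let ?\<rho> = "inv_into UNIV \<tau> \<circ> \<sigma>"
    have "?\<rho> \<in> galois_group E" by (intro galois_group_comp galois_group_inv st)
    moreover have "?\<rho> ` D = D"
      unfolding image_comp[symmetric] st(3) by (simp add: image_image galois_group_inv_apply(1)[OF st(2)])
    ultimately have "?\<rho> x = x" using assms unfolding field_of_def_Affine fixed_field_def by blast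
    then show ?thesis using galois_group_inv_apply(2)[OF st(2)] by (metis comp_apply)
  qed
  have im: "finite ((\<lambda>\<sigma>. \<sigma> x) ` galois_group E)"
    "card ((\<lambda>\<sigma>. \<sigma> x) ` galois_group E) \<le> card ((\<lambda>\<sigma>. \<sigma> ` D) ` galois_group E)"
    by (rule image_factor[OF finite_orbit_E]; rule fac; assumption)+
  have "card ((\<lambda>\<sigma>. \<sigma> x) ` galois_group Qp) \<le> (\<Prod>a\<in>A. card (orb a)) * card ((\<lambda>\<sigma>. \<sigma> x) ` galois_group E)"
  proof (rule card_galois_image_le[OF A(1)])
    show "(\<sigma> \<circ> \<tau>) x = \<sigma> (\<tau> x)" for \<sigma> \<tau> :: "'a \<Rightarrow> 'a" by simp
  qed (use A(2) im(1) in auto)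
  also have "\<dots> \<le> deg_bound" by (rule mult_left_mono[OF order_trans[OF im(2) k]]) auto
  finally show ?thesis unfolding orb_def .
qed

lemma ram_index_disk_field_pos:
  assumes "fin_ext disk_field K"
  shows "1 \<le> ram_index av disk_field K"
proof -
  obtain N where "0 < N" "\<forall>x\<in>K. x \<noteq> 0 \<longrightarrow> p_power_exp N (av x)" using fin_ext_p_power_exp[OF assms card_orb_disk_field] by auto
  then show ?thesis using fin_ext_type_subfield[OF assms] disk_field_subfield by (intro ram_index_pos) auto
qed

text \<open>Adjoining any point of \<open>D\<close>, algebraic over \<open>Qp\<close>, gives a field
  meeting \<open>D\<close>; so the \<open>LEAST\<close> is attained.\<close>

lemma disk_s_attained:
  "\<exists>K. fin_ext disk_field K \<and> Affine ` K \<inter> Affine ` D \<noteq> {} \<and> ram_index av disk_field K = disk_s av E (Affine ` D)"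
proof -
  obtain a where a: "a \<in> D" using is_disk_nonempty[OF disk_D] by blast
  obtain q where "q \<in> polys_in Qp" "q \<noteq> 0" "poly q a = 0" using algebraic_Qp by blast
  then have alg: "\<exists>q. q \<noteq> 0 \<and> (\<forall>i. coeff q i \<in> disk_field) \<and> poly q a = 0"
    using disk_field_subfield(3) unfolding polys_in_def by blast
  let ?K = "ring.finite_extension ring_of_type_algebra disk_field [a]"
  have "fin_ext disk_field ?K" "a \<in> ?K" using fin_ext_finite_extension[OF disk_field_subfield(1), of "[a]"] alg by auto
  then have "\<exists>s K. fin_ext disk_field K \<and> Affine ` K \<inter> Affine ` D \<noteq> {} \<and> ram_index av disk_field K = s" using a by blast
  then show ?thesis unfolding disk_s_def by (rule LeastI_ex)
qed

lemma disk_s_pos: "1 \<le> disk_s av E (Affine ` D)"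
  using disk_s_attained ram_index_disk_field_pos by metis

lemma val_scale_E_pos: "0 < val_scale av E"
proof (rule val_scale_pos[OF QpE(2,1)])
  show "0 < (fact deg_bound :: nat)" by simp
  show "p_power_exp (fact deg_bound) (av x)" if "x \<in> E" "x \<noteq> 0" for x
    using p_power_exp_of_card_orb[OF that(2) card_orb_disk_field] disk_field_subfield(2) that(1) by blast
qed

text \<open>The predicate under \<open>LEAST\<close> is satisfiable: if the radius
  \<open>av c\<close> has denominator \<open>N\<close>, then \<open>t = N\<close> works with
  \<open>b\<close> a power of \<open>p\<close>, which lies in every field above
  \<open>Qp\<close>.\<close>

lemma disk_t_attained:
  defines "s \<equiv> disk_s av E (Affine ` D)" and "t \<equiv> disk_t av E (Affine ` D)"
  shows "0 < t \<and> (\<exists>K. fin_ext disk_field K \<and> Affine ` K \<inter> Affine ` D \<noteq> {} \<and> ram_index av disk_field K = s \<and>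
     (\<exists>a\<in>K. \<exists>b\<in>K.
        Affine ` D = Affine ` {x. ereal (real (s * t)) * val av E (x - a) \<ge> val av E b} \<or>
        Affine ` D = Affine ` {x. ereal (real (s * t)) * val av E (x - a) > val av E b}))"
  unfolding t_def disk_t_def s_def
proof (rule LeastI_ex)
  obtain K where K: "fin_ext disk_field K" "Affine ` K \<inter> Affine ` D \<noteq> {}" "ram_index av disk_field K = s"
    using disk_s_attained unfolding s_def by blast
  then obtain a where a: "a \<in> K" "a \<in> D" by blast
  obtain c where c: "c \<noteq> 0" "D = {x. av (x - a) \<le> av c} \<or> D = {x. av (x - a) < av c}"
    using D open_disk_recenter[OF _ a(2)] closed_disk_recenter[OF _ a(2)] by blast
  obtain N where N: "0 < N" "p_power_exp N (av c)" using av_p_power_exp[OF c(1)] by blast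
  have s1: "1 \<le> s" unfolding s_def by (rule disk_s_pos)
  have "p_power_exp (s * N) (av c)" using p_power_exp_dvd[OF N(2), of "s * N"] by simp
  then obtain z :: int where z: "av c ^ (s * N) = real p powi z" unfolding p_power_exp_def by blast
  define b where "b = (of_nat p powi (- z) :: 'a)"
  have avb: "av b = real p powi z"
    unfolding b_def av_powi av_p by (simp add: power_int_minus power_int_divide_distrib)
  have b0: "b \<noteq> 0" unfolding b_def using p_gt_1 by simp
  have "b \<in> Qp" unfolding b_def by (auto simp: power_int_def intro!: Qp.power_mem Qp.inverse_mem Qp.of_nat_mem)
  then have bK: "b \<in> K" using fin_ext_type_subfield[OF K(1)] disk_field_subfield(3) by blast
  have sN: "0 < s * N" using s1 N(1) by simp
  have le: "av y ^ (s * N) \<le> av b \<longleftrightarrow> av y \<le> av c" "av y ^ (s * N) < av b \<longleftrightarrow> av y < av c" for y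
  proof -
    show "av y ^ (s * N) \<le> av b \<longleftrightarrow> av y \<le> av c"
      unfolding avb z[symmetric] by (rule power_mono_iff[OF av_nonneg av_nonneg sN])
    have "av c ^ (s * N) \<le> av y ^ (s * N) \<longleftrightarrow> av c \<le> av y" by (rule power_mono_iff[OF av_nonneg av_nonneg sN])
    then show "av y ^ (s * N) < av b \<longleftrightarrow> av y < av c" unfolding avb z[symmetric] by linarith
  qed
  note v = val_ge_iff[OF val_scale_E_pos sN b0]
  have "Affine ` D = Affine ` {x. ereal (real (s * N)) * val av E (x - a) \<ge> val av E b} \<or>
        Affine ` D = Affine ` {x. ereal (real (s * N)) * val av E (x - a) > val av E b}"
    unfolding v le using c(2) by blast
  then show "\<exists>t. 0 < t \<and> (\<exists>K. fin_ext disk_field K \<and> Affine ` K \<inter> Affine ` D \<noteq> {} \<and>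
      ram_index av disk_field K = disk_s av E (Affine ` D) \<and> (\<exists>a\<in>K. \<exists>b\<in>K.
        Affine ` D = Affine ` {x. ereal (real (disk_s av E (Affine ` D) * t)) * val av E (x - a) \<ge> val av E b} \<or>
        Affine ` D = Affine ` {x. ereal (real (disk_s av E (Affine ` D) * t)) * val av E (x - a) > val av E b}))"
    unfolding s_def[symmetric] using N(1) K a(1) bK by blast
qed

lemma disk_complexity_Affine:
  "disk_complexity av E (Affine ` D) = disk_s av E (Affine ` D) * disk_t av E (Affine ` D)"
proof -
  have "Affine ` D \<noteq> UNIV" by blast
  then show ?thesis by (simp add: disk_complexity_def)
qed

lemma disk_complexity_pos: "1 \<le> disk_complexity av E (Affine ` D)"
  using disk_s_pos disk_t_attained unfolding disk_complexity_Affine by simp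

text \<open>Values of the field of definition have denominator \<open>fact deg_bound\<close>.
  Passing to \<open>K\<close>, of ramification index \<open>s \<le> m\<close>, costs a factor
  \<open>fact m\<close>; the radius is a root of order \<open>s * t \<le> m\<close> of a value of
  \<open>K\<close>, which costs \<open>fact m\<close> again.\<close>

lemma disk_complexity_data:
  assumes m: "disk_complexity av E (Affine ` D) \<le> m"
  shows "\<exists>K a \<rho>. type_subfield K \<and> Qp \<subseteq> K \<and> a \<in> K \<and> a \<in> D \<and>
     (\<forall>x\<in>K. x \<noteq> 0 \<longrightarrow> p_power_exp (fact m * fact deg_bound) (av x)) \<and>
     0 < \<rho> \<and> p_power_exp (fact m * (fact m * fact deg_bound)) \<rho> \<and> (D = {x. av (x - a) \<le> \<rho>} \<or> D = {x. av (x - a) < \<rho>})"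
proof -
  define s where "s = disk_s av E (Affine ` D)"
  define t where "t = disk_t av E (Affine ` D)"
  obtain K a b where t: "0 < t" and K: "fin_ext disk_field K" "ram_index av disk_field K = s" and ab: "a \<in> K" "b \<in> K"
    and DD: "Affine ` D = Affine ` {x. ereal (real (s * t)) * val av E (x - a) \<ge> val av E b} \<or>
        Affine ` D = Affine ` {x. ereal (real (s * t)) * val av E (x - a) > val av E b}"
    using disk_t_attained unfolding s_def[symmetric] t_def[symmetric] by blast
  have s1: "1 \<le> s" unfolding s_def by (rule disk_s_pos)
  have st: "0 < s * t" "s * t \<le> m" using s1 t m unfolding disk_complexity_Affine s_def t_def by auto
  have sm: "s \<le> m"
  proof -
    have "s \<le> s * t" using t by simp
    then show ?thesis using st(2) by linarith
  qed
  have Ks: "type_subfield K" "disk_field \<subseteq> K" using fin_ext_type_subfield[OF K(1)] by blast+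
  have D': "D = {x. ereal (real (s * t)) * val av E (x - a) \<ge> val av E b} \<or>
        D = {x. ereal (real (s * t)) * val av E (x - a) > val av E b}"
    using DD unfolding Affine_image_eq_iff .
  \<comment> \<open>Otherwise \<open>val av E b\<close> is infinite and the inequality describes a
    single point or the empty set.\<close>
  have b0: "b \<noteq> 0"
  proof
    assume b: "b = 0"
    have fin: "ereal (real (s * t)) * val av E (x - a) \<noteq> \<infinity>" if "x \<noteq> a" for x
      using that by (simp add: val_def)
    have "val av E b = \<infinity>" using b by (simp add: val_def)
    moreover have "val av E (a - a) = \<infinity>" by (simp add: val_def)
    ultimately have "D = {a} \<or> D = {}" using D' fin st(1) by auto
    then show False using is_disk_not_singleton[OF disk_D] is_disk_nonempty[OF disk_D] by blast
  qed
  have vals: "p_power_exp (fact m * fact deg_bound) (av x)" if x: "x \<in> K" "x \<noteq> 0" for x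
  proof -
    obtain i where i: "1 \<le> i" "i \<le> s" "av x ^ i \<in> av ` (disk_field - {0})"
      using ram_index_power[OF disk_field_subfield(1) Ks(1) _ x] K(2) s1 by auto
    then obtain y where y: "y \<in> disk_field" "y \<noteq> 0" "av x ^ i = av y" by blast
    have "p_power_exp (fact deg_bound) (av x ^ i)" unfolding y(3) by (rule p_power_exp_of_card_orb[OF y(2) card_orb_disk_field[OF y(1)]])
    then have "p_power_exp (i * fact deg_bound) (av x)" by (rule p_power_exp_power)
    moreover have "i dvd (fact m :: nat)" using i sm by (intro dvd_fact) auto
    ultimately show ?thesis by (elim p_power_exp_dvd) (rule mult_dvd_mono, auto)
  qed
  define \<rho> where "\<rho> = root (s * t) (av b)"
  have bpos: "0 < av b" using b0 by (simp add: av_pos_iff)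
  have \<rho>: "0 < \<rho>" "\<rho> ^ (s * t) = av b"
    unfolding \<rho>_def using st(1) bpos by (auto intro: real_root_gt_zero real_root_pow_pos)
  have "p_power_exp (s * t * (fact m * fact deg_bound)) \<rho>"
    by (rule p_power_exp_power) (use vals[OF ab(2) b0] \<rho>(2) in simp)
  moreover have "s * t dvd (fact m :: nat)" using st by (intro dvd_fact) auto
  ultimately have pe: "p_power_exp (fact m * (fact m * fact deg_bound)) \<rho>"
    by (elim p_power_exp_dvd) (rule mult_dvd_mono, auto)
  have le: "av y ^ (s * t) \<le> av b \<longleftrightarrow> av y \<le> \<rho>" "av y ^ (s * t) < av b \<longleftrightarrow> av y < \<rho>" for y
  proof -
    show "av y ^ (s * t) \<le> av b \<longleftrightarrow> av y \<le> \<rho>"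
      unfolding \<rho>(2)[symmetric] by (rule power_mono_iff[OF av_nonneg less_imp_le[OF \<rho>(1)] st(1)])
    have "\<rho> ^ (s * t) \<le> av y ^ (s * t) \<longleftrightarrow> \<rho> \<le> av y"
      by (rule power_mono_iff[OF less_imp_le[OF \<rho>(1)] av_nonneg st(1)])
    then show "av y ^ (s * t) < av b \<longleftrightarrow> av y < \<rho>" unfolding \<rho>(2)[symmetric] by linarith
  qed
  have DR: "D = {x. av (x - a) \<le> \<rho>} \<or> D = {x. av (x - a) < \<rho>}"
    using D' unfolding val_ge_iff[OF val_scale_E_pos st(1) b0] le .
  then have "a \<in> D" using \<rho>(1) by auto
  then show ?thesis
    using Ks disk_field_subfield(3) ab(1) vals \<rho>(1) pe DR
    by (intro exI[of _ K] exI[of _ a] exI[of _ \<rho>]) auto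
qed

end

text \<open>Centres, \<open>c\<close> and residues in \<open>L\<close> put the generic point of a
  disk into \<open>L\<close>, where the sets agree by assumption.\<close>

lemma same_points_same_set:
  assumes L: "type_subfield L" "c \<in> L" "S \<subseteq> L" and w: "0 < av c" "av c < 1"
    and S: "finite S" "0 \<in> S" "\<And>x. x \<in> S \<Longrightarrow> av x \<le> 1" "\<And>x y. x \<in> S \<Longrightarrow> y \<in> S \<Longrightarrow> x \<noteq> y \<Longrightarrow> av (x - y) = 1"
    and P: "disk_decomp X P" "disk_decomp X' P'" "Suc (card (disks_of P \<union> disks_of P')) < card S"
    and lev: "\<And>B. B \<in> disks_of P \<union> disks_of P' \<Longrightarrow> \<exists>i. \<exists>b\<in>L. B = level_disk (av c) i b"
    and agree: "X \<inter> L = X' \<inter> L"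
  shows "X \<subseteq> X'"
proof
  fix y assume y: "y \<in> X"
  interpret L: type_subfield L by fact
  let ?B = "disks_of P \<union> disks_of P'"
  have finB: "finite ?B" using disks_of_finite P(1,2) by blast
  have lev': "\<exists>i b. B = level_disk (av c) i b" if "B \<in> ?B" for B using lev[OF that] by blast
  have "{B \<in> ?B. y \<in> B} \<noteq> {}"
  proof -
    obtain e where e: "e \<in> P" "y \<in> holed_disk e" using y disk_decompD(2)[OF P(1)] by blast
    then have "y \<in> fst e" "fst e \<in> ?B" by (auto simp: holed_disk_def disks_of_def)
    then show ?thesis by blast
  qed
  moreover have "finite {B \<in> ?B. y \<in> B}" using finB by simp
  ultimately obtain D where D: "D \<in> {B \<in> ?B. y \<in> B}" "\<forall>B\<in>{B \<in> ?B. y \<in> B}. B \<subseteq> D \<longrightarrow> D = B"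
    using finite_has_minimal[of "{B \<in> ?B. y \<in> B}"] by blast
  have DB: "D \<in> ?B" "y \<in> D" using D(1) by blast+
  obtain j a where a: "a \<in> L" "D = level_disk (av c) j a" using lev[OF DB(1)] by blast
  obtain s where s: "s \<in> S" "\<forall>B\<in>?B. a + c powi j * s \<in> B \<longleftrightarrow> D \<subseteq> B"
    using generic_inside[OF w refl S finB P(3) lev', of a j] unfolding a(2) by blast
  let ?x = "a + c powi j * s"
  have "c powi j \<in> L" using L(2) by (auto simp: power_int_def intro: L.power_mem L.inverse_mem)
  then have xL: "?x \<in> L" using a(1) s(1) L(3) by (intro L.add_mem L.mult_mem) auto
  have yB: "y \<in> B \<longleftrightarrow> D \<subseteq> B" if B: "B \<in> ?B" for B
  proof
    assume yB: "y \<in> B"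
    obtain i b where b: "B = level_disk (av c) i b" using lev'[OF B] by blast
    \<comment> \<open>Recentred at \<open>y\<close>, the two disks are compared by their levels
      alone, so they are nested.\<close>
    have By: "B = level_disk (av c) i y" using level_disk_recenter[of y "av c" i b] yB b by simp
    have Dy: "D = level_disk (av c) j y" using level_disk_recenter[of y "av c" j a] DB(2) a(2) by simp
    show "D \<subseteq> B"
    proof (cases "i \<le> j")
      case True
      then show ?thesis unfolding By Dy by (rule level_disk_mono[OF w])
    next
      case False
      then have "j \<le> i" by simp
      then have "B \<subseteq> D" unfolding By Dy by (rule level_disk_mono[OF w])
      then show ?thesis using D(2) B yB by blast
    qed
  qed (use DB(2) in blast)
  have xy: "?x \<in> B \<longleftrightarrow> y \<in> B" if "B \<in> ?B" for B using s(2) yB[OF that] that by blast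
  have "?x \<in> X \<longleftrightarrow> y \<in> X" by (rule disk_decomp_agree[OF P(1)]) (rule xy, blast)
  then have "?x \<in> X'" using y xL agree by blast
  moreover have "?x \<in> X' \<longleftrightarrow> y \<in> X'" by (rule disk_decomp_agree[OF P(2)]) (rule xy, blast)
  ultimately show "y \<in> X'" by blast
qed

theorem standard_subsets_determined:
  assumes E: "fin_ext Qp E"
  shows "\<exists>L. fin_ext E L \<and>
     (\<forall>X X'. standard av (Affine ` X) \<and> defined_over E (Affine ` X) \<and> complexity av E (Affine ` X) \<le> m \<and>
        standard av (Affine ` X') \<and> defined_over E (Affine ` X') \<and> complexity av E (Affine ` X') \<le> m \<and>
        X \<inter> L = X' \<inter> L \<longrightarrow> X = X')"
proof -
  have QpE: "Qp \<subseteq> E" "type_subfield E" using fin_ext_type_subfield[OF E] by blast+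
  obtain A where A: "finite A" "\<forall>\<sigma>\<in>galois_group Qp. (\<forall>a\<in>A. \<sigma> a = a) \<longrightarrow> \<sigma> \<in> galois_group E"
    by (rule fin_ext_galois_determined[OF E]) blast
  \<comment> \<open>\<open>\<nu>\<close> bounds the conjugates of each disk over \<open>Qp\<close>
    and the degrees in its field of definition. \<open>N0\<close> is a denominator for the field
    \<open>K\<close> meeting the disk, \<open>N\<close> one for the radius, and \<open>n\<close>
    bounds the degree of the point from \<open>bounded_degree_point\<close>.\<close>
  define \<nu> where "\<nu> = (\<Prod>a\<in>A. card (orb a)) * m"
  define N0 where "N0 = (fact m * fact \<nu> :: nat)"
  define N where "N = fact m * N0"
  have N0: "0 < N0" "0 < N" by (simp_all add: N0_def N_def)
  define n where "n = card (\<Union>l\<in>{1..\<nu>}. roots_of_frobenius l) ^ N0"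
  obtain B where B: "finite B" "\<forall>D a. is_disk D \<longrightarrow> a \<in> D \<longrightarrow> card (orb a) \<le> n \<longrightarrow>
     card ((\<lambda>\<sigma>. \<sigma> ` D) ` galois_group (Qp \<union> {})) \<le> \<nu> \<longrightarrow> D \<inter> fixed_field (galois_group (Qp \<union> B)) \<noteq> {}"
    using disks_meet_fixed_field[OF finite.emptyI, of n \<nu>] by blast
  obtain c where c: "av c ^ (2 * N) = 1 / real p" "0 < av c" "av c < 1" using uniformizer_root[OF N0(2)] .
  \<comment> \<open>Two families of at most \<open>m\<close> disks each, and the strict bound with
    \<open>Suc\<close>, ask for \<open>2 * m + 2\<close> residues.\<close>
  obtain S where S: "finite S" "card S = Suc (2 * m + 1)" "0 \<in> S" "\<forall>x\<in>S. av x \<le> 1"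
    "\<forall>x\<in>S. \<forall>y\<in>S. x \<noteq> y \<longrightarrow> av (x - y) = 1"
    using residue_system[of "2 * m + 1"] by (elim exE conjE) (rule that)
  obtain xs where xs: "set xs = B \<union> insert c S" using finite_list[of "B \<union> insert c S"] B(1) S(1) by auto
  define L where "L = ring.finite_extension (ring_of_type_algebra :: 'a ring) E xs"
  have alg: "\<exists>q. q \<noteq> 0 \<and> (\<forall>i. coeff q i \<in> E) \<and> poly q x = 0" for x
    using algebraic_Qp[of x] QpE(1) unfolding polys_in_def by blast
  have L: "fin_ext E L" "set xs \<subseteq> L" unfolding L_def by (rule fin_ext_finite_extension[OF QpE(2) alg])+
  have Ls: "type_subfield L" "Qp \<subseteq> L" "c \<in> L" "S \<subseteq> L" "B \<subseteq> L"
    using fin_ext_type_subfield[OF L(1)] QpE L(2) xs by auto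
  have fixL: "fixed_field (galois_group (Qp \<union> B)) \<subseteq> L"
  proof -
    have "galois_group L \<subseteq> galois_group (Qp \<union> B)" using Ls(2,5) by (intro galois_group_antimono) blast
    then have "fixed_field (galois_group (Qp \<union> B)) \<subseteq> fixed_field (galois_group L)" by (auto simp: fixed_field_def)
    then show ?thesis using fixed_field_galois_group[OF Ls(1,2)] by simp
  qed
  have good: "\<exists>P. disk_decomp X P \<and> card (disks_of P) \<le> m \<and>
      (\<forall>D\<in>disks_of P. \<exists>i. \<exists>b\<in>L. D = level_disk (av c) i b)"
    if X: "standard av (Affine ` X)" "defined_over E (Affine ` X)" "complexity av E (Affine ` X) \<le> m" for X
  proof -
    obtain P where P: "disk_decomp X P"
      "\<forall>D\<in>disks_of P. disk_complexity av E (Affine ` D) \<le> complexity av E (Affine ` X)"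
      "(\<forall>D\<in>disks_of P. 1 \<le> disk_complexity av E (Affine ` D)) \<longrightarrow> card (disks_of P) \<le> complexity av E (Affine ` X)"
      using standard_disk_decomp[OF X(1), of E] by blast
    have stab: "\<sigma> ` X = X" if "\<sigma> \<in> galois_group E" for \<sigma>
      using X(2) that unfolding defined_over_def set_stabilizer_def map_proj_line_Affine_image Affine_image_eq_iff by blast
    have orbit: "card ((\<lambda>\<sigma>. \<sigma> ` D) ` galois_group E) \<le> card (disks_of P)" if D: "D \<in> disks_of P" for D
    proof (rule card_mono[OF disks_of_finite[OF P(1)]])
      show "(\<lambda>\<sigma>. \<sigma> ` D) ` galois_group E \<subseteq> disks_of P"
        using disks_of_galois_stable[OF _ P(1) _ D] stab galois_group_antimono[OF QpE(1)] by blast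
    qed
    \<comment> \<open>Positivity comes first, with the number of disks itself as the orbit bound;
      only then is that number known to be at most \<open>m\<close>.\<close>
    have "1 \<le> disk_complexity av E (Affine ` D)" if "D \<in> disks_of P" for D
      by (rule disk_complexity_pos[OF E A disks_of_open_or_closed[OF P(1) that] orbit[OF that]])
    then have card: "card (disks_of P) \<le> m" using P(3) X(3) by fastforce
    have "\<exists>i. \<exists>b\<in>L. D = level_disk (av c) i b" if D: "D \<in> disks_of P" for D
    proof -
      note oc = disks_of_open_or_closed[OF P(1) D]
      have km: "card ((\<lambda>\<sigma>. \<sigma> ` D) ` galois_group E) \<le> m" using orbit[OF D] card by linarith
      have cm: "disk_complexity av E (Affine ` D) \<le> m" using P(2) D X(3) by fastforce
      have "\<exists>K a \<rho>. type_subfield K \<and> Qp \<subseteq> K \<and> a \<in> K \<and> a \<in> D \<and>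
         (\<forall>x\<in>K. x \<noteq> 0 \<longrightarrow> p_power_exp N0 (av x)) \<and>
         0 < \<rho> \<and> p_power_exp N \<rho> \<and> (D = {x. av (x - a) \<le> \<rho>} \<or> D = {x. av (x - a) < \<rho>})"
        unfolding N_def N0_def \<nu>_def by (rule disk_complexity_data[OF E A oc km cm])
      then obtain K a \<rho> where K: "type_subfield K" "Qp \<subseteq> K" "a \<in> K" "a \<in> D"
        "\<And>x. x \<in> K \<Longrightarrow> x \<noteq> 0 \<Longrightarrow> p_power_exp N0 (av x)"
        and \<rho>: "0 < \<rho>" "p_power_exp N \<rho>" "D = {x. av (x - a) \<le> \<rho>} \<or> D = {x. av (x - a) < \<rho>}" by auto
      have dD: "is_disk D" using oc open_disk_is_disk closed_disk_is_disk by blast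
      have orbQ: "card ((\<lambda>\<sigma>. \<sigma> ` D) ` galois_group Qp) \<le> \<nu>"
        unfolding \<nu>_def by (rule card_disk_orbit_Qp[OF E A oc km])
      obtain a' where a': "a' \<in> D" "card (orb a') \<le> n"
        using bounded_degree_point[OF dD orbQ N0(1) K(4,3,1,2)] K(5) unfolding n_def p_power_exp_def by blast
      have "D \<inter> fixed_field (galois_group (Qp \<union> B)) \<noteq> {}" using B(2) dD a' orbQ by simp
      then obtain b where b: "b \<in> D" "b \<in> L" using fixL by blast
      \<comment> \<open>The level is read off at the centre \<open>a\<close> in \<open>K\<close>;
        the centre is then moved to \<open>b\<close> in \<open>L\<close>.\<close>
      obtain j where "D = level_disk (av c) j a"
        using \<rho>(3) level_disk_of_radius[OF c(2,1) N0(2) \<rho>(1,2), of a] by metis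
      then have "D = level_disk (av c) j b" using level_disk_recenter b(1) by metis
      then show ?thesis using b(2) by blast
    qed
    then show ?thesis using P(1) card by blast
  qed
  have sub: "X \<subseteq> X'"
    if X: "standard av (Affine ` X)" "defined_over E (Affine ` X)" "complexity av E (Affine ` X) \<le> m"
      and X': "standard av (Affine ` X')" "defined_over E (Affine ` X')" "complexity av E (Affine ` X') \<le> m"
      and agree: "X \<inter> L = X' \<inter> L" for X X'
  proof -
    obtain P where P: "disk_decomp X P" "card (disks_of P) \<le> m"
      "\<forall>D\<in>disks_of P. \<exists>i. \<exists>b\<in>L. D = level_disk (av c) i b" using good[OF X] by blast
    obtain P' where P': "disk_decomp X' P'" "card (disks_of P') \<le> m"
      "\<forall>D\<in>disks_of P'. \<exists>i. \<exists>b\<in>L. D = level_disk (av c) i b" using good[OF X'] by blast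
    have "card (disks_of P \<union> disks_of P') \<le> 2 * m" using card_Un_le[of "disks_of P" "disks_of P'"] P(2) P'(2) by linarith
    then have "Suc (card (disks_of P \<union> disks_of P')) < card S" using S(2) by simp
    then show ?thesis
      using P(3) P'(3) S agree
      by (intro same_points_same_set[OF Ls(1,3,4) c(2,3) S(1,3) _ _ P(1) P'(1)]) auto
  qed
  show ?thesis using L(1) sub by (intro exI[of _ L]) (auto intro!: equalityI)
qed

end

theorem theorem4p16:
  fixes p :: nat and Qp :: "'a :: field_char_0 set" and av :: "'a \<Rightarrow> real"
    and E :: "'a set" and m :: nat
  assumes "padic_closure p Qp av"
    and "fin_ext Qp E"
    and "0 < m"
  shows "\<exists>\<E>. finite \<E> \<and> (\<forall>F\<in>\<E>. fin_ext E F) \<and>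
           (\<forall>X X'.
              standard av (Affine ` X) \<and> defined_over E (Affine ` X) \<and>
              complexity av E (Affine ` X) \<le> m \<and>
              standard av (Affine ` X') \<and> defined_over E (Affine ` X') \<and>
              complexity av E (Affine ` X') \<le> m \<and>
              (\<forall>F\<in>\<E>. X \<inter> F = X' \<inter> F)
              \<longrightarrow> X = X')"
proof -
  obtain L where L: "fin_ext E L" "\<forall>X X'. standard av (Affine ` X) \<and> defined_over E (Affine ` X) \<and>
        complexity av E (Affine ` X) \<le> m \<and> standard av (Affine ` X') \<and> defined_over E (Affine ` X') \<and>
        complexity av E (Affine ` X') \<le> m \<and> X \<inter> L = X' \<inter> L \<longrightarrow> X = X'"
    using padic_closure.standard_subsets_determined[OF assms(1,2), of m] by blast
  show ?thesis by (rule exI[of _ "{L}"]) (use L in simp)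
qed

end
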